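(* Let $\mathcal{M}$ be a preadditive braided monoidal category which has equalizers and denumerable coproducts and whose tensor products are additive and preserve equalizers and denumerable coproducts. Let $(\mathbf{T},\mathbf{P})$ be the adjunction, with unit $\boldsymbol{\eta}$ and counit $\boldsymbol{\epsilon}$, between the tensor bialgebra functor $\mathbf{T}:\mathcal{M}\to\mathrm{Bialg}(\mathcal{M})$ and the primitive functor $\mathbf{P}:\mathrm{Bialg}(\mathcal{M})\to\mathcal{M}$. Set $\boldsymbol{\gamma}:=\omega\circ\xi\mathbf{T}:\mathbf{P}\mathbf{T}\to\mathrm{Id}_{\mathcal{M}}$. Then $\boldsymbol{\gamma}\circ\boldsymbol{\eta}=\mathrm{Id}$ and $\boldsymbol{\gamma}\boldsymbol{\gamma}=\boldsymbol{\gamma}\circ\mathbf{P}\boldsymbol{\epsilon}\mathbf{T}$. Hence the functor $\mathbf{T}:\mathcal{M}\to\mathrm{Bialg}(\mathcal{M})$ is h-separable.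
   Context: A functor $F:\mathcal{B}\to\mathcal{A}$ is h-separable (heavily separable) if there are maps $P_{X,Y}:\mathrm{Hom}_{\mathcal{A}}(FX,FY)\to\mathrm{Hom}_{\mathcal{B}}(X,Y)$, natural in $X,Y\in\mathcal{B}$, such that $P_{X,Y}(Ff)=f$ for every $f:X\to Y$ in $\mathcal{B}$, and $P_{X,Z}(f\circ g)=P_{Y,Z}(f)\circ P_{X,Y}(g)$ for all $X,Y,Z\in\mathcal{B}$ and all $g:FX\to FY$, $f:FY\to FZ$ in $\mathcal{A}$. $\mathrm{Alg}(\mathcal{M})$ and $\mathrm{Bialg}(\mathcal{M})$ are the categories of algebras (monoids) and bialgebras (bimonoids, using the braiding) in $\mathcal{M}$; $\mho:\mathrm{Bialg}(\mathcal{M})\to\mathrm{Alg}(\mathcal{M})$ and $\Omega:\mathrm{Alg}(\mathcal{M})\to\mathcal{M}$ are the forgetful functors. $\mathbf{1}$ is the unit object, $l_V:\mathbf{1}\otimes V\to V$ and $r_V:V\otimes\mathbf{1}\to V$ are the unit constraints. $T:\mathcal{M}\to\mathrm{Alg}(\mathcal{M})$ is the tensor algebra functor, left adjoint to $\Omega$: $\Omega TV=\bigoplus_{n\in\mathbb{N}}V^{\otimes n}$, with canonical inclusions $\alpha_nV:V^{\otimes n}\to\Omega TV$ and multiplication by concatenation. The unit of $(T,\Omega)$ is $\eta V=\alpha_1V$, and its counit $\epsilon$ is determined by $\Omega\epsilon(A,m,u)\circ\alpha_nA=m^{n-1}$, the iterated multiplication ($m^{-1}=u$, $m^0=\mathrm{Id}_A$,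 $m^{n-1}=m\circ(m^{n-2}\otimes A)$ for $n\ge 2$). $\mathbf{T}V$ is the algebra $TV$ with the unique bialgebra structure whose comultiplication $\Delta$ and counit $\varepsilon$ are algebra morphisms satisfying $\Delta\circ\alpha_1V=(\alpha_1V\otimes u)\circ r_V^{-1}+(u\otimes\alpha_1V)\circ l_V^{-1}$ and $\varepsilon\circ\alpha_1V=0$, where $u$ is the unit of $TV$; thus $\mho\circ\mathbf{T}=T$. For a bialgebra $B$ with underlying object $\Omega\mho B$, $\xi B:\mathbf{P}B\to\Omega\mho B$ is the equalizer of $\Delta_B$ and $(u_B\otimes\Omega\mho B)\circ l^{-1}_{\Omega\mho B}+(\Omega\mho B\otimes u_B)\circ r^{-1}_{\Omega\mho B}$ (the inclusion of the primitive part); this defines $\mathbf{P}$ and a natural transformation $\xi:\mathbf{P}\to\Omega\mho$. The functor $\mathbf{T}$ is left adjoint to $\mathbf{P}$, with unit and counit determined by $\xi\mathbf{T}\circ\boldsymbol{\eta}=\eta$ and $\mho\boldsymbol{\epsilon}=\epsilon\mho\circ T\xi$; equivalently $\xi=\Omega\mho\boldsymbol{\epsilon}\circ\eta\mathbf{P}$. $\omega:\Omega T\to\mathrm{Id}_{\mathcal{M}}$ is the natural transformation determined by $\omega V\circ\alpha_nV=\delta_{n,1}\mathrm{Id}_V$ for all $n\in\mathbb{N}$, i.e. the identity of $V$ for $n=1$ and the zero morphism for $n\ne 1$. Finally $\boldsymbol{\gamma}\boldsymbol{\gamma}=\boldsymbol{\gamma}\circ\mathbf{P}\mathbf{T}\boldsymbol{\gamma}$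 is the horizontal composite. *)

theory Defs
  imports "HOL-Algebra.Group"
begin

text \<open>
  HOL-Algebra is only used for abelian groups; its symbol for the group operation is freed
  and used for tensor products of morphisms. Tensor products of objects are written with
  \<open>\<odot>\<close>.
\<close>

no_notation mult (infixl "\<otimes>\<index>" 70)

section \<open>Categories, functors, natural transformations\<close>

record ('o, 'a) cat =
  Obj :: "'o set"
  Arr :: "'a set"
  Dom :: "'a \<Rightarrow> 'o"
  Cod :: "'a \<Rightarrow> 'o"
  Ident :: "'o \<Rightarrow> 'a" ("\<one>\<^sub>a\<index>")
  Comp :: "'a \<Rightarrow> 'a \<Rightarrow> 'a" (infixr "\<cdot>\<index>" 60)

definition Hom :: "('o, 'a, 'z) cat_scheme \<Rightarrow> 'o \<Rightarrow> 'o \<Rightarrow> 'a set" where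
  "Hom C X Y = {f \<in> Arr C. Dom C f = X \<and> Cod C f = Y}"

locale category =
  fixes C :: "('o, 'a, 'z) cat_scheme" (structure)
  assumes dom_obj: "f \<in> Arr C \<Longrightarrow> Dom C f \<in> Obj C"
    and cod_obj: "f \<in> Arr C \<Longrightarrow> Cod C f \<in> Obj C"
    and ident_hom: "X \<in> Obj C \<Longrightarrow> \<one>\<^sub>a X \<in> Hom C X X"
    and comp_hom: "\<lbrakk>f \<in> Hom C X Y; g \<in> Hom C Y Z\<rbrakk> \<Longrightarrow> g \<cdot> f \<in> Hom C X Z"
    and comp_ident: "f \<in> Hom C X Y \<Longrightarrow> f \<cdot> \<one>\<^sub>a X = f"
    and ident_comp: "f \<in> Hom C X Y \<Longrightarrow> \<one>\<^sub>a Y \<cdot> f = f"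
    and comp_assoc: "\<lbrakk>f \<in> Hom C W X; g \<in> Hom C X Y; h \<in> Hom C Y Z\<rbrakk> \<Longrightarrow>
      (h \<cdot> g) \<cdot> f = h \<cdot> (g \<cdot> f)"

definition is_inverse :: "('o, 'a, 'z) cat_scheme \<Rightarrow> 'a \<Rightarrow> 'a \<Rightarrow> bool" where
  "is_inverse C f g \<longleftrightarrow> g \<in> Hom C (Cod C f) (Dom C f) \<and>
     g \<cdot>\<^bsub>C\<^esub> f = \<one>\<^sub>a\<^bsub>C\<^esub> (Dom C f) \<and> f \<cdot>\<^bsub>C\<^esub> g = \<one>\<^sub>a\<^bsub>C\<^esub> (Cod C f)"

definition is_iso :: "('o, 'a, 'z) cat_scheme \<Rightarrow> 'a \<Rightarrow> bool" where
  "is_iso C f \<longleftrightarrow> f \<in> Arr C \<and> (\<exists>g. is_inverse C f g)"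

definition inv_arr :: "('o, 'a, 'z) cat_scheme \<Rightarrow> 'a \<Rightarrow> 'a" where
  "inv_arr C f = (THE g. is_inverse C f g)"

record ('o, 'a, 'p, 'b) funct =
  FO :: "'o \<Rightarrow> 'p"
  FA :: "'a \<Rightarrow> 'b"

definition is_functor ::
  "('o, 'a, 'y) cat_scheme \<Rightarrow> ('p, 'b, 'z) cat_scheme \<Rightarrow> ('o, 'a, 'p, 'b) funct \<Rightarrow> bool" where
  "is_functor C D F \<longleftrightarrow> category C \<and> category D \<and>
     (\<forall>X \<in> Obj C. FO F X \<in> Obj D) \<and>
     (\<forall>f \<in> Arr C. FA F f \<in> Hom D (FO F (Dom C f)) (FO F (Cod C f))) \<and>
     (\<forall>X \<in> Obj C. FA F (\<one>\<^sub>a\<^bsub>C\<^esub> X) = \<one>\<^sub>a\<^bsub>D\<^esub> (FO F X)) \<and>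
     (\<forall>f \<in> Arr C. \<forall>g \<in> Arr C. Dom C g = Cod C f \<longrightarrow>
        FA F (g \<cdot>\<^bsub>C\<^esub> f) = FA F g \<cdot>\<^bsub>D\<^esub> FA F f)"

definition id_functor :: "('o, 'a, 'o, 'a) funct" where
  "id_functor = \<lparr>FO = (\<lambda>X. X), FA = (\<lambda>f. f)\<rparr>"

definition comp_functor ::
  "('p, 'b, 'q, 'c) funct \<Rightarrow> ('o, 'a, 'p, 'b) funct \<Rightarrow> ('o, 'a, 'q, 'c) funct"
  (infixr "\<circ>\<^sub>F" 60) where
  "G \<circ>\<^sub>F F = \<lparr>FO = (\<lambda>X. FO G (FO F X)), FA = (\<lambda>f. FA G (FA F f))\<rparr>"

definition nat_trans ::
  "('o, 'a, 'y) cat_scheme \<Rightarrow> ('p, 'b, 'z) cat_scheme \<Rightarrow>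
   ('o, 'a, 'p, 'b) funct \<Rightarrow> ('o, 'a, 'p, 'b) funct \<Rightarrow> ('o \<Rightarrow> 'b) \<Rightarrow> bool" where
  "nat_trans C D F G t \<longleftrightarrow> is_functor C D F \<and> is_functor C D G \<and>
     (\<forall>X \<in> Obj C. t X \<in> Hom D (FO F X) (FO G X)) \<and>
     (\<forall>f \<in> Arr C. FA G f \<cdot>\<^bsub>D\<^esub> t (Dom C f) = t (Cod C f) \<cdot>\<^bsub>D\<^esub> FA F f)"

definition adjunction ::
  "('o, 'a, 'y) cat_scheme \<Rightarrow> ('p, 'b, 'z) cat_scheme \<Rightarrow>
   ('o, 'a, 'p, 'b) funct \<Rightarrow> ('p, 'b, 'o, 'a) funct \<Rightarrow> ('o \<Rightarrow> 'a) \<Rightarrow> ('p \<Rightarrow> 'b) \<Rightarrow> bool" where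
  "adjunction C D L R eta eps \<longleftrightarrow>
     nat_trans C C id_functor (R \<circ>\<^sub>F L) eta \<and>
     nat_trans D D (L \<circ>\<^sub>F R) id_functor eps \<and>
     (\<forall>X \<in> Obj C. eps (FO L X) \<cdot>\<^bsub>D\<^esub> FA L (eta X) = \<one>\<^sub>a\<^bsub>D\<^esub> (FO L X)) \<and>
     (\<forall>Y \<in> Obj D. FA R (eps Y) \<cdot>\<^bsub>C\<^esub> eta (FO R Y) = \<one>\<^sub>a\<^bsub>C\<^esub> (FO R Y))"

definition h_separable ::
  "('p, 'b, 'y) cat_scheme \<Rightarrow> ('o, 'a, 'z) cat_scheme \<Rightarrow> ('p, 'b, 'o, 'a) funct \<Rightarrow> bool" where
  "h_separable B A F \<longleftrightarrow> is_functor B A F \<and>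
     (\<exists>P :: 'p \<Rightarrow> 'p \<Rightarrow> 'a \<Rightarrow> 'b.
        (\<forall>X \<in> Obj B. \<forall>Y \<in> Obj B. \<forall>f \<in> Hom A (FO F X) (FO F Y). P X Y f \<in> Hom B X Y) \<and>
        (\<forall>X \<in> Obj B. \<forall>Y \<in> Obj B. \<forall>X' \<in> Obj B. \<forall>Y' \<in> Obj B.
           \<forall>h \<in> Hom B X' X. \<forall>k \<in> Hom B Y Y'. \<forall>f \<in> Hom A (FO F X) (FO F Y).
             P X' Y' (FA F k \<cdot>\<^bsub>A\<^esub> f \<cdot>\<^bsub>A\<^esub> FA F h) = k \<cdot>\<^bsub>B\<^esub> P X Y f \<cdot>\<^bsub>B\<^esub> h) \<and>
        (\<forall>X \<in> Obj B. \<forall>Y \<in> Obj B. \<forall>f \<in> Hom B X Y. P X Y (FA F f) = f) \<and>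
        (\<forall>X \<in> Obj B. \<forall>Y \<in> Obj B. \<forall>Z \<in> Obj B.
           \<forall>g \<in> Hom A (FO F X) (FO F Y). \<forall>f \<in> Hom A (FO F Y) (FO F Z).
             P X Z (f \<cdot>\<^bsub>A\<^esub> g) = P Y Z f \<cdot>\<^bsub>B\<^esub> P X Y g))"

section \<open>Equalizers and denumerable coproducts\<close>

definition is_equalizer :: "('o, 'a, 'z) cat_scheme \<Rightarrow> 'a \<Rightarrow> 'a \<Rightarrow> 'a \<Rightarrow> bool" where
  "is_equalizer C f g e \<longleftrightarrow>
     f \<in> Arr C \<and> g \<in> Hom C (Dom C f) (Cod C f) \<and>
     e \<in> Arr C \<and> Cod C e = Dom C f \<and> f \<cdot>\<^bsub>C\<^esub> e = g \<cdot>\<^bsub>C\<^esub> e \<and>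
     (\<forall>h \<in> Arr C. Cod C h = Dom C f \<and> f \<cdot>\<^bsub>C\<^esub> h = g \<cdot>\<^bsub>C\<^esub> h \<longrightarrow>
        (\<exists>!k. k \<in> Hom C (Dom C h) (Dom C e) \<and> e \<cdot>\<^bsub>C\<^esub> k = h))"

definition is_coproduct ::
  "('o, 'a, 'z) cat_scheme \<Rightarrow> (nat \<Rightarrow> 'o) \<Rightarrow> 'o \<Rightarrow> (nat \<Rightarrow> 'a) \<Rightarrow> bool" where
  "is_coproduct C V S i \<longleftrightarrow> S \<in> Obj C \<and> (\<forall>n. i n \<in> Hom C (V n) S) \<and>
     (\<forall>Y \<in> Obj C. \<forall>g. (\<forall>n. g n \<in> Hom C (V n) Y) \<longrightarrow>
        (\<exists>!h. h \<in> Hom C S Y \<and> (\<forall>n. h \<cdot>\<^bsub>C\<^esub> i n = g n)))"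

definition has_equalizers :: "('o, 'a, 'z) cat_scheme \<Rightarrow> bool" where
  "has_equalizers C \<longleftrightarrow>
     (\<forall>f \<in> Arr C. \<forall>g \<in> Hom C (Dom C f) (Cod C f). \<exists>e. is_equalizer C f g e)"

definition has_denumerable_coproducts :: "('o, 'a, 'z) cat_scheme \<Rightarrow> bool" where
  "has_denumerable_coproducts C \<longleftrightarrow>
     (\<forall>V. (\<forall>n. V n \<in> Obj C) \<longrightarrow> (\<exists>S i. is_coproduct C V S i))"

definition preserves_equalizers ::
  "('o, 'a, 'y) cat_scheme \<Rightarrow> ('p, 'b, 'z) cat_scheme \<Rightarrow> ('o, 'a, 'p, 'b) funct \<Rightarrow> bool" where
  "preserves_equalizers C D F \<longleftrightarrow>
     (\<forall>f g e. is_equalizer C f g e \<longrightarrow> is_equalizer D (FA F f) (FA F g) (FA F e))"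

definition preserves_denumerable_coproducts ::
  "('o, 'a, 'y) cat_scheme \<Rightarrow> ('p, 'b, 'z) cat_scheme \<Rightarrow> ('o, 'a, 'p, 'b) funct \<Rightarrow> bool" where
  "preserves_denumerable_coproducts C D F \<longleftrightarrow>
     (\<forall>V S i. (\<forall>n. V n \<in> Obj C) \<and> is_coproduct C V S i \<longrightarrow>
        is_coproduct D (\<lambda>n. FO F (V n)) (FO F S) (\<lambda>n. FA F (i n)))"

section \<open>Braided monoidal and preadditive categories\<close>

text \<open>
  No strictness is assumed: \<open>Assoc X Y Z : (X \<odot> Y) \<odot> Z \<rightarrow> X \<odot> (Y \<odot> Z)\<close>.
\<close>

record ('o, 'a) moncat = "('o, 'a) cat" +
  TenO :: "'o \<Rightarrow> 'o \<Rightarrow> 'o" (infixr "\<odot>\<index>" 70)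
  TenA :: "'a \<Rightarrow> 'a \<Rightarrow> 'a" (infixr "\<otimes>\<index>" 70)
  UnitO :: "'o"
  Assoc :: "'o \<Rightarrow> 'o \<Rightarrow> 'o \<Rightarrow> 'a"
  LUnit :: "'o \<Rightarrow> 'a"
  RUnit :: "'o \<Rightarrow> 'a"

locale monoidal_category = category M for M :: "('o, 'a, 'z) moncat_scheme" (structure) +
  assumes unit_obj: "UnitO M \<in> Obj M"
    and ten_obj: "\<lbrakk>X \<in> Obj M; Y \<in> Obj M\<rbrakk> \<Longrightarrow> X \<odot> Y \<in> Obj M"
    and ten_hom: "\<lbrakk>f \<in> Hom M X Y; g \<in> Hom M X' Y'\<rbrakk> \<Longrightarrow> f \<otimes> g \<in> Hom M (X \<odot> X') (Y \<odot> Y')"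
    and ten_ident: "\<lbrakk>X \<in> Obj M; Y \<in> Obj M\<rbrakk> \<Longrightarrow> \<one>\<^sub>a X \<otimes> \<one>\<^sub>a Y = \<one>\<^sub>a (X \<odot> Y)"
    and ten_comp: "\<lbrakk>f \<in> Hom M X Y; g \<in> Hom M Y Z; f' \<in> Hom M X' Y'; g' \<in> Hom M Y' Z'\<rbrakk> \<Longrightarrow>
      (g \<cdot> f) \<otimes> (g' \<cdot> f') = (g \<otimes> g') \<cdot> (f \<otimes> f')"
    and assoc_hom: "\<lbrakk>X \<in> Obj M; Y \<in> Obj M; Z \<in> Obj M\<rbrakk> \<Longrightarrow>
      Assoc M X Y Z \<in> Hom M ((X \<odot> Y) \<odot> Z) (X \<odot> (Y \<odot> Z))"
    and assoc_iso: "\<lbrakk>X \<in> Obj M; Y \<in> Obj M; Z \<in> Obj M\<rbrakk> \<Longrightarrow> is_iso M (Assoc M X Y Z)"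
    and assoc_nat: "\<lbrakk>f \<in> Hom M X X'; g \<in> Hom M Y Y'; h \<in> Hom M Z Z'\<rbrakk> \<Longrightarrow>
      Assoc M X' Y' Z' \<cdot> ((f \<otimes> g) \<otimes> h) = (f \<otimes> (g \<otimes> h)) \<cdot> Assoc M X Y Z"
    and lunit_hom: "X \<in> Obj M \<Longrightarrow> LUnit M X \<in> Hom M (UnitO M \<odot> X) X"
    and lunit_iso: "X \<in> Obj M \<Longrightarrow> is_iso M (LUnit M X)"
    and lunit_nat: "f \<in> Hom M X Y \<Longrightarrow>
      LUnit M Y \<cdot> (\<one>\<^sub>a (UnitO M) \<otimes> f) = f \<cdot> LUnit M X"
    and runit_hom: "X \<in> Obj M \<Longrightarrow> RUnit M X \<in> Hom M (X \<odot> UnitO M) X"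
    and runit_iso: "X \<in> Obj M \<Longrightarrow> is_iso M (RUnit M X)"
    and runit_nat: "f \<in> Hom M X Y \<Longrightarrow>
      RUnit M Y \<cdot> (f \<otimes> \<one>\<^sub>a (UnitO M)) = f \<cdot> RUnit M X"
    and pentagon: "\<lbrakk>W \<in> Obj M; X \<in> Obj M; Y \<in> Obj M; Z \<in> Obj M\<rbrakk> \<Longrightarrow>
      (\<one>\<^sub>a W \<otimes> Assoc M X Y Z) \<cdot> Assoc M W (X \<odot> Y) Z \<cdot> (Assoc M W X Y \<otimes> \<one>\<^sub>a Z) =
      Assoc M W X (Y \<odot> Z) \<cdot> Assoc M (W \<odot> X) Y Z"
    and triangle: "\<lbrakk>X \<in> Obj M; Y \<in> Obj M\<rbrakk> \<Longrightarrow>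
      (\<one>\<^sub>a X \<otimes> LUnit M Y) \<cdot> Assoc M X (UnitO M) Y = RUnit M X \<otimes> \<one>\<^sub>a Y"

record ('o, 'a) brcat = "('o, 'a) moncat" +
  Braid :: "'o \<Rightarrow> 'o \<Rightarrow> 'a"

locale braided_monoidal_category =
  monoidal_category M for M :: "('o, 'a, 'z) brcat_scheme" (structure) +
  assumes braid_hom: "\<lbrakk>X \<in> Obj M; Y \<in> Obj M\<rbrakk> \<Longrightarrow> Braid M X Y \<in> Hom M (X \<odot> Y) (Y \<odot> X)"
    and braid_iso: "\<lbrakk>X \<in> Obj M; Y \<in> Obj M\<rbrakk> \<Longrightarrow> is_iso M (Braid M X Y)"
    and braid_nat: "\<lbrakk>f \<in> Hom M X X'; g \<in> Hom M Y Y'\<rbrakk> \<Longrightarrow>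
      Braid M X' Y' \<cdot> (f \<otimes> g) = (g \<otimes> f) \<cdot> Braid M X Y"
    and hexagon1: "\<lbrakk>X \<in> Obj M; Y \<in> Obj M; Z \<in> Obj M\<rbrakk> \<Longrightarrow>
      Assoc M Y Z X \<cdot> Braid M X (Y \<odot> Z) \<cdot> Assoc M X Y Z =
      (\<one>\<^sub>a Y \<otimes> Braid M X Z) \<cdot> Assoc M Y X Z \<cdot> (Braid M X Y \<otimes> \<one>\<^sub>a Z)"
    and hexagon2: "\<lbrakk>X \<in> Obj M; Y \<in> Obj M; Z \<in> Obj M\<rbrakk> \<Longrightarrow>
      inv_arr M (Assoc M Z X Y) \<cdot> Braid M (X \<odot> Y) Z \<cdot> inv_arr M (Assoc M X Y Z) =
      (Braid M X Z \<otimes> \<one>\<^sub>a Y) \<cdot> inv_arr M (Assoc M X Z Y) \<cdot> (\<one>\<^sub>a X \<otimes> Braid M Y Z)"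

record ('o, 'a) pabrcat = "('o, 'a) brcat" +
  Add :: "'a \<Rightarrow> 'a \<Rightarrow> 'a" (infixl "\<oplus>\<index>" 55)
  Zero :: "'o \<Rightarrow> 'o \<Rightarrow> 'a"

definition hom_group :: "('o, 'a, 'z) pabrcat_scheme \<Rightarrow> 'o \<Rightarrow> 'o \<Rightarrow> 'a monoid" where
  "hom_group M X Y = \<lparr>carrier = Hom M X Y, monoid.mult = Add M, one = Zero M X Y\<rparr>"

locale preadditive_category = category M for M :: "('o, 'a, 'z) pabrcat_scheme" (structure) +
  assumes hom_comm_group: "\<lbrakk>X \<in> Obj M; Y \<in> Obj M\<rbrakk> \<Longrightarrow> comm_group (hom_group M X Y)"
    and add_comp: "\<lbrakk>f \<in> Hom M X Y; g \<in> Hom M Y Z; g' \<in> Hom M Y Z\<rbrakk> \<Longrightarrow>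
      (g \<oplus> g') \<cdot> f = (g \<cdot> f) \<oplus> (g' \<cdot> f)"
    and comp_add: "\<lbrakk>f \<in> Hom M X Y; f' \<in> Hom M X Y; g \<in> Hom M Y Z\<rbrakk> \<Longrightarrow>
      g \<cdot> (f \<oplus> f') = (g \<cdot> f) \<oplus> (g \<cdot> f')"

definition additive_functor ::
  "('o, 'a, 'y) pabrcat_scheme \<Rightarrow> ('p, 'b, 'z) pabrcat_scheme \<Rightarrow> ('o, 'a, 'p, 'b) funct \<Rightarrow> bool"
  where
  "additive_functor C D F \<longleftrightarrow> is_functor C D F \<and>
     (\<forall>X \<in> Obj C. \<forall>Y \<in> Obj C. \<forall>f \<in> Hom C X Y. \<forall>g \<in> Hom C X Y.
        FA F (f \<oplus>\<^bsub>C\<^esub> g) = FA F f \<oplus>\<^bsub>D\<^esub> FA F g)"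

definition tensor_left :: "('o, 'a, 'z) moncat_scheme \<Rightarrow> 'o \<Rightarrow> ('o, 'a, 'o, 'a) funct" where
  "tensor_left M X = \<lparr>FO = (\<lambda>Y. X \<odot>\<^bsub>M\<^esub> Y), FA = (\<lambda>f. \<one>\<^sub>a\<^bsub>M\<^esub> X \<otimes>\<^bsub>M\<^esub> f)\<rparr>"

definition tensor_right :: "('o, 'a, 'z) moncat_scheme \<Rightarrow> 'o \<Rightarrow> ('o, 'a, 'o, 'a) funct" where
  "tensor_right M X = \<lparr>FO = (\<lambda>Y. Y \<odot>\<^bsub>M\<^esub> X), FA = (\<lambda>f. f \<otimes>\<^bsub>M\<^esub> \<one>\<^sub>a\<^bsub>M\<^esub> X)\<rparr>"

section \<open>Algebras and bialgebras\<close>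

record ('o, 'a) alg =
  Carr :: "'o"
  Mul :: "'a"
  Uni :: "'a"

record ('o, 'a) bialg = "('o, 'a) alg" +
  Comul :: "'a"
  Counit :: "'a"

definition is_algebra :: "('o, 'a, 'z) moncat_scheme \<Rightarrow> ('o, 'a, 'y) alg_scheme \<Rightarrow> bool" where
  "is_algebra M A \<longleftrightarrow>
     Carr A \<in> Obj M \<and>
     Mul A \<in> Hom M (Carr A \<odot>\<^bsub>M\<^esub> Carr A) (Carr A) \<and>
     Uni A \<in> Hom M (UnitO M) (Carr A) \<and>
     Mul A \<cdot>\<^bsub>M\<^esub> (Mul A \<otimes>\<^bsub>M\<^esub> \<one>\<^sub>a\<^bsub>M\<^esub> (Carr A)) =
       Mul A \<cdot>\<^bsub>M\<^esub> (\<one>\<^sub>a\<^bsub>M\<^esub> (Carr A) \<otimes>\<^bsub>M\<^esub> Mul A) \<cdot>\<^bsub>M\<^esub> Assoc M (Carr A) (Carr A) (Carr A) \<and>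
     Mul A \<cdot>\<^bsub>M\<^esub> (Uni A \<otimes>\<^bsub>M\<^esub> \<one>\<^sub>a\<^bsub>M\<^esub> (Carr A)) = LUnit M (Carr A) \<and>
     Mul A \<cdot>\<^bsub>M\<^esub> (\<one>\<^sub>a\<^bsub>M\<^esub> (Carr A) \<otimes>\<^bsub>M\<^esub> Uni A) = RUnit M (Carr A)"

definition is_algebra_hom ::
  "('o, 'a, 'z) moncat_scheme \<Rightarrow> ('o, 'a, 'x) alg_scheme \<Rightarrow> ('o, 'a, 'y) alg_scheme \<Rightarrow> 'a \<Rightarrow> bool"
  where
  "is_algebra_hom M A B f \<longleftrightarrow>
     f \<in> Hom M (Carr A) (Carr B) \<and>
     f \<cdot>\<^bsub>M\<^esub> Mul A = Mul B \<cdot>\<^bsub>M\<^esub> (f \<otimes>\<^bsub>M\<^esub> f) \<and>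
     f \<cdot>\<^bsub>M\<^esub> Uni A = Uni B"

definition is_coalgebra :: "('o, 'a, 'z) moncat_scheme \<Rightarrow> ('o, 'a) bialg \<Rightarrow> bool" where
  "is_coalgebra M B \<longleftrightarrow>
     Carr B \<in> Obj M \<and>
     Comul B \<in> Hom M (Carr B) (Carr B \<odot>\<^bsub>M\<^esub> Carr B) \<and>
     Counit B \<in> Hom M (Carr B) (UnitO M) \<and>
     Assoc M (Carr B) (Carr B) (Carr B) \<cdot>\<^bsub>M\<^esub>
       (Comul B \<otimes>\<^bsub>M\<^esub> \<one>\<^sub>a\<^bsub>M\<^esub> (Carr B)) \<cdot>\<^bsub>M\<^esub> Comul B =
       (\<one>\<^sub>a\<^bsub>M\<^esub> (Carr B) \<otimes>\<^bsub>M\<^esub> Comul B) \<cdot>\<^bsub>M\<^esub> Comul B \<and>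
     LUnit M (Carr B) \<cdot>\<^bsub>M\<^esub> (Counit B \<otimes>\<^bsub>M\<^esub> \<one>\<^sub>a\<^bsub>M\<^esub> (Carr B)) \<cdot>\<^bsub>M\<^esub> Comul B = \<one>\<^sub>a\<^bsub>M\<^esub> (Carr B) \<and>
     RUnit M (Carr B) \<cdot>\<^bsub>M\<^esub> (\<one>\<^sub>a\<^bsub>M\<^esub> (Carr B) \<otimes>\<^bsub>M\<^esub> Counit B) \<cdot>\<^bsub>M\<^esub> Comul B = \<one>\<^sub>a\<^bsub>M\<^esub> (Carr B)"

text \<open>
  \<open>(W \<odot> X) \<odot> (Y \<odot> Z) \<rightarrow> (W \<odot> Y) \<odot> (X \<odot> Z)\<close>, i.e. \<open>W \<otimes> c\<^bsub>X,Y\<^esub> \<otimes> Z\<close> up to associativity.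
\<close>

definition interchange ::
  "('o, 'a, 'z) brcat_scheme \<Rightarrow> 'o \<Rightarrow> 'o \<Rightarrow> 'o \<Rightarrow> 'o \<Rightarrow> 'a" where
  "interchange M W X Y Z =
     inv_arr M (Assoc M W Y (X \<odot>\<^bsub>M\<^esub> Z)) \<cdot>\<^bsub>M\<^esub>
     (\<one>\<^sub>a\<^bsub>M\<^esub> W \<otimes>\<^bsub>M\<^esub>
       (Assoc M Y X Z \<cdot>\<^bsub>M\<^esub> (Braid M X Y \<otimes>\<^bsub>M\<^esub> \<one>\<^sub>a\<^bsub>M\<^esub> Z) \<cdot>\<^bsub>M\<^esub> inv_arr M (Assoc M X Y Z))) \<cdot>\<^bsub>M\<^esub>
     Assoc M W X (Y \<odot>\<^bsub>M\<^esub> Z)"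

definition unit_alg :: "('o, 'a, 'z) moncat_scheme \<Rightarrow> ('o, 'a) alg" where
  "unit_alg M = \<lparr>Carr = UnitO M, Mul = LUnit M (UnitO M), Uni = \<one>\<^sub>a\<^bsub>M\<^esub> (UnitO M)\<rparr>"

definition tensor_product_alg ::
  "('o, 'a, 'z) brcat_scheme \<Rightarrow> ('o, 'a, 'x) alg_scheme \<Rightarrow> ('o, 'a, 'y) alg_scheme \<Rightarrow> ('o, 'a) alg"
  where
  "tensor_product_alg M A B =
     \<lparr>Carr = Carr A \<odot>\<^bsub>M\<^esub> Carr B,
      Mul = (Mul A \<otimes>\<^bsub>M\<^esub> Mul B) \<cdot>\<^bsub>M\<^esub> interchange M (Carr A) (Carr B) (Carr A) (Carr B),
      Uni = (Uni A \<otimes>\<^bsub>M\<^esub> Uni B) \<cdot>\<^bsub>M\<^esub> inv_arr M (LUnit M (UnitO M))\<rparr>"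

definition is_bialgebra :: "('o, 'a, 'z) brcat_scheme \<Rightarrow> ('o, 'a) bialg \<Rightarrow> bool" where
  "is_bialgebra M B \<longleftrightarrow> is_algebra M B \<and> is_coalgebra M B \<and>
     is_algebra_hom M B (tensor_product_alg M B B) (Comul B) \<and>
     is_algebra_hom M B (unit_alg M) (Counit B)"

definition is_bialgebra_hom ::
  "('o, 'a, 'z) moncat_scheme \<Rightarrow> ('o, 'a) bialg \<Rightarrow> ('o, 'a) bialg \<Rightarrow> 'a \<Rightarrow> bool" where
  "is_bialgebra_hom M A B f \<longleftrightarrow> is_algebra_hom M A B f \<and>
     Comul B \<cdot>\<^bsub>M\<^esub> f = (f \<otimes>\<^bsub>M\<^esub> f) \<cdot>\<^bsub>M\<^esub> Comul A \<and>
     Counit B \<cdot>\<^bsub>M\<^esub> f = Counit A"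

text \<open>
  A morphism of structured objects is a triple of source, underlying morphism and target, so
  that it determines its source and target.
\<close>

definition und :: "'s \<times> 'a \<times> 's \<Rightarrow> 'a" where
  "und F = fst (snd F)"

definition structure_cat ::
  "('o, 'a, 'z) cat_scheme \<Rightarrow> ('s \<Rightarrow> bool) \<Rightarrow> ('s \<Rightarrow> 's \<Rightarrow> 'a \<Rightarrow> bool) \<Rightarrow> ('s \<Rightarrow> 'o) \<Rightarrow>
   ('s, 's \<times> 'a \<times> 's) cat" where
  "structure_cat M isS isH U =
     \<lparr>Obj = {A. isS A},
      Arr = {(A, f, B). isS A \<and> isS B \<and> isH A B f},
      Dom = (\<lambda>F. fst F),
      Cod = (\<lambda>F. snd (snd F)),
      Ident = (\<lambda>A. (A, \<one>\<^sub>a\<^bsub>M\<^esub> (U A), A)),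
      Comp = (\<lambda>G F. (fst F, und G \<cdot>\<^bsub>M\<^esub> und F, snd (snd G)))\<rparr>"

definition Alg ::
  "('o, 'a, 'z) moncat_scheme \<Rightarrow> (('o, 'a) alg, ('o, 'a) alg \<times> 'a \<times> ('o, 'a) alg) cat" where
  "Alg M = structure_cat M (is_algebra M) (is_algebra_hom M) Carr"

definition Bialg ::
  "('o, 'a, 'z) brcat_scheme \<Rightarrow> (('o, 'a) bialg, ('o, 'a) bialg \<times> 'a \<times> ('o, 'a) bialg) cat" where
  "Bialg M = structure_cat M (is_bialgebra M) (is_bialgebra_hom M) Carr"

definition forget_alg :: "(('o, 'a) alg, ('o, 'a) alg \<times> 'a \<times> ('o, 'a) alg, 'o, 'a) funct" ("\<Omega>") where
  "\<Omega> = \<lparr>FO = Carr, FA = und\<rparr>"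

definition forget_bialg ::
  "(('o, 'a) bialg, ('o, 'a) bialg \<times> 'a \<times> ('o, 'a) bialg,
    ('o, 'a) alg, ('o, 'a) alg \<times> 'a \<times> ('o, 'a) alg) funct" ("\<mho>") where
  "\<mho> = \<lparr>FO = alg.truncate,
       FA = (\<lambda>F. (alg.truncate (fst F), und F, alg.truncate (snd (snd F))))\<rparr>"

section \<open>The tensor algebra functor\<close>

fun tpow :: "('o, 'a, 'z) moncat_scheme \<Rightarrow> 'o \<Rightarrow> nat \<Rightarrow> 'o" where
  "tpow M V 0 = UnitO M"
| "tpow M V (Suc 0) = V"
| "tpow M V (Suc (Suc n)) = tpow M V (Suc n) \<odot>\<^bsub>M\<^esub> V"

fun tpow_arr :: "('o, 'a, 'z) moncat_scheme \<Rightarrow> 'a \<Rightarrow> nat \<Rightarrow> 'a" where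
  "tpow_arr M f 0 = \<one>\<^sub>a\<^bsub>M\<^esub> (UnitO M)"
| "tpow_arr M f (Suc 0) = f"
| "tpow_arr M f (Suc (Suc n)) = tpow_arr M f (Suc n) \<otimes>\<^bsub>M\<^esub> f"

text \<open>The canonical isomorphism \<open>tpow M V m \<odot> tpow M V n \<rightarrow> tpow M V (m + n)\<close>.\<close>

fun concat_iso :: "('o, 'a, 'z) moncat_scheme \<Rightarrow> 'o \<Rightarrow> nat \<Rightarrow> nat \<Rightarrow> 'a" where
  "concat_iso M V m 0 = RUnit M (tpow M V m)"
| "concat_iso M V 0 (Suc 0) = LUnit M V"
| "concat_iso M V (Suc m) (Suc 0) = \<one>\<^sub>a\<^bsub>M\<^esub> (tpow M V (Suc m) \<odot>\<^bsub>M\<^esub> V)"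
| "concat_iso M V m (Suc (Suc n)) =
     (concat_iso M V m (Suc n) \<otimes>\<^bsub>M\<^esub> \<one>\<^sub>a\<^bsub>M\<^esub> V) \<cdot>\<^bsub>M\<^esub>
     inv_arr M (Assoc M (tpow M V m) (tpow M V (Suc n)) V)"

text \<open>
  \<open>al V n : tpow M V n \<rightarrow> \<Omega> T V\<close> is a choice of coproduct injections for every object \<open>V\<close>;
  the coproduct itself is recovered as their common codomain.
\<close>

definition tensor_obj :: "('o, 'a, 'z) moncat_scheme \<Rightarrow> ('o \<Rightarrow> nat \<Rightarrow> 'a) \<Rightarrow> 'o \<Rightarrow> 'o" where
  "tensor_obj M al V = Cod M (al V 0)"

definition tensor_alg ::
  "('o, 'a, 'z) moncat_scheme \<Rightarrow> ('o \<Rightarrow> nat \<Rightarrow> 'a) \<Rightarrow> 'o \<Rightarrow> ('o, 'a) alg" where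
  "tensor_alg M al V =
     \<lparr>Carr = tensor_obj M al V,
      Mul = (THE m. m \<in> Hom M (tensor_obj M al V \<odot>\<^bsub>M\<^esub> tensor_obj M al V) (tensor_obj M al V) \<and>
               (\<forall>i j. m \<cdot>\<^bsub>M\<^esub> (al V i \<otimes>\<^bsub>M\<^esub> al V j) = al V (i + j) \<cdot>\<^bsub>M\<^esub> concat_iso M V i j)),
      Uni = al V 0\<rparr>"

definition tensor_arr ::
  "('o, 'a, 'z) moncat_scheme \<Rightarrow> ('o \<Rightarrow> nat \<Rightarrow> 'a) \<Rightarrow> 'a \<Rightarrow> 'a" where
  "tensor_arr M al f =
     (THE h. h \<in> Hom M (tensor_obj M al (Dom M f)) (tensor_obj M al (Cod M f)) \<and>
        (\<forall>n. h \<cdot>\<^bsub>M\<^esub> al (Dom M f) n = al (Cod M f) n \<cdot>\<^bsub>M\<^esub> tpow_arr M f n))"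

definition tensor_functor ::
  "('o, 'a, 'z) moncat_scheme \<Rightarrow> ('o \<Rightarrow> nat \<Rightarrow> 'a) \<Rightarrow>
   ('o, 'a, ('o, 'a) alg, ('o, 'a) alg \<times> 'a \<times> ('o, 'a) alg) funct" where
  "tensor_functor M al =
     \<lparr>FO = tensor_alg M al,
      FA = (\<lambda>f. (tensor_alg M al (Dom M f), tensor_arr M al f, tensor_alg M al (Cod M f)))\<rparr>"

text \<open>\<open>iter_mul M A n : tpow M (Carr A) n \<rightarrow> Carr A\<close> is the iterated multiplication \<open>m\<^bsup>n-1\<^esup>\<close>.\<close>

fun iter_mul :: "('o, 'a, 'z) moncat_scheme \<Rightarrow> ('o, 'a) alg \<Rightarrow> nat \<Rightarrow> 'a" where
  "iter_mul M A 0 = Uni A"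
| "iter_mul M A (Suc 0) = \<one>\<^sub>a\<^bsub>M\<^esub> (Carr A)"
| "iter_mul M A (Suc (Suc n)) = Mul A \<cdot>\<^bsub>M\<^esub> (iter_mul M A (Suc n) \<otimes>\<^bsub>M\<^esub> \<one>\<^sub>a\<^bsub>M\<^esub> (Carr A))"

definition tensor_unit :: "('o \<Rightarrow> nat \<Rightarrow> 'a) \<Rightarrow> 'o \<Rightarrow> 'a" where
  "tensor_unit al V = al V 1"

definition tensor_counit ::
  "('o, 'a, 'z) moncat_scheme \<Rightarrow> ('o \<Rightarrow> nat \<Rightarrow> 'a) \<Rightarrow> ('o, 'a) alg \<Rightarrow>
   ('o, 'a) alg \<times> 'a \<times> ('o, 'a) alg" where
  "tensor_counit M al A =
     (tensor_alg M al (FO \<Omega> A),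
      (THE h. h \<in> Hom M (tensor_obj M al (FO \<Omega> A)) (FO \<Omega> A) \<and>
         (\<forall>n. h \<cdot>\<^bsub>M\<^esub> al (FO \<Omega> A) n = iter_mul M A n)),
      A)"

section \<open>The tensor bialgebra functor and the primitive functor\<close>

definition tensor_bialg ::
  "('o, 'a, 'z) pabrcat_scheme \<Rightarrow> ('o \<Rightarrow> nat \<Rightarrow> 'a) \<Rightarrow> 'o \<Rightarrow> ('o, 'a) bialg" where
  "tensor_bialg M al V =
     (let A = tensor_alg M al V in
      \<lparr>Carr = Carr A, Mul = Mul A, Uni = Uni A,
       Comul = (THE d. is_algebra_hom M A (tensor_product_alg M A A) d \<and>
         d \<cdot>\<^bsub>M\<^esub> al V 1 =
           ((al V 1 \<otimes>\<^bsub>M\<^esub> Uni A) \<cdot>\<^bsub>M\<^esub> inv_arr M (RUnit M V)) \<oplus>\<^bsub>M\<^esub>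
           ((Uni A \<otimes>\<^bsub>M\<^esub> al V 1) \<cdot>\<^bsub>M\<^esub> inv_arr M (LUnit M V))),
       Counit = (THE e. is_algebra_hom M A (unit_alg M) e \<and>
         e \<cdot>\<^bsub>M\<^esub> al V 1 = Zero M V (UnitO M))\<rparr>)"

definition tensor_bialg_functor ::
  "('o, 'a, 'z) pabrcat_scheme \<Rightarrow> ('o \<Rightarrow> nat \<Rightarrow> 'a) \<Rightarrow>
   ('o, 'a, ('o, 'a) bialg, ('o, 'a) bialg \<times> 'a \<times> ('o, 'a) bialg) funct" where
  "tensor_bialg_functor M al =
     \<lparr>FO = tensor_bialg M al,
      FA = (\<lambda>f. (tensor_bialg M al (Dom M f),
                 und (FA (tensor_functor M al) f),
                 tensor_bialg M al (Cod M f)))\<rparr>"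

definition is_primitive_part ::
  "('o, 'a, 'z) pabrcat_scheme \<Rightarrow> ('o, 'a) bialg \<Rightarrow> 'a \<Rightarrow> bool" where
  "is_primitive_part M B x \<longleftrightarrow>
     is_equalizer M (Comul B)
       (((Uni B \<otimes>\<^bsub>M\<^esub> \<one>\<^sub>a\<^bsub>M\<^esub> (Carr B)) \<cdot>\<^bsub>M\<^esub> inv_arr M (LUnit M (Carr B))) \<oplus>\<^bsub>M\<^esub>
        ((\<one>\<^sub>a\<^bsub>M\<^esub> (Carr B) \<otimes>\<^bsub>M\<^esub> Uni B) \<cdot>\<^bsub>M\<^esub> inv_arr M (RUnit M (Carr B))))
       x"

text \<open>
  \<open>xi B : P B \<rightarrow> \<Omega> \<mho> B\<close> is a choice of such an equalizer for every bialgebra \<open>B\<close>; the object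
  \<open>P B\<close> is recovered as its domain.
\<close>

definition primitive_functor ::
  "('o, 'a, 'z) pabrcat_scheme \<Rightarrow> (('o, 'a) bialg \<Rightarrow> 'a) \<Rightarrow>
   (('o, 'a) bialg, ('o, 'a) bialg \<times> 'a \<times> ('o, 'a) bialg, 'o, 'a) funct" where
  "primitive_functor M xi =
     \<lparr>FO = (\<lambda>B. Dom M (xi B)),
      FA = (\<lambda>F. THE h. h \<in> Hom M (Dom M (xi (fst F))) (Dom M (xi (snd (snd F)))) \<and>
              xi (snd (snd F)) \<cdot>\<^bsub>M\<^esub> h = und F \<cdot>\<^bsub>M\<^esub> xi (fst F))\<rparr>"

definition bialg_unit ::
  "('o, 'a, 'z) pabrcat_scheme \<Rightarrow> ('o \<Rightarrow> nat \<Rightarrow> 'a) \<Rightarrow> (('o, 'a) bialg \<Rightarrow> 'a) \<Rightarrow> 'o \<Rightarrow> 'a" where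
  "bialg_unit M al xi V =
     (THE h. h \<in> Hom M V (FO (primitive_functor M xi \<circ>\<^sub>F tensor_bialg_functor M al) V) \<and>
        xi (tensor_bialg M al V) \<cdot>\<^bsub>M\<^esub> h = tensor_unit al V)"

definition bialg_counit ::
  "('o, 'a, 'z) pabrcat_scheme \<Rightarrow> ('o \<Rightarrow> nat \<Rightarrow> 'a) \<Rightarrow> (('o, 'a) bialg \<Rightarrow> 'a) \<Rightarrow>
   ('o, 'a) bialg \<Rightarrow> ('o, 'a) bialg \<times> 'a \<times> ('o, 'a) bialg" where
  "bialg_counit M al xi B =
     (FO (tensor_bialg_functor M al \<circ>\<^sub>F primitive_functor M xi) B,
      und (tensor_counit M al (FO \<mho> B) \<cdot>\<^bsub>Alg M\<^esub> FA (tensor_functor M al) (xi B)),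
      B)"

definition tensor_proj ::
  "('o, 'a, 'z) pabrcat_scheme \<Rightarrow> ('o \<Rightarrow> nat \<Rightarrow> 'a) \<Rightarrow> 'o \<Rightarrow> 'a" where
  "tensor_proj M al V =
     (THE h. h \<in> Hom M (FO (\<Omega> \<circ>\<^sub>F tensor_functor M al) V) V \<and>
        (\<forall>n. h \<cdot>\<^bsub>M\<^esub> al V n = (if n = 1 then \<one>\<^sub>a\<^bsub>M\<^esub> V else Zero M (tpow M V n) V)))"

definition gamma_trans ::
  "('o, 'a, 'z) pabrcat_scheme \<Rightarrow> ('o \<Rightarrow> nat \<Rightarrow> 'a) \<Rightarrow> (('o, 'a) bialg \<Rightarrow> 'a) \<Rightarrow> 'o \<Rightarrow> 'a" where
  "gamma_trans M al xi V = tensor_proj M al V \<cdot>\<^bsub>M\<^esub> xi (FO (tensor_bialg_functor M al) V)"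

end

theory Submission
  imports Defs
begin

text \<open>
  The heart of the theorem is the equality \<open>\<gamma> V \<cdot> P T (\<gamma> V) = \<gamma> V \<cdot> P (\<epsilon> (T V))\<close>. Write \<open>W\<close> for the
  primitive part of \<open>T V\<close>. By naturality of \<open>\<xi>\<close> and \<open>\<omega>\<close>, the two sides are \<open>\<gamma> V \<cdot> \<omega> W\<close> and
  \<open>\<omega> V \<cdot> \<epsilon> (T V)\<close>, each preceded by the inclusion of the primitive part of \<open>T W\<close>; in fact these two arrows
  agree on all of \<open>T W\<close> (\<open>tensor_proj_counit\<close>). The former is \<open>\<gamma> V\<close> in degree one and zero in all other
  degrees. The latter multiplies words of primitive elements of \<open>T V\<close> and then projects to degree one.
  On a single primitive element that is \<open>\<gamma> V\<close>. On words of any other length it vanishes, because \<open>\<omega>\<close>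
  kills the unit and is a derivation relative to the counit (\<open>tensor_proj_derivation\<close>), while the
  counit is multiplicative and vanishes on primitive elements (\<open>counit_primitive\<close>).

  The remaining claims about \<open>\<gamma>\<close> are formal: \<open>\<gamma> V \<cdot> \<eta> V\<close> is the projection to degree one restricted to
  generators, and heavy separability holds for every left adjoint whose unit has a natural retraction
  with this property (\<open>h_separable_left_adjoint\<close>).

  The adjunction itself comes from two universal properties. An algebra morphism out of a tensor algebra
  is determined, and may be prescribed, on generators (\<open>tensor_hom_ext\<close>, \<open>tensor_lift_ex1\<close>); and it is a
  bialgebra morphism if the generators are sent to primitive elements (\<open>primitive_lift_bialgebra_hom\<close>).
  So the bialgebra axioms, functoriality, naturality and the first triangle identity are all checked on
  generators, and what concerns primitive parts is checked after the monomorphism \<open>\<xi>\<close>.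

  For this, tensor products of algebras have to be algebras, and the associator and the unit constraints
  have to be algebra morphisms. In a braided category that is not assumed to be strict this is a
  coherence question about the interchange \<open>(W \<odot> X) \<odot> (Y \<odot> Z) \<rightarrow> (W \<odot> Y) \<odot> (X \<odot> Z)\<close>. It is settled by
  bringing all products into right-nested form, where the braiding appears only as
  \<open>cross X Y Z : X \<odot> (Y \<odot> Z) \<rightarrow> Y \<odot> (X \<odot> Z)\<close>; the required identities then follow from the hexagons and
  from the naturality of \<open>cross\<close> (\<open>interchange_assoc\<close>, \<open>interchange_assoc_arr\<close>).
\<close>

section \<open>Composition and inverses in a category\<close>

text \<open>
  Hom-sets mention source and target as parameters, which leaves unbound variables in the premises
  of conditional rewrite rules. Membership is therefore split into conditions on \<open>Dom\<close> and \<open>Cod\<close>,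
  which the simplifier discharges.
\<close>

lemma in_Hom_iff [simp]: "f \<in> Hom C X Y \<longleftrightarrow> f \<in> Arr C \<and> Dom C f = X \<and> Cod C f = Y"
  by (auto simp: Hom_def)

context category
begin

lemmas [simp] = dom_obj cod_obj

lemma ident_arr [simp]:
  assumes "X \<in> Obj C"
  shows "\<one>\<^sub>a X \<in> Arr C" "Dom C (\<one>\<^sub>a X) = X" "Cod C (\<one>\<^sub>a X) = X"
  using ident_hom[OF assms] by auto

lemma comp_arr [simp]:
  assumes "f \<in> Arr C" "g \<in> Arr C" "Dom C g = Cod C f"
  shows "g \<cdot> f \<in> Arr C" "Dom C (g \<cdot> f) = Dom C f" "Cod C (g \<cdot> f) = Cod C g"
  using comp_hom[of f "Dom C f" "Cod C f" g "Cod C g"] assms by auto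

lemma comp_ident' [simp]: "\<lbrakk>f \<in> Arr C; Dom C f = X\<rbrakk> \<Longrightarrow> f \<cdot> \<one>\<^sub>a X = f"
  using comp_ident[of f X "Cod C f"] by auto

lemma ident_comp' [simp]: "\<lbrakk>f \<in> Arr C; Cod C f = X\<rbrakk> \<Longrightarrow> \<one>\<^sub>a X \<cdot> f = f"
  using ident_comp[of f "Dom C f" X] by auto

lemma comp_assoc' [simp]:
  assumes "f \<in> Arr C" "g \<in> Arr C" "h \<in> Arr C" "Dom C g = Cod C f" "Dom C h = Cod C g"
  shows "(h \<cdot> g) \<cdot> f = h \<cdot> (g \<cdot> f)"
  using comp_assoc[of f "Dom C f" "Cod C f" g "Cod C g" h "Cod C h"] assms by auto

text \<open>
  Composites are kept associated to the right, so an equation between composites only applies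
  at the end of a chain; the rules \<open>comp_tail\<close> extend it to the middle of a chain.
\<close>

lemma comp_tail:
  assumes "f \<cdot> g = h" "f \<in> Arr C" "g \<in> Arr C" "Dom C f = Cod C g" "k \<in> Arr C" "Dom C g = Cod C k"
  shows "f \<cdot> (g \<cdot> k) = h \<cdot> k"
proof -
  have "(f \<cdot> g) \<cdot> k = f \<cdot> (g \<cdot> k)" using assms(2-) by simp
  then show ?thesis unfolding assms(1) by (rule sym)
qed

lemma comp_tail3:
  assumes "f1 \<cdot> (f2 \<cdot> f3) = h" "f1 \<in> Arr C" "f2 \<in> Arr C" "f3 \<in> Arr C"
    "Dom C f1 = Cod C f2" "Dom C f2 = Cod C f3" "k \<in> Arr C" "Dom C f3 = Cod C k"
  shows "f1 \<cdot> (f2 \<cdot> (f3 \<cdot> k)) = h \<cdot> k"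
proof -
  have "(f1 \<cdot> (f2 \<cdot> f3)) \<cdot> k = f1 \<cdot> (f2 \<cdot> (f3 \<cdot> k))" using assms(2-) by simp
  then show ?thesis unfolding assms(1) by (rule sym)
qed

lemma comp_tail4:
  assumes "f1 \<cdot> (f2 \<cdot> (f3 \<cdot> f4)) = h" "f1 \<in> Arr C" "f2 \<in> Arr C" "f3 \<in> Arr C" "f4 \<in> Arr C"
    "Dom C f1 = Cod C f2" "Dom C f2 = Cod C f3" "Dom C f3 = Cod C f4" "k \<in> Arr C" "Dom C f4 = Cod C k"
  shows "f1 \<cdot> (f2 \<cdot> (f3 \<cdot> (f4 \<cdot> k))) = h \<cdot> k"
proof -
  have "(f1 \<cdot> (f2 \<cdot> (f3 \<cdot> f4))) \<cdot> k = f1 \<cdot> (f2 \<cdot> (f3 \<cdot> (f4 \<cdot> k)))" using assms(2-) by simp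
  then show ?thesis unfolding assms(1) by (rule sym)
qed

lemma is_inverse_unique:
  assumes "f \<in> Arr C" "is_inverse C f g" "is_inverse C f h"
  shows "g = h"
proof -
  have "g = g \<cdot> (f \<cdot> h)" using assms by (simp add: is_inverse_def)
  also have "g \<cdot> (f \<cdot> h) = (g \<cdot> f) \<cdot> h"
    using assms by (intro comp_assoc'[symmetric]) (auto simp: is_inverse_def)
  also have "\<dots> = h" using assms by (simp add: is_inverse_def)
  finally show ?thesis .
qed

lemma inv_arr_is_inverse:
  assumes "is_iso C f"
  shows "is_inverse C f (inv_arr C f)"
  using assms is_inverse_unique unfolding is_iso_def inv_arr_def by (metis theI)

lemma iso_arr: "is_iso C f \<Longrightarrow> f \<in> Arr C"
  by (simp add: is_iso_def)

lemma inv_arr [simp]: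
  assumes "is_iso C f"
  shows "inv_arr C f \<in> Arr C" "Dom C (inv_arr C f) = Cod C f" "Cod C (inv_arr C f) = Dom C f"
    "f \<cdot> inv_arr C f = \<one>\<^sub>a (Cod C f)" "inv_arr C f \<cdot> f = \<one>\<^sub>a (Dom C f)"
  using inv_arr_is_inverse[OF assms] by (auto simp: is_inverse_def)

lemma inv_arr_tail [simp]:
  assumes "is_iso C f" "k \<in> Arr C"
  shows "Cod C k = Cod C f \<Longrightarrow> f \<cdot> (inv_arr C f \<cdot> k) = k"
    "Cod C k = Dom C f \<Longrightarrow> inv_arr C f \<cdot> (f \<cdot> k) = k"
  using assms iso_arr[OF assms(1)] by (auto simp: comp_tail[OF inv_arr(4)] comp_tail[OF inv_arr(5)])

lemma iso_cancel_left:
  assumes "is_iso C f" "g \<in> Arr C" "h \<in> Arr C" "Cod C g = Dom C f" "Cod C h = Dom C f" "f \<cdot> g = f \<cdot> h"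
  shows "g = h"
  using assms inv_arr_tail(2) by metis

lemma iso_cancel_right:
  assumes "is_iso C f" "g \<in> Arr C" "h \<in> Arr C" "Dom C g = Cod C f" "Dom C h = Cod C f" "g \<cdot> f = h \<cdot> f"
  shows "g = h"
proof -
  have "g = (g \<cdot> f) \<cdot> inv_arr C f" using assms(1-5) iso_arr[OF assms(1)] by simp
  also have "\<dots> = h" unfolding assms(6) using assms(1-5) iso_arr[OF assms(1)] by simp
  finally show ?thesis .
qed

lemma iso_comp:
  assumes "is_iso C f" "is_iso C g" "Dom C g = Cod C f"
  shows "is_iso C (g \<cdot> f)"
  using assms iso_arr[OF assms(1)] iso_arr[OF assms(2)]
  by (auto simp: is_iso_def[of _ "g \<cdot> f"] is_inverse_def intro!: exI[of _ "inv_arr C f \<cdot> inv_arr C g"])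

end

section \<open>Coherence in monoidal categories\<close>

context monoidal_category
begin

lemmas [simp] = unit_obj ten_obj ten_ident assoc_iso lunit_iso runit_iso

lemma ten_arr [simp]:
  assumes "f \<in> Arr M" "g \<in> Arr M"
  shows "f \<otimes> g \<in> Arr M" "Dom M (f \<otimes> g) = Dom M f \<odot> Dom M g" "Cod M (f \<otimes> g) = Cod M f \<odot> Cod M g"
  using ten_hom[of f "Dom M f" "Cod M f" g "Dom M g" "Cod M g"] assms by auto

lemma assoc_arr [simp]:
  assumes "X \<in> Obj M" "Y \<in> Obj M" "Z \<in> Obj M"
  shows "Assoc M X Y Z \<in> Arr M" "Dom M (Assoc M X Y Z) = (X \<odot> Y) \<odot> Z"
    "Cod M (Assoc M X Y Z) = X \<odot> (Y \<odot> Z)"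
  using assoc_hom[OF assms] by auto

lemma unit_arr [simp]:
  assumes "X \<in> Obj M"
  shows "LUnit M X \<in> Arr M" "Dom M (LUnit M X) = UnitO M \<odot> X" "Cod M (LUnit M X) = X"
    "RUnit M X \<in> Arr M" "Dom M (RUnit M X) = X \<odot> UnitO M" "Cod M (RUnit M X) = X"
  using lunit_hom[OF assms] runit_hom[OF assms] by auto

text \<open>
  Bifunctoriality is used from left to right: two layers of tensor products become one layer of
  composites. Splitting a layer happens by stating the intended chain and merging both sides.
\<close>

lemma ten_merge:
  assumes "f \<in> Arr M" "g \<in> Arr M" "f' \<in> Arr M" "g' \<in> Arr M" "Dom M g = Cod M f" "Dom M g' = Cod M f'"
  shows "(g \<otimes> g') \<cdot> (f \<otimes> f') = (g \<cdot> f) \<otimes> (g' \<cdot> f')"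
  using ten_comp[of f "Dom M f" "Cod M f" g "Cod M g" f' "Dom M f'" "Cod M f'" g' "Cod M g'"] assms
  by simp

lemma ten_merge_tail:
  assumes "f \<in> Arr M" "g \<in> Arr M" "f' \<in> Arr M" "g' \<in> Arr M" "Dom M g = Cod M f" "Dom M g' = Cod M f'"
    "k \<in> Arr M" "Cod M k = Dom M f \<odot> Dom M f'"
  shows "(g \<otimes> g') \<cdot> ((f \<otimes> f') \<cdot> k) = ((g \<cdot> f) \<otimes> (g' \<cdot> f')) \<cdot> k"
  using assms by (simp add: comp_tail[OF ten_merge])

lemmas merge = ten_merge ten_merge_tail

lemma assoc_natural:
  assumes "f \<in> Arr M" "g \<in> Arr M" "h \<in> Arr M" "Cod M f = X'" "Cod M g = Y'" "Cod M h = Z'"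
  shows "Assoc M X' Y' Z' \<cdot> ((f \<otimes> g) \<otimes> h) = (f \<otimes> (g \<otimes> h)) \<cdot> Assoc M (Dom M f) (Dom M g) (Dom M h)"
  using assms assoc_nat[of f "Dom M f" X' g "Dom M g" Y' h "Dom M h" Z'] by simp

lemma assoc_natural_ident:
  assumes "X \<in> Obj M" "Y \<in> Obj M" "h \<in> Arr M" "Cod M h = Z'"
  shows "Assoc M X Y Z' \<cdot> (\<one>\<^sub>a (X \<odot> Y) \<otimes> h) = (\<one>\<^sub>a X \<otimes> (\<one>\<^sub>a Y \<otimes> h)) \<cdot> Assoc M X Y (Dom M h)"
  using assms assoc_natural[of "\<one>\<^sub>a X" "\<one>\<^sub>a Y" h X Y Z'] by simp

lemma assoc_natural_ident':
  assumes "f \<in> Arr M" "Y \<in> Obj M" "Z \<in> Obj M" "Cod M f = X'"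
  shows "Assoc M X' Y Z \<cdot> ((f \<otimes> \<one>\<^sub>a Y) \<otimes> \<one>\<^sub>a Z) = (f \<otimes> \<one>\<^sub>a (Y \<odot> Z)) \<cdot> Assoc M (Dom M f) Y Z"
  using assms assoc_natural[of f "\<one>\<^sub>a Y" "\<one>\<^sub>a Z" X' Y Z] by simp

lemma pentagon':
  assumes "W \<in> Obj M" "X \<in> Obj M" "Y \<in> Obj M" "Z \<in> Obj M"
  shows "Assoc M W X (Y \<odot> Z) \<cdot> Assoc M (W \<odot> X) Y Z =
      (\<one>\<^sub>a W \<otimes> Assoc M X Y Z) \<cdot> (Assoc M W (X \<odot> Y) Z \<cdot> (Assoc M W X Y \<otimes> \<one>\<^sub>a Z))"
  using pentagon[OF assms] by simp

lemma lunit_natural: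
  "\<lbrakk>f \<in> Arr M; Cod M f = Y\<rbrakk> \<Longrightarrow> LUnit M Y \<cdot> (\<one>\<^sub>a (UnitO M) \<otimes> f) = f \<cdot> LUnit M (Dom M f)"
  using lunit_nat[of f "Dom M f" Y] by simp

lemma runit_natural:
  "\<lbrakk>f \<in> Arr M; Cod M f = Y\<rbrakk> \<Longrightarrow> RUnit M Y \<cdot> (f \<otimes> \<one>\<^sub>a (UnitO M)) = f \<cdot> RUnit M (Dom M f)"
  using runit_nat[of f "Dom M f" Y] by simp

lemma iso_ten [simp]:
  assumes "is_iso M f" "is_iso M g"
  shows "is_iso M (f \<otimes> g)"
  using assms iso_arr[OF assms(1)] iso_arr[OF assms(2)]
  by (auto simp: is_iso_def[of _ "f \<otimes> g"] is_inverse_def ten_merge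
      intro!: exI[of _ "inv_arr M f \<otimes> inv_arr M g"])

lemma iso_ident [simp]: "X \<in> Obj M \<Longrightarrow> is_iso M (\<one>\<^sub>a X)"
  by (auto simp: is_iso_def is_inverse_def intro!: exI[of _ "\<one>\<^sub>a X"])

text \<open>
  By naturality of the unit constraint, \<open>f\<close> is conjugate to \<open>\<one>\<^sub>a (UnitO M) \<otimes> f\<close> by isomorphisms.
\<close>

lemma ten_unit_faithful_left:
  assumes "f \<in> Arr M" "g \<in> Arr M" "Dom M f = Dom M g" "Cod M f = Cod M g"
    "\<one>\<^sub>a (UnitO M) \<otimes> f = \<one>\<^sub>a (UnitO M) \<otimes> g"
  shows "f = g"
proof (rule iso_cancel_right[of "LUnit M (Dom M f)"])
  show "f \<cdot> LUnit M (Dom M f) = g \<cdot> LUnit M (Dom M f)"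
    using assms lunit_natural[of f] lunit_natural[of g] by simp
qed (use assms in auto)

lemma ten_unit_faithful_right:
  assumes "f \<in> Arr M" "g \<in> Arr M" "Dom M f = Dom M g" "Cod M f = Cod M g"
    "f \<otimes> \<one>\<^sub>a (UnitO M) = g \<otimes> \<one>\<^sub>a (UnitO M)"
  shows "f = g"
proof (rule iso_cancel_right[of "RUnit M (Dom M f)"])
  show "f \<cdot> RUnit M (Dom M f) = g \<cdot> RUnit M (Dom M f)"
    using assms runit_natural[of f] runit_natural[of g] by simp
qed (use assms in auto)

text \<open>
  The unit coherence laws that Mac Lane's original axioms included and Kelly showed to be
  redundant. Tensoring with the unit object is faithful, and after tensoring the claim follows
  from the pentagon and the triangle.
\<close>

lemma lunit_ten:
  assumes [simp]: "X \<in> Obj M" "Y \<in> Obj M"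
  shows "LUnit M (X \<odot> Y) \<cdot> Assoc M (UnitO M) X Y = LUnit M X \<otimes> \<one>\<^sub>a Y"
proof (rule ten_unit_faithful_left)
  let ?I = "UnitO M" and ?a = "Assoc M"
  show "\<one>\<^sub>a ?I \<otimes> (LUnit M (X \<odot> Y) \<cdot> ?a ?I X Y) = \<one>\<^sub>a ?I \<otimes> (LUnit M X \<otimes> \<one>\<^sub>a Y)"
  proof (rule iso_cancel_right[of "?a ?I (?I \<odot> X) Y \<cdot> (?a ?I ?I X \<otimes> \<one>\<^sub>a Y)"])
    have "(\<one>\<^sub>a ?I \<otimes> (LUnit M (X \<odot> Y) \<cdot> ?a ?I X Y)) \<cdot> (?a ?I (?I \<odot> X) Y \<cdot> (?a ?I ?I X \<otimes> \<one>\<^sub>a Y))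
        = (\<one>\<^sub>a ?I \<otimes> LUnit M (X \<odot> Y)) \<cdot> ((\<one>\<^sub>a ?I \<otimes> ?a ?I X Y) \<cdot> (?a ?I (?I \<odot> X) Y \<cdot> (?a ?I ?I X \<otimes> \<one>\<^sub>a Y)))"
      by (simp add: merge)
    also have "\<dots> = (\<one>\<^sub>a ?I \<otimes> LUnit M (X \<odot> Y)) \<cdot> (?a ?I ?I (X \<odot> Y) \<cdot> ?a (?I \<odot> ?I) X Y)"
      by (simp add: pentagon')
    also have "\<dots> = (RUnit M ?I \<otimes> \<one>\<^sub>a (X \<odot> Y)) \<cdot> ?a (?I \<odot> ?I) X Y"
      by (simp add: comp_tail[OF triangle])
    also have "\<dots> = ?a ?I X Y \<cdot> ((RUnit M ?I \<otimes> \<one>\<^sub>a X) \<otimes> \<one>\<^sub>a Y)"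
      by (simp add: assoc_natural_ident')
    also have "\<dots> = ?a ?I X Y \<cdot> (((\<one>\<^sub>a ?I \<otimes> LUnit M X) \<cdot> ?a ?I ?I X) \<otimes> \<one>\<^sub>a Y)"
      by (simp add: triangle)
    also have "\<dots> = ?a ?I X Y \<cdot> ((\<one>\<^sub>a ?I \<otimes> LUnit M X) \<otimes> \<one>\<^sub>a Y) \<cdot> (?a ?I ?I X \<otimes> \<one>\<^sub>a Y)"
      by (simp add: merge)
    also have "\<dots> = (\<one>\<^sub>a ?I \<otimes> (LUnit M X \<otimes> \<one>\<^sub>a Y)) \<cdot> ?a ?I (?I \<odot> X) Y \<cdot> (?a ?I ?I X \<otimes> \<one>\<^sub>a Y)"
      by (simp add: comp_tail[OF assoc_natural])
    finally show "(\<one>\<^sub>a ?I \<otimes> (LUnit M (X \<odot> Y) \<cdot> ?a ?I X Y)) \<cdot> (?a ?I (?I \<odot> X) Y \<cdot> (?a ?I ?I X \<otimes> \<one>\<^sub>a Y))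
        = (\<one>\<^sub>a ?I \<otimes> (LUnit M X \<otimes> \<one>\<^sub>a Y)) \<cdot> ?a ?I (?I \<odot> X) Y \<cdot> (?a ?I ?I X \<otimes> \<one>\<^sub>a Y)" .
  qed (auto intro!: iso_comp)
qed auto

lemma runit_ten:
  assumes [simp]: "X \<in> Obj M" "Y \<in> Obj M"
  shows "(\<one>\<^sub>a X \<otimes> RUnit M Y) \<cdot> Assoc M X Y (UnitO M) = RUnit M (X \<odot> Y)"
proof (rule ten_unit_faithful_right)
  let ?I = "UnitO M" and ?a = "Assoc M"
  show "((\<one>\<^sub>a X \<otimes> RUnit M Y) \<cdot> ?a X Y ?I) \<otimes> \<one>\<^sub>a ?I = RUnit M (X \<odot> Y) \<otimes> \<one>\<^sub>a ?I"
  proof (rule iso_cancel_left[of "?a X Y ?I"])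
    have "?a X Y ?I \<cdot> (((\<one>\<^sub>a X \<otimes> RUnit M Y) \<cdot> ?a X Y ?I) \<otimes> \<one>\<^sub>a ?I)
        = ?a X Y ?I \<cdot> ((\<one>\<^sub>a X \<otimes> RUnit M Y) \<otimes> \<one>\<^sub>a ?I) \<cdot> (?a X Y ?I \<otimes> \<one>\<^sub>a ?I)"
      by (simp add: merge)
    also have "\<dots> = (\<one>\<^sub>a X \<otimes> (RUnit M Y \<otimes> \<one>\<^sub>a ?I)) \<cdot> ?a X (Y \<odot> ?I) ?I \<cdot> (?a X Y ?I \<otimes> \<one>\<^sub>a ?I)"
      by (simp add: comp_tail[OF assoc_natural])
    also have "\<dots> = (\<one>\<^sub>a X \<otimes> ((\<one>\<^sub>a Y \<otimes> LUnit M ?I) \<cdot> ?a Y ?I ?I)) \<cdot> ?a X (Y \<odot> ?I) ?I \<cdot>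
        (?a X Y ?I \<otimes> \<one>\<^sub>a ?I)"
      by (simp add: triangle)
    also have "\<dots> = (\<one>\<^sub>a X \<otimes> (\<one>\<^sub>a Y \<otimes> LUnit M ?I)) \<cdot> (\<one>\<^sub>a X \<otimes> ?a Y ?I ?I) \<cdot> ?a X (Y \<odot> ?I) ?I \<cdot>
        (?a X Y ?I \<otimes> \<one>\<^sub>a ?I)"
      by (simp add: merge)
    also have "\<dots> = (\<one>\<^sub>a X \<otimes> (\<one>\<^sub>a Y \<otimes> LUnit M ?I)) \<cdot> ?a X Y (?I \<odot> ?I) \<cdot> ?a (X \<odot> Y) ?I ?I"
      by (simp add: pentagon')
    also have "\<dots> = ?a X Y ?I \<cdot> (\<one>\<^sub>a (X \<odot> Y) \<otimes> LUnit M ?I) \<cdot> ?a (X \<odot> Y) ?I ?I"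
      by (simp add: comp_tail[OF assoc_natural_ident])
    also have "\<dots> = ?a X Y ?I \<cdot> (RUnit M (X \<odot> Y) \<otimes> \<one>\<^sub>a ?I)"
      by (simp add: triangle)
    finally show "?a X Y ?I \<cdot> (((\<one>\<^sub>a X \<otimes> RUnit M Y) \<cdot> ?a X Y ?I) \<otimes> \<one>\<^sub>a ?I)
        = ?a X Y ?I \<cdot> (RUnit M (X \<odot> Y) \<otimes> \<one>\<^sub>a ?I)" .
  qed auto
qed auto

text \<open>
  Both constraints become \<open>LUnit M (UnitO M \<odot> UnitO M)\<close> after tensoring on the right and undoing
  the associator: the left one by \<open>lunit_ten\<close>, the right one by the triangle together with
  naturality of \<open>LUnit\<close> at \<open>LUnit\<close> itself.
\<close>

lemma lunit_eq_runit: "LUnit M (UnitO M) = RUnit M (UnitO M)"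
proof (rule ten_unit_faithful_right)
  let ?I = "UnitO M"
  have "LUnit M (?I \<odot> ?I) = \<one>\<^sub>a ?I \<otimes> LUnit M ?I"
    by (rule iso_cancel_left[of "LUnit M ?I"]) (auto simp: lunit_natural)
  then show "LUnit M ?I \<otimes> \<one>\<^sub>a ?I = RUnit M ?I \<otimes> \<one>\<^sub>a ?I"
    by (simp flip: lunit_ten add: triangle)
qed auto

end

section \<open>Coherence in braided monoidal categories\<close>

context braided_monoidal_category
begin

lemmas [simp] = braid_iso

lemma braid_arr [simp]:
  assumes "X \<in> Obj M" "Y \<in> Obj M"
  shows "Braid M X Y \<in> Arr M" "Dom M (Braid M X Y) = X \<odot> Y" "Cod M (Braid M X Y) = Y \<odot> X"
  using braid_hom[OF assms] by auto

text \<open>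
  The braiding of the first two factors of the right-nested product \<open>X \<odot> (Y \<odot> Z)\<close>. If all objects
  are kept right-nested, braidings enter only through \<open>cross\<close>, and neither the hexagons nor the
  coherence of \<open>interchange\<close> involve inverse associators. Naturality in \<open>Z\<close> expresses that
  braidings at disjoint positions commute.
\<close>

definition cross :: "'o \<Rightarrow> 'o \<Rightarrow> 'o \<Rightarrow> 'a" where
  "cross X Y Z = Assoc M Y X Z \<cdot> (Braid M X Y \<otimes> \<one>\<^sub>a Z) \<cdot> inv_arr M (Assoc M X Y Z)"

lemma cross_arr [simp]:
  assumes "X \<in> Obj M" "Y \<in> Obj M" "Z \<in> Obj M"
  shows "cross X Y Z \<in> Arr M" "Dom M (cross X Y Z) = X \<odot> (Y \<odot> Z)" "Cod M (cross X Y Z) = Y \<odot> (X \<odot> Z)"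
  using assms by (auto simp: cross_def)

lemma cross_assoc:
  assumes "X \<in> Obj M" "Y \<in> Obj M" "Z \<in> Obj M"
  shows "cross X Y Z \<cdot> Assoc M X Y Z = Assoc M Y X Z \<cdot> (Braid M X Y \<otimes> \<one>\<^sub>a Z)"
  using assms by (simp add: cross_def)

lemma cross_natural:
  assumes "f \<in> Arr M" "g \<in> Arr M" "h \<in> Arr M" "Cod M f = X'" "Cod M g = Y'" "Cod M h = Z'"
  shows "cross X' Y' Z' \<cdot> (f \<otimes> (g \<otimes> h)) = (g \<otimes> (f \<otimes> h)) \<cdot> cross (Dom M f) (Dom M g) (Dom M h)"
proof -
  let ?a = "Assoc M (Dom M f) (Dom M g) (Dom M h)"
  have [simp]: "X' \<in> Obj M" "Y' \<in> Obj M" "Z' \<in> Obj M" using assms by auto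
  have br: "Braid M X' Y' \<cdot> (f \<otimes> g) = (g \<otimes> f) \<cdot> Braid M (Dom M f) (Dom M g)"
    using braid_nat[of f "Dom M f" X' g "Dom M g" Y'] assms by simp
  have "(cross X' Y' Z' \<cdot> (f \<otimes> (g \<otimes> h))) \<cdot> ?a = cross X' Y' Z' \<cdot> (Assoc M X' Y' Z' \<cdot> ((f \<otimes> g) \<otimes> h))"
    using assms by (simp add: assoc_natural)
  also have "\<dots> = Assoc M Y' X' Z' \<cdot> ((Braid M X' Y' \<cdot> (f \<otimes> g)) \<otimes> h)"
    using assms by (simp add: comp_tail[OF cross_assoc] merge)
  also have "\<dots> = Assoc M Y' X' Z' \<cdot> ((g \<otimes> f) \<otimes> h) \<cdot> (Braid M (Dom M f) (Dom M g) \<otimes> \<one>\<^sub>a (Dom M h))"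
    using assms by (simp add: br merge)
  also have "\<dots> = ((g \<otimes> (f \<otimes> h)) \<cdot> cross (Dom M f) (Dom M g) (Dom M h)) \<cdot> ?a"
    using assms by (simp add: comp_tail[OF assoc_natural] cross_assoc)
  finally show ?thesis
    by (rule iso_cancel_right[rotated -1]) (use assms in auto)
qed

text \<open>
  The first hexagon: crossing \<open>Y \<odot> Y'\<close> is crossing \<open>Y\<close> and then \<open>Y'\<close>. The equation is tested after
  composing with the isomorphism from the left-nested product, where \<open>cross\<close> is a plain braiding.
\<close>

lemma cross_ten_right:
  assumes [simp]: "X \<in> Obj M" "Y \<in> Obj M" "Y' \<in> Obj M" "Z \<in> Obj M"
  shows "Assoc M Y Y' (X \<odot> Z) \<cdot> cross X (Y \<odot> Y') Z
    = (\<one>\<^sub>a Y \<otimes> cross X Y' Z) \<cdot> cross X Y (Y' \<odot> Z) \<cdot> (\<one>\<^sub>a X \<otimes> Assoc M Y Y' Z)"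
    (is "?L = ?R")
proof -
  let ?a = "Assoc M" and ?c = "Braid M"
  have "?L \<cdot> (?a X (Y \<odot> Y') Z \<cdot> (?a X Y Y' \<otimes> \<one>\<^sub>a Z))
      = ?a Y Y' (X \<odot> Z) \<cdot> ?a (Y \<odot> Y') X Z \<cdot> ((?c X (Y \<odot> Y') \<cdot> ?a X Y Y') \<otimes> \<one>\<^sub>a Z)"
    by (simp add: comp_tail[OF cross_assoc] merge)
  also have "\<dots> = (\<one>\<^sub>a Y \<otimes> ?a Y' X Z) \<cdot> ?a Y (Y' \<odot> X) Z \<cdot> ((?a Y Y' X \<cdot> ?c X (Y \<odot> Y') \<cdot>
      ?a X Y Y') \<otimes> \<one>\<^sub>a Z)"
    by (simp add: comp_tail[OF pentagon'] merge)
  also have "\<dots> = (\<one>\<^sub>a Y \<otimes> ?a Y' X Z) \<cdot> ?a Y (Y' \<odot> X) Z \<cdot> (((\<one>\<^sub>a Y \<otimes> ?c X Y') \<cdot> ?a Y X Y' \<cdot>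
      (?c X Y \<otimes> \<one>\<^sub>a Y')) \<otimes> \<one>\<^sub>a Z)"
    by (simp add: hexagon1)
  also have "\<dots> = (\<one>\<^sub>a Y \<otimes> ?a Y' X Z) \<cdot> ?a Y (Y' \<odot> X) Z \<cdot> ((\<one>\<^sub>a Y \<otimes> ?c X Y') \<otimes> \<one>\<^sub>a Z) \<cdot>
      (?a Y X Y' \<otimes> \<one>\<^sub>a Z) \<cdot> ((?c X Y \<otimes> \<one>\<^sub>a Y') \<otimes> \<one>\<^sub>a Z)"
    by (simp add: merge)
  also have "\<dots> = (\<one>\<^sub>a Y \<otimes> (?a Y' X Z \<cdot> (?c X Y' \<otimes> \<one>\<^sub>a Z))) \<cdot> ?a Y (X \<odot> Y') Z \<cdot> (?a Y X Y' \<otimes> \<one>\<^sub>a Z) \<cdot>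
      ((?c X Y \<otimes> \<one>\<^sub>a Y') \<otimes> \<one>\<^sub>a Z)"
    by (simp add: comp_tail[OF assoc_natural]) (simp add: merge)
  also have "\<dots> = (\<one>\<^sub>a Y \<otimes> (cross X Y' Z \<cdot> ?a X Y' Z)) \<cdot> ?a Y (X \<odot> Y') Z \<cdot> (?a Y X Y' \<otimes> \<one>\<^sub>a Z) \<cdot>
      ((?c X Y \<otimes> \<one>\<^sub>a Y') \<otimes> \<one>\<^sub>a Z)"
    by (simp add: cross_assoc)
  also have "\<dots> = (\<one>\<^sub>a Y \<otimes> cross X Y' Z) \<cdot> (\<one>\<^sub>a Y \<otimes> ?a X Y' Z) \<cdot> ?a Y (X \<odot> Y') Z \<cdot> (?a Y X Y' \<otimes> \<one>\<^sub>a Z) \<cdot>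
      ((?c X Y \<otimes> \<one>\<^sub>a Y') \<otimes> \<one>\<^sub>a Z)"
    by (simp add: merge)
  also have "\<dots> = (\<one>\<^sub>a Y \<otimes> cross X Y' Z) \<cdot> ?a Y X (Y' \<odot> Z) \<cdot> ?a (Y \<odot> X) Y' Z \<cdot>
      ((?c X Y \<otimes> \<one>\<^sub>a Y') \<otimes> \<one>\<^sub>a Z)"
    by (simp add: comp_tail[OF pentagon'])
  also have "\<dots> = (\<one>\<^sub>a Y \<otimes> cross X Y' Z) \<cdot> (?a Y X (Y' \<odot> Z) \<cdot> (?c X Y \<otimes> \<one>\<^sub>a (Y' \<odot> Z))) \<cdot> ?a (X \<odot> Y) Y' Z"
    by (simp add: assoc_natural_ident')
  also have "\<dots> = (\<one>\<^sub>a Y \<otimes> cross X Y' Z) \<cdot> cross X Y (Y' \<odot> Z) \<cdot> ?a X Y (Y' \<odot> Z) \<cdot> ?a (X \<odot> Y) Y' Z"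
    by (simp flip: comp_tail[OF cross_assoc] cross_assoc)
  also have "\<dots> = ?R \<cdot> (?a X (Y \<odot> Y') Z \<cdot> (?a X Y Y' \<otimes> \<one>\<^sub>a Z))"
    by (simp add: pentagon')
  finally show ?thesis
    by (rule iso_cancel_right[rotated -1]) (auto intro: iso_comp)
qed

text \<open>
  A fourth factor \<open>Z\<close> tensored on the right of \<open>cross X Y X'\<close> is absorbed into the third one.
\<close>

lemma cross_tail:
  assumes [simp]: "X \<in> Obj M" "X' \<in> Obj M" "Y \<in> Obj M" "Z \<in> Obj M"
  shows "(\<one>\<^sub>a Y \<otimes> Assoc M X X' Z) \<cdot> Assoc M Y (X \<odot> X') Z \<cdot> (cross X Y X' \<otimes> \<one>\<^sub>a Z)
    = cross X Y (X' \<odot> Z) \<cdot> (\<one>\<^sub>a X \<otimes> Assoc M Y X' Z) \<cdot> Assoc M X (Y \<odot> X') Z"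
    (is "?L = ?R")
proof -
  let ?a = "Assoc M" and ?c = "Braid M"
  have "?L \<cdot> (?a X Y X' \<otimes> \<one>\<^sub>a Z)
      = (\<one>\<^sub>a Y \<otimes> ?a X X' Z) \<cdot> ?a Y (X \<odot> X') Z \<cdot> (?a Y X X' \<otimes> \<one>\<^sub>a Z) \<cdot> ((?c X Y \<otimes> \<one>\<^sub>a X') \<otimes> \<one>\<^sub>a Z)"
    by (simp add: cross_assoc merge)
  also have "\<dots> = ?a Y X (X' \<odot> Z) \<cdot> ?a (Y \<odot> X) X' Z \<cdot> ((?c X Y \<otimes> \<one>\<^sub>a X') \<otimes> \<one>\<^sub>a Z)"
    by (simp add: comp_tail[OF pentagon'])
  also have "\<dots> = cross X Y (X' \<odot> Z) \<cdot> ?a X Y (X' \<odot> Z) \<cdot> ?a (X \<odot> Y) X' Z"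
    by (simp add: assoc_natural_ident' comp_tail[OF cross_assoc])
  also have "\<dots> = ?R \<cdot> (?a X Y X' \<otimes> \<one>\<^sub>a Z)"
    by (simp add: pentagon')
  finally show ?thesis
    by (rule iso_cancel_right[rotated -1]) auto
qed

text \<open>
  The second hexagon with its inverse associators moved to the other side; \<open>cross_ten_left\<close> is the
  same law with a further factor on the right.
\<close>

lemma braid_ten_left:
  assumes [simp]: "X \<in> Obj M" "X' \<in> Obj M" "Y \<in> Obj M"
  shows "Braid M (X \<odot> X') Y = cross X Y X' \<cdot> (\<one>\<^sub>a X \<otimes> Braid M X' Y) \<cdot> Assoc M X X' Y"
proof -
  have "Braid M (X \<odot> X') Y = Assoc M Y X X' \<cdot> (inv_arr M (Assoc M Y X X') \<cdot> Braid M (X \<odot> X') Y \<cdot>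
      inv_arr M (Assoc M X X' Y)) \<cdot> Assoc M X X' Y"
    by simp
  also have "\<dots> = cross X Y X' \<cdot> (\<one>\<^sub>a X \<otimes> Braid M X' Y) \<cdot> Assoc M X X' Y"
    unfolding hexagon2[OF assms] by (simp add: cross_def)
  finally show ?thesis .
qed

lemma cross_ten_left:
  assumes [simp]: "X \<in> Obj M" "X' \<in> Obj M" "Y \<in> Obj M" "Z \<in> Obj M"
  shows "(\<one>\<^sub>a Y \<otimes> Assoc M X X' Z) \<cdot> cross (X \<odot> X') Y Z
    = cross X Y (X' \<odot> Z) \<cdot> (\<one>\<^sub>a X \<otimes> cross X' Y Z) \<cdot> Assoc M X X' (Y \<odot> Z)"
    (is "?L = ?R")
proof -
  let ?a = "Assoc M" and ?c = "Braid M"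
  have "?L \<cdot> ?a (X \<odot> X') Y Z
      = (\<one>\<^sub>a Y \<otimes> ?a X X' Z) \<cdot> ?a Y (X \<odot> X') Z \<cdot> (cross X Y X' \<otimes> \<one>\<^sub>a Z) \<cdot> ((\<one>\<^sub>a X \<otimes> ?c X' Y) \<otimes> \<one>\<^sub>a Z) \<cdot> (?a X X' Y \<otimes> \<one>\<^sub>a Z)"
    by (simp add: cross_assoc braid_ten_left merge)
  also have "\<dots> = cross X Y (X' \<odot> Z) \<cdot> (\<one>\<^sub>a X \<otimes> ?a Y X' Z) \<cdot> ?a X (Y \<odot> X') Z \<cdot>
      ((\<one>\<^sub>a X \<otimes> ?c X' Y) \<otimes> \<one>\<^sub>a Z) \<cdot> (?a X X' Y \<otimes> \<one>\<^sub>a Z)"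
    by (simp add: comp_tail3[OF cross_tail])
  also have "\<dots> = cross X Y (X' \<odot> Z) \<cdot> (\<one>\<^sub>a X \<otimes> (?a Y X' Z \<cdot> (?c X' Y \<otimes> \<one>\<^sub>a Z))) \<cdot> ?a X (X' \<odot> Y) Z \<cdot>
      (?a X X' Y \<otimes> \<one>\<^sub>a Z)"
    by (simp add: comp_tail[OF assoc_natural]) (simp add: merge)
  also have "\<dots> = cross X Y (X' \<odot> Z) \<cdot> (\<one>\<^sub>a X \<otimes> cross X' Y Z) \<cdot> (\<one>\<^sub>a X \<otimes> ?a X' Y Z) \<cdot> ?a X (X' \<odot> Y) Z \<cdot>
      (?a X X' Y \<otimes> \<one>\<^sub>a Z)"
    by (simp add: merge cross_assoc)
  also have "\<dots> = ?R \<cdot> ?a (X \<odot> X') Y Z"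
    by (simp add: pentagon')
  finally show ?thesis
    by (rule iso_cancel_right[rotated -1]) auto
qed

subsection \<open>The interchange isomorphism\<close>

lemma interchange_cross:
  "interchange M W X Y Z = inv_arr M (Assoc M W Y (X \<odot> Z)) \<cdot> (\<one>\<^sub>a W \<otimes> cross X Y Z) \<cdot>
      Assoc M W X (Y \<odot> Z)"
  by (simp add: interchange_def cross_def)

lemma interchange_arr [simp]:
  assumes "W \<in> Obj M" "X \<in> Obj M" "Y \<in> Obj M" "Z \<in> Obj M"
  shows "interchange M W X Y Z \<in> Arr M" "Dom M (interchange M W X Y Z) = (W \<odot> X) \<odot> (Y \<odot> Z)"
    "Cod M (interchange M W X Y Z) = (W \<odot> Y) \<odot> (X \<odot> Z)"
  using assms by (auto simp: interchange_cross)

lemma assoc_interchange: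
  assumes "W \<in> Obj M" "X \<in> Obj M" "Y \<in> Obj M" "Z \<in> Obj M"
  shows "Assoc M W Y (X \<odot> Z) \<cdot> interchange M W X Y Z = (\<one>\<^sub>a W \<otimes> cross X Y Z) \<cdot> Assoc M W X (Y \<odot> Z)"
  using assms by (simp add: interchange_cross)

lemma interchange_natural:
  assumes "f \<in> Arr M" "g \<in> Arr M" "h \<in> Arr M" "k \<in> Arr M"
    "Cod M f = W'" "Cod M g = X'" "Cod M h = Y'" "Cod M k = Z'"
  shows "interchange M W' X' Y' Z' \<cdot> ((f \<otimes> g) \<otimes> (h \<otimes> k))
    = ((f \<otimes> h) \<otimes> (g \<otimes> k)) \<cdot> interchange M (Dom M f) (Dom M g) (Dom M h) (Dom M k)"
proof -
  have [simp]: "W' \<in> Obj M" "X' \<in> Obj M" "Y' \<in> Obj M" "Z' \<in> Obj M" using assms by auto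
  have "Assoc M W' Y' (X' \<odot> Z') \<cdot> (interchange M W' X' Y' Z' \<cdot> ((f \<otimes> g) \<otimes> (h \<otimes> k)))
      = (f \<otimes> (cross X' Y' Z' \<cdot> (g \<otimes> (h \<otimes> k)))) \<cdot> Assoc M (Dom M f) (Dom M g) (Dom M h \<odot> Dom M k)"
    using assms by (simp add: comp_tail[OF assoc_interchange] assoc_natural) (simp add: merge)
  also have "\<dots> = (f \<otimes> (h \<otimes> (g \<otimes> k))) \<cdot> (\<one>\<^sub>a (Dom M f) \<otimes> cross (Dom M g) (Dom M h) (Dom M k)) \<cdot>
      Assoc M (Dom M f) (Dom M g) (Dom M h \<odot> Dom M k)"
    using assms by (simp add: cross_natural merge)
  also have "\<dots> = Assoc M W' Y' (X' \<odot> Z') \<cdot> (((f \<otimes> h) \<otimes> (g \<otimes> k)) \<cdot>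
      interchange M (Dom M f) (Dom M g) (Dom M h) (Dom M k))"
    using assms by (simp add: comp_tail[OF assoc_natural] assoc_interchange)
  finally show ?thesis
    by (rule iso_cancel_left[rotated -1]) (use assms in auto)
qed

text \<open>
  The analogue of \<open>cross_tail\<close>: tensored with \<open>R\<close> and brought to right-nested form, the interchange
  is a single \<open>cross\<close> at the second position.
\<close>

lemma interchange_tail:
  assumes [simp]: "A \<in> Obj M" "B \<in> Obj M" "A' \<in> Obj M" "B' \<in> Obj M" "R \<in> Obj M"
  shows "Assoc M A A' (B \<odot> (B' \<odot> R)) \<cdot> (\<one>\<^sub>a (A \<odot> A') \<otimes> Assoc M B B' R) \<cdot> Assoc M (A \<odot> A') (B \<odot> B') R \<cdot>
      (interchange M A B A' B' \<otimes> \<one>\<^sub>a R)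
    = (\<one>\<^sub>a A \<otimes> (cross B A' (B' \<odot> R) \<cdot> (\<one>\<^sub>a B \<otimes> Assoc M A' B' R))) \<cdot> Assoc M A B ((A' \<odot> B') \<odot> R) \<cdot>
      Assoc M (A \<odot> B) (A' \<odot> B') R" (is "?L = ?R")
proof -
  let ?a = "Assoc M"
  have "?L = (\<one>\<^sub>a A \<otimes> (\<one>\<^sub>a A' \<otimes> ?a B B' R)) \<cdot> ?a A A' ((B \<odot> B') \<odot> R) \<cdot> ?a (A \<odot> A') (B \<odot> B') R \<cdot>
      (interchange M A B A' B' \<otimes> \<one>\<^sub>a R)"
    by (simp add: comp_tail[OF assoc_natural_ident])
  also have "\<dots> = (\<one>\<^sub>a A \<otimes> (\<one>\<^sub>a A' \<otimes> ?a B B' R)) \<cdot> (\<one>\<^sub>a A \<otimes> ?a A' (B \<odot> B') R) \<cdot> ?a A (A' \<odot> (B \<odot> B')) R \<cdot>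
      ((?a A A' (B \<odot> B') \<cdot> interchange M A B A' B') \<otimes> \<one>\<^sub>a R)"
    by (simp add: comp_tail[OF pentagon']) (simp add: merge)
  also have "\<dots> = (\<one>\<^sub>a A \<otimes> (\<one>\<^sub>a A' \<otimes> ?a B B' R)) \<cdot> (\<one>\<^sub>a A \<otimes> ?a A' (B \<odot> B') R) \<cdot> ?a A (A' \<odot> (B \<odot> B')) R \<cdot>
      ((\<one>\<^sub>a A \<otimes> cross B A' B') \<otimes> \<one>\<^sub>a R) \<cdot> (?a A B (A' \<odot> B') \<otimes> \<one>\<^sub>a R)"
    by (simp add: assoc_interchange merge)
  also have "\<dots> = (\<one>\<^sub>a A \<otimes> ((\<one>\<^sub>a A' \<otimes> ?a B B' R) \<cdot> ?a A' (B \<odot> B') R \<cdot> (cross B A' B' \<otimes> \<one>\<^sub>a R))) \<cdot>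
      ?a A (B \<odot> (A' \<odot> B')) R \<cdot>
      (?a A B (A' \<odot> B') \<otimes> \<one>\<^sub>a R)"
    by (simp add: comp_tail[OF assoc_natural]) (simp add: merge)
  also have "\<dots> = (\<one>\<^sub>a A \<otimes> cross B A' (B' \<odot> R)) \<cdot> (\<one>\<^sub>a A \<otimes> (\<one>\<^sub>a B \<otimes> ?a A' B' R)) \<cdot>
      (\<one>\<^sub>a A \<otimes> ?a B (A' \<odot> B') R) \<cdot> ?a A (B \<odot> (A' \<odot> B')) R \<cdot>
      (?a A B (A' \<odot> B') \<otimes> \<one>\<^sub>a R)"
    by (simp add: cross_tail merge)
  also have "\<dots> = (\<one>\<^sub>a A \<otimes> cross B A' (B' \<odot> R)) \<cdot> (\<one>\<^sub>a A \<otimes> (\<one>\<^sub>a B \<otimes> ?a A' B' R)) \<cdot>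
      ?a A B ((A' \<odot> B') \<odot> R) \<cdot> ?a (A \<odot> B) (A' \<odot> B') R"
    by (simp add: pentagon')
  also have "\<dots> = ?R"
    by (simp add: merge)
  finally show ?thesis .
qed

text \<open>
  Associativity of the tensor product of two algebras rests on this identity. Without associators
  both sides move \<open>B\<close> past \<open>A'\<close> and \<open>A''\<close>, and \<open>B'\<close> past \<open>A''\<close>. By the hexagons each side becomes
  a product of three crossings, and the two products differ by an exchange of the disjoint crossings
  of \<open>B\<close> with \<open>A'\<close> and of \<open>B'\<close> with \<open>A''\<close>.
\<close>

lemma interchange_assoc:
  assumes [simp]: "A \<in> Obj M" "B \<in> Obj M" "A' \<in> Obj M" "B' \<in> Obj M" "A'' \<in> Obj M" "B'' \<in> Obj M"
  shows "(Assoc M A A' A'' \<otimes> Assoc M B B' B'') \<cdot> interchange M (A \<odot> A') (B \<odot> B') A'' B'' \<cdot>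
      (interchange M A B A' B' \<otimes> \<one>\<^sub>a (A'' \<odot> B''))
    = interchange M A B (A' \<odot> A'') (B' \<odot> B'') \<cdot> (\<one>\<^sub>a (A \<odot> B) \<otimes> interchange M A' B' A'' B'') \<cdot>
      Assoc M (A \<odot> B) (A' \<odot> B') (A'' \<odot> B'')" (is "?L = ?R")
proof -
  let ?a = "Assoc M" and ?R2 = "A'' \<odot> B''" and ?S = "B \<odot> (B' \<odot> B'')"
  \<comment> \<open>\<open>K\<close> moves \<open>A''\<close> past both \<open>B'\<close> and \<open>B\<close>; \<open>N\<close> right-nests the common target.\<close>
  define K where "K = cross B A'' (B' \<odot> B'') \<cdot> (\<one>\<^sub>a B \<otimes> cross B' A'' B'')"
  have [simp]: "K \<in> Arr M" "Dom M K = B \<odot> (B' \<odot> (A'' \<odot> B''))" "Cod M K = A'' \<odot> (B \<odot> (B' \<odot> B''))"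
    by (auto simp: K_def)
  define N where "N = (\<one>\<^sub>a A \<otimes> ?a A' A'' ?S) \<cdot> ?a A (A' \<odot> A'') ?S"
  have isoN: "is_iso M N"
    by (auto simp: N_def intro: iso_comp)
  let ?mid = "(\<one>\<^sub>a A \<otimes> ((\<one>\<^sub>a A' \<otimes> K) \<cdot> cross B A' (B' \<odot> ?R2) \<cdot> (\<one>\<^sub>a B \<otimes> ?a A' B' ?R2))) \<cdot>
      ?a A B ((A' \<odot> B') \<odot> ?R2) \<cdot> ?a (A \<odot> B) (A' \<odot> B') ?R2"
  have "N \<cdot> ?L = ?a A A' (A'' \<odot> ?S) \<cdot> ?a (A \<odot> A') A'' ?S \<cdot> (\<one>\<^sub>a ((A \<odot> A') \<odot> A'') \<otimes> ?a B B' B'') \<cdot>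
      interchange M (A \<odot> A') (B \<odot> B') A'' B'' \<cdot>
      (interchange M A B A' B' \<otimes> \<one>\<^sub>a ?R2)"
    by (simp add: N_def comp_tail[OF pentagon']) (simp add: merge)
  also have "\<dots> = ?a A A' (A'' \<odot> ?S) \<cdot> (\<one>\<^sub>a (A \<odot> A') \<otimes> (\<one>\<^sub>a A'' \<otimes> ?a B B' B'')) \<cdot>
      (\<one>\<^sub>a (A \<odot> A') \<otimes> cross (B \<odot> B') A'' B'') \<cdot> ?a (A \<odot> A') (B \<odot> B') ?R2 \<cdot>
      (interchange M A B A' B' \<otimes> \<one>\<^sub>a ?R2)"
    by (simp add: comp_tail[OF assoc_natural_ident] comp_tail[OF assoc_interchange])
  also have "\<dots> = ?a A A' (A'' \<odot> ?S) \<cdot> (\<one>\<^sub>a (A \<odot> A') \<otimes> K) \<cdot> (\<one>\<^sub>a (A \<odot> A') \<otimes> ?a B B' ?R2) \<cdot>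
      ?a (A \<odot> A') (B \<odot> B') ?R2 \<cdot>
      (interchange M A B A' B' \<otimes> \<one>\<^sub>a ?R2)"
    by (simp add: merge cross_ten_left K_def)
  also have "\<dots> = (\<one>\<^sub>a A \<otimes> (\<one>\<^sub>a A' \<otimes> K)) \<cdot> ?a A A' (B \<odot> (B' \<odot> ?R2)) \<cdot> (\<one>\<^sub>a (A \<odot> A') \<otimes> ?a B B' ?R2) \<cdot>
      ?a (A \<odot> A') (B \<odot> B') ?R2 \<cdot>
      (interchange M A B A' B' \<otimes> \<one>\<^sub>a ?R2)"
    using comp_tail[OF assoc_natural_ident[of A A' K "A'' \<odot> ?S"]] by simp
  also have "\<dots> = ?mid"
    by (simp add: interchange_tail) (simp add: merge)
  finally have L: "N \<cdot> ?L = ?mid" .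
  have "N \<cdot> ?R = (\<one>\<^sub>a A \<otimes> ?a A' A'' ?S) \<cdot> (\<one>\<^sub>a A \<otimes> cross B (A' \<odot> A'') (B' \<odot> B'')) \<cdot>
      ?a A B ((A' \<odot> A'') \<odot> (B' \<odot> B'')) \<cdot>
      (\<one>\<^sub>a (A \<odot> B) \<otimes> interchange M A' B' A'' B'') \<cdot> ?a (A \<odot> B) (A' \<odot> B') ?R2"
    by (simp add: N_def comp_tail[OF assoc_interchange])
  also have "\<dots> = (\<one>\<^sub>a A \<otimes> (?a A' A'' ?S \<cdot> cross B (A' \<odot> A'') (B' \<odot> B''))) \<cdot>
      (\<one>\<^sub>a A \<otimes> (\<one>\<^sub>a B \<otimes> interchange M A' B' A'' B'')) \<cdot>
      ?a A B ((A' \<odot> B') \<odot> ?R2) \<cdot> ?a (A \<odot> B) (A' \<odot> B') ?R2"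
    by (simp add: comp_tail[OF assoc_natural_ident]) (simp add: merge)
  also have "\<dots> = (\<one>\<^sub>a A \<otimes> ((\<one>\<^sub>a A' \<otimes> cross B A'' (B' \<odot> B'')) \<cdot> cross B A' (A'' \<odot> (B' \<odot> B'')) \<cdot>
      (\<one>\<^sub>a B \<otimes> (?a A' A'' (B' \<odot> B'') \<cdot> interchange M A' B' A'' B'')))) \<cdot>
      ?a A B ((A' \<odot> B') \<odot> ?R2) \<cdot> ?a (A \<odot> B) (A' \<odot> B') ?R2"
    by (simp add: cross_ten_right merge)
  also have "\<dots> = (\<one>\<^sub>a A \<otimes> ((\<one>\<^sub>a A' \<otimes> cross B A'' (B' \<odot> B'')) \<cdot> (cross B A' (A'' \<odot> (B' \<odot> B'')) \<cdot>
      (\<one>\<^sub>a B \<otimes> (\<one>\<^sub>a A' \<otimes> cross B' A'' B''))) \<cdot> (\<one>\<^sub>a B \<otimes> ?a A' B' ?R2))) \<cdot>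
      ?a A B ((A' \<odot> B') \<odot> ?R2) \<cdot> ?a (A \<odot> B) (A' \<odot> B') ?R2"
    by (simp add: assoc_interchange merge)
  also have "\<dots> = ?mid"
    by (simp add: cross_natural merge K_def)
  finally have "N \<cdot> ?L = N \<cdot> ?R" using L by simp
  then show ?thesis
    by (rule iso_cancel_left[rotated -1]) (auto simp: isoN, auto simp: N_def)
qed

text \<open>
  This identity makes the associator a morphism between threefold tensor products of algebras. The
  proof has the pattern of \<open>interchange_assoc\<close>: right-nest the target, expand the crossings of
  composite objects by the hexagons, and commute the two disjoint crossings (\<open>slide\<close>).
\<close>

lemma interchange_assoc_arr:
  assumes [simp]: "A \<in> Obj M" "B \<in> Obj M" "C \<in> Obj M" "A' \<in> Obj M" "B' \<in> Obj M" "C' \<in> Obj M"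
  shows "Assoc M (A \<odot> A') (B \<odot> B') (C \<odot> C') \<cdot> (interchange M A B A' B' \<otimes> \<one>\<^sub>a (C \<odot> C')) \<cdot>
      interchange M (A \<odot> B) C (A' \<odot> B') C'
    = (\<one>\<^sub>a (A \<odot> A') \<otimes> interchange M B C B' C') \<cdot> interchange M A (B \<odot> C) A' (B' \<odot> C') \<cdot> (Assoc M A B C \<otimes> Assoc M A' B' C')"
    (is "?L = ?R")
proof -
  let ?a = "Assoc M" and ?CC = "C \<odot> C'" and ?BC = "B' \<odot> C'"
  define N where "N = ?a A A' (B \<odot> (B' \<odot> ?CC)) \<cdot> (\<one>\<^sub>a (A \<odot> A') \<otimes> ?a B B' ?CC)"
  have isoN: "is_iso M N"
    by (auto simp: N_def intro: iso_comp)
  let ?mid = "(\<one>\<^sub>a A \<otimes> (cross B A' (B' \<odot> ?CC) \<cdot> (\<one>\<^sub>a B \<otimes> ((\<one>\<^sub>a A' \<otimes> cross C B' C') \<cdot> cross C A' ?BC \<cdot>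
      (\<one>\<^sub>a C \<otimes> ?a A' B' C'))))) \<cdot>
    ?a A B (C \<odot> ((A' \<odot> B') \<odot> C')) \<cdot> ?a (A \<odot> B) C ((A' \<odot> B') \<odot> C')"
  have "N \<cdot> ?L = (\<one>\<^sub>a A \<otimes> (cross B A' (B' \<odot> ?CC) \<cdot> (\<one>\<^sub>a B \<otimes> ?a A' B' ?CC))) \<cdot> ?a A B ((A' \<odot> B') \<odot> ?CC) \<cdot>
      ?a (A \<odot> B) (A' \<odot> B') ?CC \<cdot> interchange M (A \<odot> B) C (A' \<odot> B') C'"
    using comp_tail4[OF interchange_tail[of A B A' B' ?CC]] by (simp add: N_def)
  also have "\<dots> = (\<one>\<^sub>a A \<otimes> (cross B A' (B' \<odot> ?CC) \<cdot> (\<one>\<^sub>a B \<otimes> ?a A' B' ?CC))) \<cdot>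
      (\<one>\<^sub>a A \<otimes> (\<one>\<^sub>a B \<otimes> cross C (A' \<odot> B') C')) \<cdot>
      ?a A B (C \<odot> ((A' \<odot> B') \<odot> C')) \<cdot> ?a (A \<odot> B) C ((A' \<odot> B') \<odot> C')"
    by (simp add: assoc_interchange comp_tail[OF assoc_natural_ident])
  also have "\<dots> = ?mid"
    by (simp add: merge cross_ten_right)
  finally have L: "N \<cdot> ?L = ?mid" .
  have slide: "(\<one>\<^sub>a A' \<otimes> (\<one>\<^sub>a B \<otimes> cross C B' C')) \<cdot> cross B A' (C \<odot> ?BC)
      = cross B A' (B' \<odot> ?CC) \<cdot> (\<one>\<^sub>a B \<otimes> (\<one>\<^sub>a A' \<otimes> cross C B' C'))"
    by (simp add: cross_natural)
  have "N \<cdot> ?R = ?a A A' (B \<odot> (B' \<odot> ?CC)) \<cdot> (\<one>\<^sub>a (A \<odot> A') \<otimes> (\<one>\<^sub>a B \<otimes> cross C B' C')) \<cdot>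
      (\<one>\<^sub>a (A \<odot> A') \<otimes> ?a B C ?BC) \<cdot>
      interchange M A (B \<odot> C) A' ?BC \<cdot> (?a A B C \<otimes> ?a A' B' C')"
    by (simp add: N_def merge assoc_interchange)
  also have "\<dots> = (\<one>\<^sub>a A \<otimes> (\<one>\<^sub>a A' \<otimes> (\<one>\<^sub>a B \<otimes> cross C B' C'))) \<cdot> (\<one>\<^sub>a A \<otimes> (\<one>\<^sub>a A' \<otimes> ?a B C ?BC)) \<cdot>
      (\<one>\<^sub>a A \<otimes> cross (B \<odot> C) A' ?BC) \<cdot> ?a A (B \<odot> C) (A' \<odot> ?BC) \<cdot> (?a A B C \<otimes> ?a A' B' C')"
    by (simp add: comp_tail[OF assoc_natural_ident] comp_tail[OF assoc_interchange])
  also have "\<dots> = (\<one>\<^sub>a A \<otimes> (((\<one>\<^sub>a A' \<otimes> (\<one>\<^sub>a B \<otimes> cross C B' C')) \<cdot> cross B A' (C \<odot> ?BC)) \<cdot>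
      (\<one>\<^sub>a B \<otimes> cross C A' ?BC))) \<cdot> (\<one>\<^sub>a A \<otimes> ?a B C (A' \<odot> ?BC)) \<cdot>
      ?a A (B \<odot> C) (A' \<odot> ?BC) \<cdot> (?a A B C \<otimes> ?a A' B' C')"
    by (simp add: merge cross_ten_left)
  also have "\<dots> = (\<one>\<^sub>a A \<otimes> (cross B A' (B' \<odot> ?CC) \<cdot> (\<one>\<^sub>a B \<otimes> ((\<one>\<^sub>a A' \<otimes> cross C B' C') \<cdot>
      cross C A' ?BC)))) \<cdot> (\<one>\<^sub>a A \<otimes> ?a B C (A' \<odot> ?BC)) \<cdot>
      ?a A (B \<odot> C) (A' \<odot> ?BC) \<cdot> (?a A B C \<otimes> \<one>\<^sub>a (A' \<odot> ?BC)) \<cdot> (\<one>\<^sub>a ((A \<odot> B) \<odot> C) \<otimes> ?a A' B' C')"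
    by (simp add: comp_tail[OF slide]) (simp add: merge)
  also have "\<dots> = (\<one>\<^sub>a A \<otimes> (cross B A' (B' \<odot> ?CC) \<cdot> (\<one>\<^sub>a B \<otimes> ((\<one>\<^sub>a A' \<otimes> cross C B' C') \<cdot>
      cross C A' ?BC)))) \<cdot>
      ?a A B (C \<odot> (A' \<odot> ?BC)) \<cdot> ?a (A \<odot> B) C (A' \<odot> ?BC) \<cdot> (\<one>\<^sub>a ((A \<odot> B) \<odot> C) \<otimes> ?a A' B' C')"
    by (simp add: comp_tail[OF pentagon'])
  also have "\<dots> = ?mid"
    by (simp add: comp_tail[OF assoc_natural_ident] assoc_natural_ident) (simp add: merge)
  finally have "N \<cdot> ?L = N \<cdot> ?R" using L by simp
  then show ?thesis
    by (rule iso_cancel_left[rotated -1]) (auto simp: isoN, auto simp: N_def)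
qed

subsection \<open>Compatibility with the unit object\<close>

lemma braid_natural:
  assumes "f \<in> Arr M" "g \<in> Arr M" "Cod M f = X'" "Cod M g = Y'"
  shows "Braid M X' Y' \<cdot> (f \<otimes> g) = (g \<otimes> f) \<cdot> Braid M (Dom M f) (Dom M g)"
  using braid_nat[of f "Dom M f" X' g "Dom M g" Y'] assms by simp

text \<open>
  Braiding with the unit object is determined by the unit constraints. The first hexagon with two
  unit objects gives the claim tensored with the unit object and followed by the invertible
  \<open>Braid M X (UnitO M)\<close>.
\<close>

lemma lunit_braid:
  assumes [simp]: "X \<in> Obj M"
  shows "LUnit M X \<cdot> Braid M X (UnitO M) = RUnit M X"
proof (rule ten_unit_faithful_right)
  let ?I = "UnitO M" and ?a = "Assoc M" and ?c = "Braid M"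
  have "?c X ?I \<cdot> ((LUnit M X \<cdot> ?c X ?I) \<otimes> \<one>\<^sub>a ?I) = ?c X ?I \<cdot> (LUnit M X \<otimes> \<one>\<^sub>a ?I) \<cdot>
      (?c X ?I \<otimes> \<one>\<^sub>a ?I)"
    by (simp add: merge)
  also have "\<dots> = ?c X ?I \<cdot> LUnit M (X \<odot> ?I) \<cdot> ?a ?I X ?I \<cdot> (?c X ?I \<otimes> \<one>\<^sub>a ?I)"
    by (simp add: comp_tail[OF lunit_ten])
  also have "\<dots> = LUnit M (?I \<odot> X) \<cdot> (\<one>\<^sub>a ?I \<otimes> ?c X ?I) \<cdot> ?a ?I X ?I \<cdot> (?c X ?I \<otimes> \<one>\<^sub>a ?I)"
    by (simp add: comp_tail[OF lunit_natural])
  also have "\<dots> = LUnit M (?I \<odot> X) \<cdot> ?a ?I ?I X \<cdot> ?c X (?I \<odot> ?I) \<cdot> ?a X ?I ?I"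
    by (simp add: hexagon1)
  also have "\<dots> = (LUnit M ?I \<otimes> \<one>\<^sub>a X) \<cdot> ?c X (?I \<odot> ?I) \<cdot> ?a X ?I ?I"
    by (simp add: comp_tail[OF lunit_ten])
  also have "\<dots> = ?c X ?I \<cdot> (\<one>\<^sub>a X \<otimes> LUnit M ?I) \<cdot> ?a X ?I ?I"
    by (simp add: comp_tail[OF braid_natural])
  also have "\<dots> = ?c X ?I \<cdot> (RUnit M X \<otimes> \<one>\<^sub>a ?I)"
    by (simp add: triangle)
  finally show "(LUnit M X \<cdot> ?c X ?I) \<otimes> \<one>\<^sub>a ?I = RUnit M X \<otimes> \<one>\<^sub>a ?I"
    by (rule iso_cancel_left[rotated -1]) auto
qed auto

lemma runit_cross:
  assumes [simp]: "X \<in> Obj M" "Y \<in> Obj M"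
  shows "(\<one>\<^sub>a Y \<otimes> RUnit M X) \<cdot> cross X Y (UnitO M) = Braid M X Y \<cdot> (\<one>\<^sub>a X \<otimes> RUnit M Y)"
    (is "?L = ?R")
proof -
  let ?I = "UnitO M"
  have "?L \<cdot> Assoc M X Y ?I = RUnit M (Y \<odot> X) \<cdot> (Braid M X Y \<otimes> \<one>\<^sub>a ?I)"
    by (simp add: cross_assoc comp_tail[OF runit_ten])
  also have "\<dots> = ?R \<cdot> Assoc M X Y ?I"
    by (simp add: runit_natural runit_ten)
  finally show ?thesis
    by (rule iso_cancel_right[rotated -1]) auto
qed

lemma runit_braid:
  assumes [simp]: "X \<in> Obj M"
  shows "RUnit M X \<cdot> Braid M (UnitO M) X = LUnit M X"
proof (rule ten_unit_faithful_left)
  let ?I = "UnitO M" and ?a = "Assoc M" and ?c = "Braid M"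
  have "(?c ?I X \<cdot> (\<one>\<^sub>a ?I \<otimes> (RUnit M X \<cdot> ?c ?I X))) \<cdot> ?a ?I ?I X
      = ?c ?I X \<cdot> (\<one>\<^sub>a ?I \<otimes> RUnit M X) \<cdot> (\<one>\<^sub>a ?I \<otimes> ?c ?I X) \<cdot> ?a ?I ?I X"
    by (simp add: merge)
  also have "\<dots> = (\<one>\<^sub>a X \<otimes> RUnit M ?I) \<cdot> ?c (?I \<odot> ?I) X"
    by (simp add: comp_tail[OF runit_cross] braid_ten_left)
  also have "\<dots> = ?c ?I X \<cdot> (RUnit M ?I \<otimes> \<one>\<^sub>a X)"
    by (simp add: braid_natural)
  also have "\<dots> = (?c ?I X \<cdot> (\<one>\<^sub>a ?I \<otimes> LUnit M X)) \<cdot> ?a ?I ?I X"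
    by (simp add: triangle)
  finally have "?c ?I X \<cdot> (\<one>\<^sub>a ?I \<otimes> (RUnit M X \<cdot> ?c ?I X)) = ?c ?I X \<cdot> (\<one>\<^sub>a ?I \<otimes> LUnit M X)"
    by (rule iso_cancel_right[rotated -1]) auto
  then show "\<one>\<^sub>a ?I \<otimes> (RUnit M X \<cdot> ?c ?I X) = \<one>\<^sub>a ?I \<otimes> LUnit M X"
    by (rule iso_cancel_left[rotated -1]) auto
qed auto

lemma cross_unit_left:
  assumes [simp]: "X \<in> Obj M" "Y \<in> Obj M"
  shows "(\<one>\<^sub>a X \<otimes> LUnit M Y) \<cdot> cross (UnitO M) X Y = LUnit M (X \<odot> Y)" (is "?L = ?R")
proof -
  let ?I = "UnitO M"
  have "?L \<cdot> Assoc M ?I X Y = (RUnit M X \<cdot> Braid M ?I X) \<otimes> \<one>\<^sub>a Y"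
    by (simp add: cross_assoc comp_tail[OF triangle]) (simp add: merge)
  also have "\<dots> = ?R \<cdot> Assoc M ?I X Y"
    by (simp add: runit_braid lunit_ten)
  finally show ?thesis
    by (rule iso_cancel_right[rotated -1]) auto
qed

lemma cross_unit_mid:
  assumes [simp]: "X \<in> Obj M" "Y \<in> Obj M"
  shows "LUnit M (X \<odot> Y) \<cdot> cross X (UnitO M) Y = \<one>\<^sub>a X \<otimes> LUnit M Y" (is "?L = ?R")
proof -
  let ?I = "UnitO M"
  have "?L \<cdot> Assoc M X ?I Y = (LUnit M X \<cdot> Braid M X ?I) \<otimes> \<one>\<^sub>a Y"
    by (simp add: cross_assoc comp_tail[OF lunit_ten]) (simp add: merge)
  also have "\<dots> = ?R \<cdot> Assoc M X ?I Y"
    by (simp add: lunit_braid triangle)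
  finally show ?thesis
    by (rule iso_cancel_right[rotated -1]) auto
qed

text \<open>
  These four identities are the unit laws of a tensor product of algebras and the compatibility of
  \<open>LUnit\<close> and \<open>RUnit\<close> with the products of \<open>unit_alg M \<boxtimes> A\<close> and \<open>A \<boxtimes> unit_alg M\<close>; in each of them the
  only crossing involves a unit object and collapses.
\<close>

lemma interchange_unit_left:
  assumes [simp]: "A \<in> Obj M" "B \<in> Obj M"
  shows "(LUnit M A \<otimes> LUnit M B) \<cdot> interchange M (UnitO M) (UnitO M) A B = LUnit M (A \<odot> B) \<cdot>
      (LUnit M (UnitO M) \<otimes> \<one>\<^sub>a (A \<odot> B))"
proof -
  let ?I = "UnitO M" and ?z = "interchange M (UnitO M) (UnitO M) A B"
  have "(LUnit M A \<otimes> LUnit M B) \<cdot> ?z = (LUnit M A \<otimes> \<one>\<^sub>a B) \<cdot> (\<one>\<^sub>a (?I \<odot> A) \<otimes> LUnit M B) \<cdot> ?z"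
    by (simp add: merge)
  also have "\<dots> = LUnit M (A \<odot> B) \<cdot> Assoc M ?I A B \<cdot> (\<one>\<^sub>a (?I \<odot> A) \<otimes> LUnit M B) \<cdot> ?z"
    by (simp add: comp_tail[OF lunit_ten])
  also have "\<dots> = LUnit M (A \<odot> B) \<cdot> (\<one>\<^sub>a ?I \<otimes> ((\<one>\<^sub>a A \<otimes> LUnit M B) \<cdot> cross ?I A B)) \<cdot>
      Assoc M ?I ?I (A \<odot> B)"
    by (simp add: comp_tail[OF assoc_natural_ident] assoc_interchange) (simp add: merge)
  also have "\<dots> = LUnit M (A \<odot> B) \<cdot> (LUnit M ?I \<otimes> \<one>\<^sub>a (A \<odot> B))"
    by (simp add: cross_unit_left triangle lunit_eq_runit)
  finally show ?thesis .
qed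

lemma interchange_unit_right:
  assumes [simp]: "A \<in> Obj M" "B \<in> Obj M"
  shows "(RUnit M A \<otimes> RUnit M B) \<cdot> interchange M A B (UnitO M) (UnitO M) = RUnit M (A \<odot> B) \<cdot>
      (\<one>\<^sub>a (A \<odot> B) \<otimes> LUnit M (UnitO M))"
proof -
  let ?I = "UnitO M" and ?z = "interchange M A B (UnitO M) (UnitO M)"
  have "(RUnit M A \<otimes> RUnit M B) \<cdot> ?z = (\<one>\<^sub>a A \<otimes> RUnit M B) \<cdot> (RUnit M A \<otimes> \<one>\<^sub>a (B \<odot> ?I)) \<cdot> ?z"
    by (simp add: merge)
  also have "\<dots> = (\<one>\<^sub>a A \<otimes> RUnit M B) \<cdot> (\<one>\<^sub>a A \<otimes> LUnit M (B \<odot> ?I)) \<cdot> Assoc M A ?I (B \<odot> ?I) \<cdot> ?z"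
    by (simp flip: triangle)
  also have "\<dots> = (\<one>\<^sub>a A \<otimes> RUnit M B) \<cdot> (\<one>\<^sub>a A \<otimes> (LUnit M (B \<odot> ?I) \<cdot> cross B ?I ?I)) \<cdot>
      Assoc M A B (?I \<odot> ?I)"
    by (simp add: assoc_interchange) (simp add: merge)
  also have "\<dots> = (\<one>\<^sub>a A \<otimes> RUnit M B) \<cdot> Assoc M A B ?I \<cdot> (\<one>\<^sub>a (A \<odot> B) \<otimes> LUnit M ?I)"
    by (simp add: cross_unit_mid assoc_natural_ident)
  also have "\<dots> = RUnit M (A \<odot> B) \<cdot> (\<one>\<^sub>a (A \<odot> B) \<otimes> LUnit M ?I)"
    by (simp add: comp_tail[OF runit_ten])
  finally show ?thesis .
qed

lemma lunit_interchange:
  assumes [simp]: "A \<in> Obj M" "B \<in> Obj M"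
  shows "LUnit M (A \<odot> B) \<cdot> (LUnit M (UnitO M) \<otimes> \<one>\<^sub>a (A \<odot> B)) \<cdot> interchange M (UnitO M) A (UnitO M) B =
      LUnit M A \<otimes> LUnit M B"
proof -
  let ?I = "UnitO M" and ?z = "interchange M (UnitO M) A (UnitO M) B"
  have "LUnit M (A \<odot> B) \<cdot> (LUnit M ?I \<otimes> \<one>\<^sub>a (A \<odot> B)) \<cdot> ?z
      = LUnit M (A \<odot> B) \<cdot> (\<one>\<^sub>a ?I \<otimes> LUnit M (A \<odot> B)) \<cdot> Assoc M ?I ?I (A \<odot> B) \<cdot> ?z"
    by (simp add: lunit_eq_runit flip: triangle)
  also have "\<dots> = LUnit M (A \<odot> B) \<cdot> (\<one>\<^sub>a ?I \<otimes> (LUnit M (A \<odot> B) \<cdot> cross A ?I B)) \<cdot> Assoc M ?I A (?I \<odot> B)"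
    by (simp add: assoc_interchange) (simp add: merge)
  also have "\<dots> = (\<one>\<^sub>a A \<otimes> LUnit M B) \<cdot> LUnit M (A \<odot> (?I \<odot> B)) \<cdot> Assoc M ?I A (?I \<odot> B)"
    by (simp add: cross_unit_mid comp_tail[OF lunit_natural])
  also have "\<dots> = LUnit M A \<otimes> LUnit M B"
    by (simp add: lunit_ten merge)
  finally show ?thesis .
qed

lemma runit_interchange:
  assumes [simp]: "A \<in> Obj M" "B \<in> Obj M"
  shows "RUnit M (A \<odot> B) \<cdot> (\<one>\<^sub>a (A \<odot> B) \<otimes> LUnit M (UnitO M)) \<cdot> interchange M A (UnitO M) B (UnitO M) =
      RUnit M A \<otimes> RUnit M B"
proof -
  let ?I = "UnitO M" and ?z = "interchange M A (UnitO M) B (UnitO M)"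
  have "RUnit M (A \<odot> B) \<cdot> (\<one>\<^sub>a (A \<odot> B) \<otimes> LUnit M ?I) \<cdot> ?z
      = (\<one>\<^sub>a A \<otimes> RUnit M B) \<cdot> (\<one>\<^sub>a A \<otimes> (\<one>\<^sub>a B \<otimes> LUnit M ?I)) \<cdot> Assoc M A B (?I \<odot> ?I) \<cdot> ?z"
    by (simp flip: runit_ten add: comp_tail[OF assoc_natural_ident])
  also have "\<dots> = (\<one>\<^sub>a A \<otimes> RUnit M B) \<cdot> (\<one>\<^sub>a A \<otimes> ((\<one>\<^sub>a B \<otimes> LUnit M ?I) \<cdot> cross ?I B ?I)) \<cdot>
      Assoc M A ?I (B \<odot> ?I)"
    by (simp add: assoc_interchange) (simp add: merge)
  also have "\<dots> = RUnit M A \<otimes> RUnit M B"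
    by (simp add: cross_unit_left triangle merge)
  finally show ?thesis .
qed

end

section \<open>Concatenation of tensor powers\<close>

context monoidal_category
begin

lemma tpow_obj [simp]: "V \<in> Obj M \<Longrightarrow> tpow M V n \<in> Obj M"
  by (induction n rule: induct_nat_012) auto

lemma tpow_arr_arr [simp]:
  assumes "f \<in> Arr M"
  shows "tpow_arr M f n \<in> Arr M" "Dom M (tpow_arr M f n) = tpow M (Dom M f) n"
    "Cod M (tpow_arr M f n) = tpow M (Cod M f) n"
  using assms by (induction n rule: induct_nat_012) auto

text \<open>
  The definition of tensor powers treats the first power separately. The isomorphisms
  \<open>tpow M V n \<odot> V \<rightarrow> tpow M V (Suc n)\<close>, which are identities except at \<open>n = 0\<close>, hide this and
  give concatenation a uniform recursion.
\<close>

definition snoc_iso :: "'o \<Rightarrow> nat \<Rightarrow> 'a" where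
  "snoc_iso V n = concat_iso M V n (Suc 0)"

lemma snoc_iso_simps [simp]:
  "snoc_iso V 0 = LUnit M V"
  "snoc_iso V (Suc n) = \<one>\<^sub>a (tpow M V (Suc n) \<odot> V)"
  by (auto simp: snoc_iso_def)

lemma snoc_iso_arr [simp]:
  assumes "V \<in> Obj M"
  shows "snoc_iso V n \<in> Arr M" "Dom M (snoc_iso V n) = tpow M V n \<odot> V"
    "Cod M (snoc_iso V n) = tpow M V (Suc n)" "is_iso M (snoc_iso V n)"
  using assms by (cases n; auto)+

lemma snoc_iso_natural:
  assumes "f \<in> Arr M" "V = Cod M f"
  shows "snoc_iso V n \<cdot> (tpow_arr M f n \<otimes> f) = tpow_arr M f (Suc n) \<cdot> snoc_iso (Dom M f) n"
  using assms by (cases n) (auto simp: lunit_natural)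

lemma concat_iso_arr [simp]:
  assumes "V \<in> Obj M"
  shows "concat_iso M V m n \<in> Arr M" "Dom M (concat_iso M V m n) = tpow M V m \<odot> tpow M V n"
    "Cod M (concat_iso M V m n) = tpow M V (m + n)"
proof -
  have "concat_iso M V m n \<in> Arr M \<and> Dom M (concat_iso M V m n) = tpow M V m \<odot> tpow M V n
    \<and> Cod M (concat_iso M V m n) = tpow M V (m + n)"
    using assms by (induction n rule: induct_nat_012) (cases m; auto)+
  then show "concat_iso M V m n \<in> Arr M" "Dom M (concat_iso M V m n) = tpow M V m \<odot> tpow M V n"
    "Cod M (concat_iso M V m n) = tpow M V (m + n)" by auto
qed

lemma concat_iso_snoc:
  assumes "V \<in> Obj M"
  shows "concat_iso M V m (Suc n) \<cdot> (\<one>\<^sub>a (tpow M V m) \<otimes> snoc_iso V n) \<cdot>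
      Assoc M (tpow M V m) (tpow M V n) V
    = snoc_iso V (m + n) \<cdot> (concat_iso M V m n \<otimes> \<one>\<^sub>a V)"
proof (cases n)
  case 0
  then show ?thesis using assms by (simp add: triangle flip: snoc_iso_def)
next
  case (Suc k)
  then show ?thesis using assms by simp
qed

lemma concat_iso_natural:
  assumes [simp]: "f \<in> Arr M" and V: "V = Cod M f"
  shows "concat_iso M V m n \<cdot> (tpow_arr M f m \<otimes> tpow_arr M f n) = tpow_arr M f (m + n) \<cdot>
      concat_iso M (Dom M f) m n"
proof (induction n)
  case 0
  then show ?case by (simp add: V runit_natural)
next
  case (Suc n)
  let ?W = "Dom M f"
  let ?e = "(\<one>\<^sub>a (tpow M ?W m) \<otimes> snoc_iso ?W n) \<cdot> Assoc M (tpow M ?W m) (tpow M ?W n) ?W"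
  have "(concat_iso M V m (Suc n) \<cdot> (tpow_arr M f m \<otimes> tpow_arr M f (Suc n))) \<cdot> ?e
      = concat_iso M V m (Suc n) \<cdot> (\<one>\<^sub>a (tpow M V m) \<otimes> snoc_iso V n) \<cdot> (tpow_arr M f m \<otimes> (tpow_arr M f n \<otimes> f)) \<cdot> Assoc M (tpow M ?W m) (tpow M ?W n) ?W"
    by (simp add: V merge snoc_iso_natural del: tpow_arr.simps snoc_iso_simps concat_iso.simps)
  also have "\<dots> = concat_iso M V m (Suc n) \<cdot> (\<one>\<^sub>a (tpow M V m) \<otimes> snoc_iso V n) \<cdot>
      Assoc M (tpow M V m) (tpow M V n) V \<cdot> ((tpow_arr M f m \<otimes> tpow_arr M f n) \<otimes> f)"
    by (simp add: V assoc_natural del: tpow_arr.simps snoc_iso_simps concat_iso.simps)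
  also have "\<dots> = snoc_iso V (m + n) \<cdot> ((concat_iso M V m n \<cdot> (tpow_arr M f m \<otimes> tpow_arr M f n)) \<otimes> f)"
    by (simp add: V comp_tail3[OF concat_iso_snoc] merge del: tpow_arr.simps snoc_iso_simps concat_iso.simps)
  also have "\<dots> = snoc_iso V (m + n) \<cdot> (tpow_arr M f (m + n) \<otimes> f) \<cdot> (concat_iso M ?W m n \<otimes> \<one>\<^sub>a ?W)"
    by (simp only: Suc.IH) (simp add: V merge del: tpow_arr.simps snoc_iso_simps concat_iso.simps)
  also have "\<dots> = (tpow_arr M f (m + Suc n) \<cdot> concat_iso M ?W m (Suc n)) \<cdot> ?e"
    by (simp add: V comp_tail[OF snoc_iso_natural] concat_iso_snoc del: tpow_arr.simps snoc_iso_simps concat_iso.simps)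
  finally show ?case
    by (rule iso_cancel_right[rotated -1]) (auto simp: V iso_comp simp del: tpow_arr.simps snoc_iso_simps concat_iso.simps)
qed

text \<open>
  Induction on \<open>k\<close>. By \<open>concat_iso_snoc\<close> the step for \<open>Suc k\<close> is the pentagon with one more factor
  \<open>V\<close> appended on the right, applied to the equation for \<open>k\<close>.
\<close>

lemma concat_iso_assoc:
  assumes [simp]: "V \<in> Obj M"
  shows "concat_iso M V (i + j) k \<cdot> (concat_iso M V i j \<otimes> \<one>\<^sub>a (tpow M V k))
    = concat_iso M V i (j + k) \<cdot> (\<one>\<^sub>a (tpow M V i) \<otimes> concat_iso M V j k) \<cdot> Assoc M (tpow M V i) (tpow M V j) (tpow M V k)"
proof (induction k)
  case 0
  then show ?case by (simp add: runit_natural runit_ten)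
next
  case (Suc k)
  note [simp del] = tpow_arr.simps snoc_iso_simps concat_iso.simps tpow.simps
  let ?c = "concat_iso M V" and ?s = "snoc_iso V" and ?p = "tpow M V" and ?a = "Assoc M"
  let ?e = "(\<one>\<^sub>a (?p i \<odot> ?p j) \<otimes> ?s k) \<cdot> ?a (?p i \<odot> ?p j) (?p k) V"
  have "(?c (i + j) (Suc k) \<cdot> (?c i j \<otimes> \<one>\<^sub>a (?p (Suc k)))) \<cdot> ?e
      = ?c (i + j) (Suc k) \<cdot> (\<one>\<^sub>a (?p (i + j)) \<otimes> ?s k) \<cdot> (?c i j \<otimes> \<one>\<^sub>a (?p k \<odot> V)) \<cdot> ?a (?p i \<odot> ?p j) (?p k) V"
    by (simp add: merge)
  also have "\<dots> = ?c (i + j) (Suc k) \<cdot> (\<one>\<^sub>a (?p (i + j)) \<otimes> ?s k) \<cdot> ?a (?p (i + j)) (?p k) V \<cdot>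
      ((?c i j \<otimes> \<one>\<^sub>a (?p k)) \<otimes> \<one>\<^sub>a V)"
    by (simp add: assoc_natural_ident')
  also have "\<dots> = ?s (i + j + k) \<cdot> ((?c (i + j) k \<cdot> (?c i j \<otimes> \<one>\<^sub>a (?p k))) \<otimes> \<one>\<^sub>a V)"
    by (simp add: comp_tail3[OF concat_iso_snoc] merge)
  also have "\<dots> = ?s (i + (j + k)) \<cdot> (?c i (j + k) \<otimes> \<one>\<^sub>a V) \<cdot> ((\<one>\<^sub>a (?p i) \<otimes> ?c j k) \<otimes> \<one>\<^sub>a V) \<cdot>
      (?a (?p i) (?p j) (?p k) \<otimes> \<one>\<^sub>a V)"
    by (simp only: Suc.IH) (simp add: merge add.assoc)
  also have "\<dots> = ?c i (Suc (j + k)) \<cdot> (\<one>\<^sub>a (?p i) \<otimes> ?s (j + k)) \<cdot> ?a (?p i) (?p (j + k)) V \<cdot>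
      ((\<one>\<^sub>a (?p i) \<otimes> ?c j k) \<otimes> \<one>\<^sub>a V) \<cdot> (?a (?p i) (?p j) (?p k) \<otimes> \<one>\<^sub>a V)"
    by (simp add: comp_tail3[OF concat_iso_snoc])
  also have "\<dots> = ?c i (Suc (j + k)) \<cdot> (\<one>\<^sub>a (?p i) \<otimes> (?s (j + k) \<cdot> (?c j k \<otimes> \<one>\<^sub>a V))) \<cdot>
      ?a (?p i) (?p j \<odot> ?p k) V \<cdot> (?a (?p i) (?p j) (?p k) \<otimes> \<one>\<^sub>a V)"
    by (simp add: comp_tail[OF assoc_natural]) (simp add: merge)
  also have "\<dots> = ?c i (Suc (j + k)) \<cdot> (\<one>\<^sub>a (?p i) \<otimes> (?c j (Suc k) \<cdot> (\<one>\<^sub>a (?p j) \<otimes> ?s k))) \<cdot>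
      (\<one>\<^sub>a (?p i) \<otimes> ?a (?p j) (?p k) V) \<cdot> ?a (?p i) (?p j \<odot> ?p k) V \<cdot> (?a (?p i) (?p j) (?p k) \<otimes> \<one>\<^sub>a V)"
    by (simp add: merge flip: concat_iso_snoc)
  also have "\<dots> = ?c i (Suc (j + k)) \<cdot> (\<one>\<^sub>a (?p i) \<otimes> ?c j (Suc k)) \<cdot> (\<one>\<^sub>a (?p i) \<otimes> (\<one>\<^sub>a (?p j) \<otimes> ?s k)) \<cdot>
      ?a (?p i) (?p j) (?p k \<odot> V) \<cdot> ?a (?p i \<odot> ?p j) (?p k) V"
    by (simp add: pentagon') (simp add: merge)
  also have "\<dots> = (?c i (j + Suc k) \<cdot> (\<one>\<^sub>a (?p i) \<otimes> ?c j (Suc k)) \<cdot> ?a (?p i) (?p j) (?p (Suc k))) \<cdot> ?e"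
    by (simp add: comp_tail[OF assoc_natural_ident])
  finally show ?case
    by (rule iso_cancel_right[rotated -1]) (auto intro: iso_comp)
qed

lemma concat_iso_0_left:
  assumes [simp]: "V \<in> Obj M"
  shows "concat_iso M V 0 n = LUnit M (tpow M V n)"
proof (induction n)
  case 0
  then show ?case by (simp add: lunit_eq_runit)
next
  case (Suc n)
  note [simp del] = snoc_iso_simps concat_iso.simps tpow.simps
  let ?I = "UnitO M" and ?p = "tpow M V"
  note [simp] = tpow.simps(1)
  have "concat_iso M V 0 (Suc n) \<cdot> ((\<one>\<^sub>a ?I \<otimes> snoc_iso V n) \<cdot> Assoc M ?I (?p n) V) = snoc_iso V n \<cdot>
      (LUnit M (?p n) \<otimes> \<one>\<^sub>a V)"
    using concat_iso_snoc[of V 0 n] by (simp add: Suc.IH)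
  also have "\<dots> = LUnit M (?p (Suc n)) \<cdot> ((\<one>\<^sub>a ?I \<otimes> snoc_iso V n) \<cdot> Assoc M ?I (?p n) V)"
    by (simp add: comp_tail[OF lunit_natural] lunit_ten)
  finally show ?case
    by (rule iso_cancel_right[rotated -1]) (auto intro: iso_comp)
qed

section \<open>Algebras and iterated multiplication\<close>

lemma algebra_arr [simp]:
  assumes "is_algebra M A"
  shows "Carr A \<in> Obj M" "Mul A \<in> Arr M" "Dom M (Mul A) = Carr A \<odot> Carr A" "Cod M (Mul A) = Carr A"
    "Uni A \<in> Arr M" "Dom M (Uni A) = UnitO M" "Cod M (Uni A) = Carr A"
  using assms by (auto simp: is_algebra_def)

lemma algebra_laws:
  assumes "is_algebra M A"
  shows "Mul A \<cdot> (Mul A \<otimes> \<one>\<^sub>a (Carr A)) = Mul A \<cdot> (\<one>\<^sub>a (Carr A) \<otimes> Mul A) \<cdot>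
      Assoc M (Carr A) (Carr A) (Carr A)"
    "Mul A \<cdot> (Uni A \<otimes> \<one>\<^sub>a (Carr A)) = LUnit M (Carr A)"
    "Mul A \<cdot> (\<one>\<^sub>a (Carr A) \<otimes> Uni A) = RUnit M (Carr A)"
  using assms unfolding is_algebra_def by blast+

lemma mul_assoc:
  assumes "is_algebra M A" "f \<in> Arr M" "g \<in> Arr M" "h \<in> Arr M"
    "Cod M f = Carr A" "Cod M g = Carr A" "Cod M h = Carr A"
  shows "Mul A \<cdot> ((Mul A \<cdot> (f \<otimes> g)) \<otimes> h) = Mul A \<cdot> (f \<otimes> (Mul A \<cdot> (g \<otimes> h))) \<cdot>
      Assoc M (Dom M f) (Dom M g) (Dom M h)"
proof -
  have "Mul A \<cdot> ((Mul A \<cdot> (f \<otimes> g)) \<otimes> h) = (Mul A \<cdot> (Mul A \<otimes> \<one>\<^sub>a (Carr A))) \<cdot> ((f \<otimes> g) \<otimes> h)"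
    using assms by (simp add: merge)
  also have "\<dots> = Mul A \<cdot> (\<one>\<^sub>a (Carr A) \<otimes> Mul A) \<cdot> Assoc M (Carr A) (Carr A) (Carr A) \<cdot> ((f \<otimes> g) \<otimes> h)"
    unfolding algebra_laws(1)[OF assms(1)] using assms by simp
  also have "\<dots> = Mul A \<cdot> (f \<otimes> (Mul A \<cdot> (g \<otimes> h))) \<cdot> Assoc M (Dom M f) (Dom M g) (Dom M h)"
    using assms by (simp add: assoc_natural) (simp add: merge)
  finally show ?thesis .
qed

lemma mul_unit_right:
  assumes "is_algebra M A" "f \<in> Arr M" "Cod M f = Carr A"
  shows "Mul A \<cdot> (f \<otimes> Uni A) = f \<cdot> RUnit M (Dom M f)"
proof -
  have "Mul A \<cdot> (f \<otimes> Uni A) = (Mul A \<cdot> (\<one>\<^sub>a (Carr A) \<otimes> Uni A)) \<cdot> (f \<otimes> \<one>\<^sub>a (UnitO M))"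
    using assms by (simp add: merge)
  also have "\<dots> = f \<cdot> RUnit M (Dom M f)"
    unfolding algebra_laws(3)[OF assms(1)] using assms by (simp add: runit_natural)
  finally show ?thesis .
qed

lemma algebra_homD:
  assumes "is_algebra_hom M A B f"
  shows "f \<in> Arr M" "Dom M f = Carr A" "Cod M f = Carr B"
    "f \<cdot> Mul A = Mul B \<cdot> (f \<otimes> f)" "f \<cdot> Uni A = Uni B"
  using assms by (auto simp: is_algebra_hom_def)

lemma algebra_hom_ident: "is_algebra M A \<Longrightarrow> is_algebra_hom M A A (\<one>\<^sub>a (Carr A))"
  by (simp add: is_algebra_hom_def)

lemma algebra_hom_comp:
  assumes f: "is_algebra_hom M A B f" and g: "is_algebra_hom M B C g"
    and A: "is_algebra M A" and B: "is_algebra M B" and C: "is_algebra M C"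
  shows "is_algebra_hom M A C (g \<cdot> f)"
proof -
  note [simp] = algebra_homD(1-3)[OF f] algebra_homD(1-3)[OF g] A B C
  have "(g \<cdot> f) \<cdot> Mul A = g \<cdot> (f \<cdot> Mul A)" by simp
  also have "\<dots> = (g \<cdot> Mul B) \<cdot> (f \<otimes> f)" by (simp add: algebra_homD(4)[OF f])
  also have "\<dots> = Mul C \<cdot> ((g \<cdot> f) \<otimes> (g \<cdot> f))" by (simp add: algebra_homD(4)[OF g] merge)
  finally show ?thesis
    by (simp add: is_algebra_hom_def algebra_homD(5)[OF f] algebra_homD(5)[OF g])
qed

lemma iter_mul_arr [simp]:
  assumes "is_algebra M A"
  shows "iter_mul M A n \<in> Arr M" "Dom M (iter_mul M A n) = tpow M (Carr A) n" "Cod M (iter_mul M A n) =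
      Carr A"
  using assms by (induction n rule: induct_nat_012) auto

lemma iter_mul_snoc:
  assumes "is_algebra M A"
  shows "iter_mul M A (Suc n) \<cdot> snoc_iso (Carr A) n = Mul A \<cdot> (iter_mul M A n \<otimes> \<one>\<^sub>a (Carr A))"
  using assms by (cases n) (auto simp: algebra_laws)

text \<open>
  General associativity: multiplying a word of length \<open>i + j\<close> is multiplying its two parts and then
  their values.
\<close>

lemma iter_mul_concat:
  assumes [simp]: "is_algebra M A"
  shows "iter_mul M A (i + j) \<cdot> concat_iso M (Carr A) i j = Mul A \<cdot> (iter_mul M A i \<otimes> iter_mul M A j)"
proof (induction j)
  case 0
  then show ?case by (simp add: mul_unit_right)
next
  case (Suc j)
  note [simp del] = snoc_iso_simps concat_iso.simps tpow.simps iter_mul.simps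
  let ?V = "Carr A" and ?\<mu> = "iter_mul M A" and ?p = "tpow M (Carr A)"
  let ?e = "(\<one>\<^sub>a (?p i) \<otimes> snoc_iso ?V j) \<cdot> Assoc M (?p i) (?p j) ?V"
  have "(?\<mu> (i + Suc j) \<cdot> concat_iso M ?V i (Suc j)) \<cdot> ?e = ?\<mu> (Suc (i + j)) \<cdot> snoc_iso ?V (i + j) \<cdot>
      (concat_iso M ?V i j \<otimes> \<one>\<^sub>a ?V)"
    by (simp add: concat_iso_snoc)
  also have "\<dots> = Mul A \<cdot> ((Mul A \<cdot> (?\<mu> i \<otimes> ?\<mu> j)) \<otimes> \<one>\<^sub>a ?V)"
    by (simp add: comp_tail[OF iter_mul_snoc] merge Suc.IH)
  also have "\<dots> = Mul A \<cdot> (?\<mu> i \<otimes> (Mul A \<cdot> (?\<mu> j \<otimes> \<one>\<^sub>a ?V))) \<cdot> Assoc M (?p i) (?p j) ?V"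
    by (simp add: mul_assoc)
  also have "\<dots> = (Mul A \<cdot> (?\<mu> i \<otimes> ?\<mu> (Suc j))) \<cdot> ?e"
    by (simp add: merge iter_mul_snoc)
  finally show ?case
    by (rule iso_cancel_right[rotated -1]) (auto intro: iso_comp)
qed

end

section \<open>The tensor algebra\<close>

context category
begin

lemma coproduct_arr:
  assumes "is_coproduct C V S i"
  shows "S \<in> Obj C" "i n \<in> Arr C" "Dom C (i n) = V n" "Cod C (i n) = S"
  using assms by (auto simp: is_coproduct_def)

lemma coproduct_lift:
  assumes "is_coproduct C V S i" "Y \<in> Obj C" "\<And>n. g n \<in> Arr C" "\<And>n. Dom C (g n) = V n"
      "\<And>n. Cod C (g n) = Y"
  shows "\<exists>!h. h \<in> Hom C S Y \<and> (\<forall>n. h \<cdot> i n = g n)"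
  using assms unfolding is_coproduct_def in_Hom_iff by blast

lemma coproduct_ext:
  assumes i: "is_coproduct C V S i" and [simp]: "g \<in> Arr C" "h \<in> Arr C" "Dom C g = S" "Dom C h = S"
    and cod: "Cod C g = Cod C h" and eq: "\<And>n. g \<cdot> i n = h \<cdot> i n"
  shows "g = h"
proof -
  let ?P = "\<lambda>k. k \<in> Hom C S (Cod C g) \<and> (\<forall>n. k \<cdot> i n = g \<cdot> i n)"
  have "\<exists>!k. ?P k"
    by (rule coproduct_lift[OF i]) (auto simp: coproduct_arr[OF i])
  moreover have "?P g" by simp
  moreover have "?P h" by (simp add: cod eq)
  ultimately show ?thesis by blast
qed

end

locale tensor_algebras = monoidal_category M for M :: "('o, 'a, 'z) moncat_scheme" (structure) +
  fixes al :: "'o \<Rightarrow> nat \<Rightarrow> 'a"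
  assumes tensor_coproduct: "V \<in> Obj M \<Longrightarrow> is_coproduct M (tpow M V) (tensor_obj M al V) (al V)"
    and left_preserves: "X \<in> Obj M \<Longrightarrow> preserves_denumerable_coproducts M M (tensor_left M X)"
    and right_preserves: "X \<in> Obj M \<Longrightarrow> preserves_denumerable_coproducts M M (tensor_right M X)"
begin

abbreviation T where "T V \<equiv> tensor_obj M al V"
abbreviation TA where "TA V \<equiv> tensor_alg M al V"

lemma tensor_obj_arr [simp]:
  assumes "V \<in> Obj M"
  shows "T V \<in> Obj M" "al V n \<in> Arr M" "Dom M (al V n) = tpow M V n" "Cod M (al V n) = T V"
  using coproduct_arr[OF tensor_coproduct[OF assms]] by auto

lemma ten_left_coproduct:
  "\<lbrakk>X \<in> Obj M; \<And>n. V n \<in> Obj M; is_coproduct M V S i\<rbrakk> \<Longrightarrow> is_coproduct M (\<lambda>n. X \<odot> V n) (X \<odot> S) (\<lambda>n. \<one>\<^sub>a X \<otimes> i n)"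
  using left_preserves[of X] unfolding preserves_denumerable_coproducts_def tensor_left_def by fastforce

lemma ten_right_coproduct:
  "\<lbrakk>X \<in> Obj M; \<And>n. V n \<in> Obj M; is_coproduct M V S i\<rbrakk> \<Longrightarrow> is_coproduct M (\<lambda>n. V n \<odot> X) (S \<odot> X) (\<lambda>n. i n \<otimes> \<one>\<^sub>a X)"
  using right_preserves[of X] unfolding preserves_denumerable_coproducts_def tensor_right_def by fastforce

lemma tensor_ext:
  assumes "V \<in> Obj M" "g \<in> Arr M" "h \<in> Arr M" "Dom M g = T V" "Dom M h = T V" "Cod M g = Cod M h"
    "\<And>n. g \<cdot> al V n = h \<cdot> al V n"
  shows "g = h"
  using coproduct_ext[OF tensor_coproduct] assms by blast

text \<open>
  Tensoring preserves the coproducts, so the products of inclusions are jointly epimorphic on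
  twofold and threefold tensor products of tensor algebras.
\<close>

lemma tensor_ext2:
  assumes [simp]: "V \<in> Obj M" "W \<in> Obj M" "g \<in> Arr M" "h \<in> Arr M"
    and [simp]: "Dom M g = T V \<odot> T W" "Dom M h = T V \<odot> T W" and cod: "Cod M g = Cod M h"
    and eq: "\<And>i j. g \<cdot> (al V i \<otimes> al W j) = h \<cdot> (al V i \<otimes> al W j)"
  shows "g = h"
proof (rule coproduct_ext[OF ten_right_coproduct[OF _ _ tensor_coproduct, of "T W" V]])
  fix i
  show "g \<cdot> (al V i \<otimes> \<one>\<^sub>a (T W)) = h \<cdot> (al V i \<otimes> \<one>\<^sub>a (T W))"
  proof (rule coproduct_ext[OF ten_left_coproduct[OF _ _ tensor_coproduct, of "tpow M V i" W]])
    fix j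
    show "(g \<cdot> (al V i \<otimes> \<one>\<^sub>a (T W))) \<cdot> (\<one>\<^sub>a (tpow M V i) \<otimes> al W j) = (h \<cdot> (al V i \<otimes> \<one>\<^sub>a (T W))) \<cdot>
        (\<one>\<^sub>a (tpow M V i) \<otimes> al W j)"
      using eq by (simp add: merge)
  qed (auto simp: cod)
qed (auto simp: cod)

lemma tensor_ext3:
  assumes [simp]: "U \<in> Obj M" "V \<in> Obj M" "W \<in> Obj M" "g \<in> Arr M" "h \<in> Arr M"
    and [simp]: "Dom M g = (T U \<odot> T V) \<odot> T W" "Dom M h = (T U \<odot> T V) \<odot> T W" and cod: "Cod M g = Cod M h"
    and eq: "\<And>i j k. g \<cdot> ((al U i \<otimes> al V j) \<otimes> al W k) = h \<cdot> ((al U i \<otimes> al V j) \<otimes> al W k)"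
  shows "g = h"
proof (rule coproduct_ext[OF ten_left_coproduct[OF _ _ tensor_coproduct, of "T U \<odot> T V" W]])
  fix k
  let ?P = "tpow M W k"
  show "g \<cdot> (\<one>\<^sub>a (T U \<odot> T V) \<otimes> al W k) = h \<cdot> (\<one>\<^sub>a (T U \<odot> T V) \<otimes> al W k)"
  proof (rule coproduct_ext[OF ten_right_coproduct[OF _ _ ten_right_coproduct[OF _ _ tensor_coproduct, of "T V" U], of ?P]])
    fix i
    let ?g = "\<lambda>g. (g \<cdot> (\<one>\<^sub>a (T U \<odot> T V) \<otimes> al W k)) \<cdot> ((al U i \<otimes> \<one>\<^sub>a (T V)) \<otimes> \<one>\<^sub>a ?P)"
    show "?g g = ?g h"
    proof (rule coproduct_ext[OF ten_right_coproduct[OF _ _ ten_left_coproduct[OF _ _ tensor_coproduct, of "tpow M U i" V], of ?P]])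
      fix j
      show "?g g \<cdot> ((\<one>\<^sub>a (tpow M U i) \<otimes> al V j) \<otimes> \<one>\<^sub>a ?P) = ?g h \<cdot>
          ((\<one>\<^sub>a (tpow M U i) \<otimes> al V j) \<otimes> \<one>\<^sub>a ?P)"
        using eq by (simp add: merge)
    qed (auto simp: cod)
  qed (auto simp: cod)
qed (auto simp: cod)

text \<open>
  The product exists by lifting in one variable at a time: first over the coproduct
  \<open>tpow M V i \<odot> T V\<close> for fixed \<open>i\<close>, and then over \<open>T V \<odot> T V\<close>.
\<close>

lemma tensor_mul_ex1:
  assumes [simp]: "V \<in> Obj M"
  shows "\<exists>!m. m \<in> Hom M (T V \<odot> T V) (T V) \<and> (\<forall>i j. m \<cdot> (al V i \<otimes> al V j) = al V (i + j) \<cdot>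
      concat_iso M V i j)"
proof -
  have "\<exists>m. m \<in> Hom M (tpow M V i \<odot> T V) (T V) \<and> (\<forall>j. m \<cdot> (\<one>\<^sub>a (tpow M V i) \<otimes> al V j) = al V (i + j) \<cdot>
      concat_iso M V i j)" for i
    by (rule ex1_implies_ex, rule coproduct_lift[OF ten_left_coproduct[OF _ _ tensor_coproduct]]) auto
  then have "\<forall>i. \<exists>m. m \<in> Hom M (tpow M V i \<odot> T V) (T V) \<and> (\<forall>j. m \<cdot> (\<one>\<^sub>a (tpow M V i) \<otimes> al V j) =
      al V (i + j) \<cdot> concat_iso M V i j)" ..
  from choice[OF this] obtain m where
    "\<forall>i. m i \<in> Hom M (tpow M V i \<odot> T V) (T V) \<and> (\<forall>j. m i \<cdot> (\<one>\<^sub>a (tpow M V i) \<otimes> al V j) = al V (i + j) \<cdot>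
        concat_iso M V i j)"
    by blast
  then have m: "\<And>i. m i \<in> Arr M" "\<And>i. Dom M (m i) = tpow M V i \<odot> T V" "\<And>i. Cod M (m i) = T V"
      "\<And>i j. m i \<cdot> (\<one>\<^sub>a (tpow M V i) \<otimes> al V j) = al V (i + j) \<cdot> concat_iso M V i j"
    by simp_all
  have "\<exists>!n. n \<in> Hom M (T V \<odot> T V) (T V) \<and> (\<forall>i. n \<cdot> (al V i \<otimes> \<one>\<^sub>a (T V)) = m i)"
    by (rule coproduct_lift[OF ten_right_coproduct[OF _ _ tensor_coproduct]]) (auto simp: m)
  then obtain n where "n \<in> Hom M (T V \<odot> T V) (T V) \<and> (\<forall>i. n \<cdot> (al V i \<otimes> \<one>\<^sub>a (T V)) = m i)"
    by blast
  then have n: "n \<in> Arr M" "Dom M n = T V \<odot> T V" "Cod M n = T V" "\<And>i. n \<cdot> (al V i \<otimes> \<one>\<^sub>a (T V)) = m i"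
    by simp_all
  have nij: "n \<cdot> (al V i \<otimes> al V j) = al V (i + j) \<cdot> concat_iso M V i j" for i j
  proof -
    have "n \<cdot> (al V i \<otimes> al V j) = (n \<cdot> (al V i \<otimes> \<one>\<^sub>a (T V))) \<cdot> (\<one>\<^sub>a (tpow M V i) \<otimes> al V j)"
      using n(1-3) by (simp add: merge)
    then show ?thesis by (simp only: n(4) m(4))
  qed
  show ?thesis
  proof (rule ex1I[of _ n])
    show "n \<in> Hom M (T V \<odot> T V) (T V) \<and> (\<forall>i j. n \<cdot> (al V i \<otimes> al V j) = al V (i + j) \<cdot>
        concat_iso M V i j)"
      using n(1-3) nij by simp
  next
    fix k assume k: "k \<in> Hom M (T V \<odot> T V) (T V) \<and> (\<forall>i j. k \<cdot> (al V i \<otimes> al V j) = al V (i + j) \<cdot>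
        concat_iso M V i j)"
    show "k = n"
    proof (rule tensor_ext2[of V V])
      fix i j
      have "k \<cdot> (al V i \<otimes> al V j) = al V (i + j) \<cdot> concat_iso M V i j" using k by blast
      then show "k \<cdot> (al V i \<otimes> al V j) = n \<cdot> (al V i \<otimes> al V j)" by (simp only: nij)
    qed (use k n(1-3) in simp_all)
  qed
qed

lemma tensor_alg_simps [simp]:
  "Carr (TA V) = T V" "Uni (TA V) = al V 0"
  by (auto simp: tensor_alg_def)

lemma tensor_mul:
  assumes [simp]: "V \<in> Obj M"
  shows "Mul (TA V) \<in> Arr M" "Dom M (Mul (TA V)) = T V \<odot> T V" "Cod M (Mul (TA V)) = T V"
    "Mul (TA V) \<cdot> (al V i \<otimes> al V j) = al V (i + j) \<cdot> concat_iso M V i j"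
  using theI'[OF tensor_mul_ex1[OF assms]] by (simp_all add: tensor_alg_def)

lemma tensor_mul_al:
  assumes [simp]: "V \<in> Obj M" and "f \<in> Arr M" "g \<in> Arr M" "Cod M f = tpow M V i" "Cod M g = tpow M V j"
  shows "Mul (TA V) \<cdot> ((al V i \<cdot> f) \<otimes> (al V j \<cdot> g)) = al V (i + j) \<cdot> concat_iso M V i j \<cdot> (f \<otimes> g)"
proof -
  have "Mul (TA V) \<cdot> ((al V i \<cdot> f) \<otimes> (al V j \<cdot> g)) = (Mul (TA V) \<cdot> (al V i \<otimes> al V j)) \<cdot> (f \<otimes> g)"
    using assms by (simp add: merge tensor_mul(1-3))
  then show ?thesis
    using assms by (simp add: tensor_mul(4))
qed

lemma tensor_alg_algebra [simp]:
  assumes [simp]: "V \<in> Obj M"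
  shows "is_algebra M (TA V)"
proof -
  note [simp] = tensor_mul(1-3)
  let ?m = "Mul (TA V)" and ?i = "\<one>\<^sub>a (T V)" and ?p = "tpow M V"
  have al0: "al V 0 = al V 0 \<cdot> \<one>\<^sub>a (UnitO M)" by simp
  have assoc: "?m \<cdot> (?m \<otimes> ?i) = ?m \<cdot> (?i \<otimes> ?m) \<cdot> Assoc M (T V) (T V) (T V)"
  proof (rule tensor_ext3[of V V V])
    fix i j k
    have "(?m \<cdot> (?m \<otimes> ?i)) \<cdot> ((al V i \<otimes> al V j) \<otimes> al V k) = ?m \<cdot> ((al V (i + j) \<cdot>
        concat_iso M V i j) \<otimes> (al V k \<cdot> \<one>\<^sub>a (?p k)))"
      by (simp add: merge tensor_mul(4))
    also have "\<dots> = al V (i + (j + k)) \<cdot> (concat_iso M V (i + j) k \<cdot> (concat_iso M V i j \<otimes> \<one>\<^sub>a (?p k)))"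
      by (simp only: tensor_mul_al concat_iso_arr ident_arr tpow_obj assms add.assoc)
    also have "\<dots> = al V (i + (j + k)) \<cdot> (concat_iso M V i (j + k) \<cdot> (\<one>\<^sub>a (?p i) \<otimes> concat_iso M V j k)) \<cdot>
        Assoc M (?p i) (?p j) (?p k)"
      by (simp add: concat_iso_assoc)
    also have "\<dots> = (?m \<cdot> ((al V i \<cdot> \<one>\<^sub>a (?p i)) \<otimes> (al V (j + k) \<cdot> concat_iso M V j k))) \<cdot>
        Assoc M (?p i) (?p j) (?p k)"
      by (subst tensor_mul_al) (auto simp: add.assoc)
    also have "\<dots> = (?m \<cdot> (al V i \<otimes> (?m \<cdot> (al V j \<otimes> al V k)))) \<cdot> Assoc M (?p i) (?p j) (?p k)"
      by (simp add: tensor_mul(4))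
    also have "\<dots> = (?m \<cdot> (?i \<otimes> ?m) \<cdot> Assoc M (T V) (T V) (T V)) \<cdot> ((al V i \<otimes> al V j) \<otimes> al V k)"
      by (simp add: assoc_natural) (simp add: merge)
    finally show "(?m \<cdot> (?m \<otimes> ?i)) \<cdot> ((al V i \<otimes> al V j) \<otimes> al V k)
      = (?m \<cdot> (?i \<otimes> ?m) \<cdot> Assoc M (T V) (T V) (T V)) \<cdot> ((al V i \<otimes> al V j) \<otimes> al V k)" .
  qed auto
  have left: "?m \<cdot> (al V 0 \<otimes> ?i) = LUnit M (T V)"
  proof (rule coproduct_ext[OF ten_left_coproduct[OF _ _ tensor_coproduct, of "UnitO M" V]])
    fix n
    show "(?m \<cdot> (al V 0 \<otimes> ?i)) \<cdot> (\<one>\<^sub>a (UnitO M) \<otimes> al V n) = LUnit M (T V) \<cdot> (\<one>\<^sub>a (UnitO M) \<otimes> al V n)"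
      by (simp add: merge lunit_natural tensor_mul(4) concat_iso_0_left)
  qed auto
  have right: "?m \<cdot> (?i \<otimes> al V 0) = RUnit M (T V)"
  proof (rule coproduct_ext[OF ten_right_coproduct[OF _ _ tensor_coproduct, of "UnitO M" V]])
    fix n
    show "(?m \<cdot> (?i \<otimes> al V 0)) \<cdot> (al V n \<otimes> \<one>\<^sub>a (UnitO M)) = RUnit M (T V) \<cdot> (al V n \<otimes> \<one>\<^sub>a (UnitO M))"
      by (simp add: merge runit_natural tensor_mul(4))
  qed auto
  show ?thesis
    unfolding is_algebra_def tensor_alg_simps
    using assoc left right by (simp del: comp_assoc')
qed

text \<open>
  The inclusion of a power \<open>Suc n\<close> is the product of the inclusions of the powers \<open>n\<close> and \<open>1\<close>, up to
  \<open>snoc_iso\<close>.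
\<close>

lemma tensor_hom_Suc:
  assumes [simp]: "V \<in> Obj M" and f: "is_algebra_hom M (TA V) A f"
    and A: "Mul A \<in> Arr M" "Dom M (Mul A) = Carr A \<odot> Carr A"
  shows "f \<cdot> al V (Suc n) = Mul A \<cdot> ((f \<cdot> al V n) \<otimes> (f \<cdot> al V (Suc 0))) \<cdot> inv_arr M (snoc_iso V n)"
proof -
  note [simp] = algebra_homD(1-3)[OF f] A
  have "f \<cdot> al V (Suc n) = f \<cdot> (al V (n + Suc 0) \<cdot> concat_iso M V n (Suc 0)) \<cdot> inv_arr M (snoc_iso V n)"
    by (simp flip: snoc_iso_def del: tpow.simps snoc_iso_simps)
  also have "\<dots> = (f \<cdot> Mul (TA V)) \<cdot> (al V n \<otimes> al V (Suc 0)) \<cdot> inv_arr M (snoc_iso V n)"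
    by (subst tensor_mul(4)[symmetric]) (auto simp: tensor_mul(1-3))
  also have "\<dots> = Mul A \<cdot> ((f \<cdot> al V n) \<otimes> (f \<cdot> al V (Suc 0))) \<cdot> inv_arr M (snoc_iso V n)"
    unfolding algebra_homD(4)[OF f] by (simp add: merge)
  finally show ?thesis .
qed

text \<open>
  By induction on the degree: \<open>tensor_hom_Suc\<close> splits off the last letter of a word.
\<close>

lemma tensor_hom_ext:
  assumes [simp]: "V \<in> Obj M" and g: "is_algebra_hom M (TA V) A g" and h: "is_algebra_hom M (TA V) A h"
    and A: "Mul A \<in> Arr M" "Dom M (Mul A) = Carr A \<odot> Carr A"
    and eq: "g \<cdot> al V (Suc 0) = h \<cdot> al V (Suc 0)"
  shows "g = h"
proof (rule tensor_ext[of V])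
  show "g \<cdot> al V n = h \<cdot> al V n" for n
  proof (induction n)
    case 0
    show ?case using algebra_homD(5)[OF g] algebra_homD(5)[OF h] by simp
  next
    case (Suc n)
    show ?case
      unfolding tensor_hom_Suc[OF assms(1) g A, of n] tensor_hom_Suc[OF assms(1) h A, of n] Suc.IH eq ..
  qed
qed (use algebra_homD(1-3)[OF g] algebra_homD(1-3)[OF h] in auto)

text \<open>
  Multiplicativity can be tested on pairs of homogeneous components.
\<close>

lemma algebra_hom_from_tensorI:
  assumes [simp]: "V \<in> Obj M" and A: "is_algebra M A"
    and [simp]: "h \<in> Arr M" "Dom M h = T V" "Cod M h = Carr A" and "h \<cdot> al V 0 = Uni A"
    and eq: "\<And>i j. h \<cdot> al V (i + j) \<cdot> concat_iso M V i j = Mul A \<cdot> ((h \<cdot> al V i) \<otimes> (h \<cdot> al V j))"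
  shows "is_algebra_hom M (TA V) A h"
proof -
  note [simp] = A
  have "h \<cdot> Mul (TA V) = Mul A \<cdot> (h \<otimes> h)"
  proof (rule tensor_ext2[of V V])
    fix i j
    show "(h \<cdot> Mul (TA V)) \<cdot> (al V i \<otimes> al V j) = (Mul A \<cdot> (h \<otimes> h)) \<cdot> (al V i \<otimes> al V j)"
      by (simp add: tensor_mul eq merge)
  qed (auto simp: tensor_mul)
  then show ?thesis
    using assms by (simp add: is_algebra_hom_def)
qed

lemma tensor_arr_arr:
  assumes [simp]: "f \<in> Arr M"
  shows "tensor_arr M al f \<in> Arr M" "Dom M (tensor_arr M al f) = T (Dom M f)"
      "Cod M (tensor_arr M al f) = T (Cod M f)"
    "tensor_arr M al f \<cdot> al (Dom M f) n = al (Cod M f) n \<cdot> tpow_arr M f n"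
proof -
  have "\<exists>!h. h \<in> Hom M (T (Dom M f)) (T (Cod M f)) \<and> (\<forall>n. h \<cdot> al (Dom M f) n = al (Cod M f) n \<cdot>
      tpow_arr M f n)"
    by (rule coproduct_lift[OF tensor_coproduct]) auto
  from theI'[OF this] show "tensor_arr M al f \<in> Arr M" "Dom M (tensor_arr M al f) = T (Dom M f)"
      "Cod M (tensor_arr M al f) = T (Cod M f)"
    "tensor_arr M al f \<cdot> al (Dom M f) n = al (Cod M f) n \<cdot> tpow_arr M f n"
    unfolding tensor_arr_def by simp_all
qed

lemma tensor_arr_hom:
  assumes [simp]: "f \<in> Arr M"
  shows "is_algebra_hom M (TA (Dom M f)) (TA (Cod M f)) (tensor_arr M al f)"
proof (rule algebra_hom_from_tensorI)
  note [simp] = tensor_arr_arr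
  let ?V = "Dom M f" and ?W = "Cod M f" and ?h = "tensor_arr M al f"
  fix i j
  have "?h \<cdot> al ?V (i + j) \<cdot> concat_iso M ?V i j = al ?W (i + j) \<cdot> tpow_arr M f (i + j) \<cdot>
      concat_iso M ?V i j"
    by (simp add: comp_tail[OF tensor_arr_arr(4)])
  also have "\<dots> = Mul (TA ?W) \<cdot> ((?h \<cdot> al ?V i) \<otimes> (?h \<cdot> al ?V j))"
    by (simp add: tensor_mul_al concat_iso_natural)
  finally show "?h \<cdot> al ?V (i + j) \<cdot> concat_iso M ?V i j = Mul (TA ?W) \<cdot> ((?h \<cdot> al ?V i) \<otimes> (?h \<cdot>
      al ?V j))" .
qed (auto simp: tensor_arr_arr)

abbreviation mult_out :: "('o, 'a) alg \<Rightarrow> 'a" where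
  "mult_out A \<equiv> und (tensor_counit M al A)"

lemma mult_out_arr:
  assumes [simp]: "is_algebra M A"
  shows "mult_out A \<in> Arr M" "Dom M (mult_out A) = T (Carr A)" "Cod M (mult_out A) = Carr A"
    "mult_out A \<cdot> al (Carr A) n = iter_mul M A n"
proof -
  have "\<exists>!h. h \<in> Hom M (T (Carr A)) (Carr A) \<and> (\<forall>n. h \<cdot> al (Carr A) n = iter_mul M A n)"
    by (rule coproduct_lift[OF tensor_coproduct]) auto
  from theI'[OF this] show "mult_out A \<in> Arr M" "Dom M (mult_out A) = T (Carr A)" "Cod M (mult_out A) =
      Carr A"
    "mult_out A \<cdot> al (Carr A) n = iter_mul M A n"
    by (simp_all add: und_def tensor_counit_def forget_alg_def)
qed

lemma mult_out_hom:
  assumes [simp]: "is_algebra M A"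
  shows "is_algebra_hom M (TA (Carr A)) A (mult_out A)"
  by (rule algebra_hom_from_tensorI)
    (auto simp: mult_out_arr comp_tail[OF mult_out_arr(4)] iter_mul_concat)

text \<open>
  The universal property of the tensor algebra, obtained from functoriality and the counit: the lift
  of \<open>f\<close> applies \<open>f\<close> to every letter and then multiplies.
\<close>

lemma tensor_lift_ex1:
  fixes A :: "('o, 'a) alg"
  assumes [simp]: "is_algebra M A" and f [simp]: "f \<in> Arr M" "Dom M f = V" "Cod M f = Carr A"
  shows "\<exists>!h. is_algebra_hom M (TA V) A h \<and> h \<cdot> al V (Suc 0) = f"
proof -
  have [simp]: "V \<in> Obj M" using dom_obj[OF f(1)] unfolding f(2) .
  let ?h = "mult_out A \<cdot> tensor_arr M al f"
  note [simp] = mult_out_arr[of A] tensor_arr_arr[OF f(1), unfolded f(2,3)]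
  have hom: "is_algebra_hom M (TA V) A ?h"
    using tensor_arr_hom[OF f(1), unfolded f(2,3)] mult_out_hom[of A]
    by (rule algebra_hom_comp) auto
  have gen: "?h \<cdot> al V (Suc 0) = f"
    by (simp add: comp_tail[OF mult_out_arr(4)])
  show ?thesis
  proof (rule ex1I)
    show "is_algebra_hom M (TA V) A ?h \<and> ?h \<cdot> al V (Suc 0) = f" using hom gen by blast
  next
    fix h assume h: "is_algebra_hom M (TA V) A h \<and> h \<cdot> al V (Suc 0) = f"
    show "h = ?h"
      by (rule tensor_hom_ext[of V A]) (use h hom gen in auto)
  qed
qed

end

lemma truncate_simps [simp]:
  "Carr (alg.truncate A) = Carr A" "Mul (alg.truncate A) = Mul A" "Uni (alg.truncate A) = Uni A"
  by (simp_all add: alg.truncate_def)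

lemma truncate_algebra:
  "is_algebra M (alg.truncate A) \<longleftrightarrow> is_algebra M A"
  "is_algebra_hom M B (alg.truncate A) h \<longleftrightarrow> is_algebra_hom M B A h"
  by (simp_all only: is_algebra_def is_algebra_hom_def truncate_simps)

section \<open>Tensor products of algebras\<close>

lemma tensor_product_alg_simps [simp]:
  "Carr (tensor_product_alg M A B) = Carr A \<odot>\<^bsub>M\<^esub> Carr B"
  "Mul (tensor_product_alg M A B) =
      (Mul A \<otimes>\<^bsub>M\<^esub> Mul B) \<cdot>\<^bsub>M\<^esub> interchange M (Carr A) (Carr B) (Carr A) (Carr B)"
  "Uni (tensor_product_alg M A B) = (Uni A \<otimes>\<^bsub>M\<^esub> Uni B) \<cdot>\<^bsub>M\<^esub> inv_arr M (LUnit M (UnitO M))"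
  by (simp_all add: tensor_product_alg_def)

lemma unit_alg_simps [simp]:
  "Carr (unit_alg M) = UnitO M" "Mul (unit_alg M) = LUnit M (UnitO M)" "Uni (unit_alg M) =
      \<one>\<^sub>a\<^bsub>M\<^esub> (UnitO M)"
  by (simp_all add: unit_alg_def)

context braided_monoidal_category
begin

abbreviation tp (infixr "\<boxtimes>" 70) where "A \<boxtimes> B \<equiv> tensor_product_alg M A B"

lemma unit_alg_algebra [simp]: "is_algebra M (unit_alg M)"
  unfolding is_algebra_def unit_alg_simps by (auto simp: lunit_eq_runit triangle[of "UnitO M"
      "UnitO M", unfolded lunit_eq_runit])

lemma tensor_product_alg_algebra [simp]:
  assumes [simp]: "is_algebra M A" "is_algebra M B"
  shows "is_algebra M (A \<boxtimes> B)"
proof -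
  let ?a = "Carr A" and ?b = "Carr B" and ?m = "Mul A" and ?n = "Mul B" and ?z = "interchange M"
  let ?i = "\<one>\<^sub>a ?a" and ?j = "\<one>\<^sub>a ?b" and ?M = "Mul A \<otimes> Mul B" and ?I = "UnitO M"
  have zl: "?z ?a ?b ?a ?b \<cdot> (?M \<otimes> \<one>\<^sub>a (?a \<odot> ?b)) = ((?m \<otimes> ?i) \<otimes> (?n \<otimes> ?j)) \<cdot>
      ?z (?a \<odot> ?a) (?b \<odot> ?b) ?a ?b"
    using interchange_natural[of ?m ?n ?i ?j ?a ?b ?a ?b] by simp
  have zr: "?z ?a ?b ?a ?b \<cdot> (\<one>\<^sub>a (?a \<odot> ?b) \<otimes> ?M) = ((?i \<otimes> ?m) \<otimes> (?j \<otimes> ?n)) \<cdot>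
      ?z ?a ?b (?a \<odot> ?a) (?b \<odot> ?b)"
    using interchange_natural[of ?i ?j ?m ?n ?a ?b ?a ?b] by simp
  have "(?M \<cdot> ?z ?a ?b ?a ?b) \<cdot> ((?M \<cdot> ?z ?a ?b ?a ?b) \<otimes> \<one>\<^sub>a (?a \<odot> ?b))
      = ?M \<cdot> ?z ?a ?b ?a ?b \<cdot> (?M \<otimes> \<one>\<^sub>a (?a \<odot> ?b)) \<cdot> (?z ?a ?b ?a ?b \<otimes> \<one>\<^sub>a (?a \<odot> ?b))"
    by (simp add: merge)
  also have "\<dots> = ((?m \<cdot> (?m \<otimes> ?i)) \<otimes> (?n \<cdot> (?n \<otimes> ?j))) \<cdot> ?z (?a \<odot> ?a) (?b \<odot> ?b) ?a ?b \<cdot>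
      (?z ?a ?b ?a ?b \<otimes> \<one>\<^sub>a (?a \<odot> ?b))"
    by (simp add: comp_tail[OF zl]) (simp add: merge)
  also have "\<dots> = ((?m \<cdot> (?i \<otimes> ?m)) \<otimes> (?n \<cdot> (?j \<otimes> ?n))) \<cdot> (Assoc M ?a ?a ?a \<otimes> Assoc M ?b ?b ?b) \<cdot>
      ?z (?a \<odot> ?a) (?b \<odot> ?b) ?a ?b \<cdot> (?z ?a ?b ?a ?b \<otimes> \<one>\<^sub>a (?a \<odot> ?b))"
    by (simp add: algebra_laws(1) merge)
  also have "\<dots> = ((?m \<cdot> (?i \<otimes> ?m)) \<otimes> (?n \<cdot> (?j \<otimes> ?n))) \<cdot> ?z ?a ?b (?a \<odot> ?a) (?b \<odot> ?b) \<cdot>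
      (\<one>\<^sub>a (?a \<odot> ?b) \<otimes> ?z ?a ?b ?a ?b) \<cdot> Assoc M (?a \<odot> ?b) (?a \<odot> ?b) (?a \<odot> ?b)"
    by (simp add: interchange_assoc)
  also have "\<dots> = ?M \<cdot> ?z ?a ?b ?a ?b \<cdot> (\<one>\<^sub>a (?a \<odot> ?b) \<otimes> ?M) \<cdot> (\<one>\<^sub>a (?a \<odot> ?b) \<otimes> ?z ?a ?b ?a ?b) \<cdot>
      Assoc M (?a \<odot> ?b) (?a \<odot> ?b) (?a \<odot> ?b)"
    by (simp add: comp_tail[OF zr]) (simp add: merge)
  also have "\<dots> = (?M \<cdot> ?z ?a ?b ?a ?b) \<cdot> (\<one>\<^sub>a (?a \<odot> ?b) \<otimes> (?M \<cdot> ?z ?a ?b ?a ?b)) \<cdot>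
      Assoc M (?a \<odot> ?b) (?a \<odot> ?b) (?a \<odot> ?b)"
    by (simp add: merge)
  finally have assoc: "(?M \<cdot> ?z ?a ?b ?a ?b) \<cdot> ((?M \<cdot> ?z ?a ?b ?a ?b) \<otimes> \<one>\<^sub>a (?a \<odot> ?b))
      = (?M \<cdot> ?z ?a ?b ?a ?b) \<cdot> (\<one>\<^sub>a (?a \<odot> ?b) \<otimes> (?M \<cdot> ?z ?a ?b ?a ?b)) \<cdot> Assoc M (?a \<odot> ?b) (?a \<odot> ?b) (?a \<odot> ?b)" .
  have ul: "?z ?a ?b ?a ?b \<cdot> ((Uni A \<otimes> Uni B) \<otimes> \<one>\<^sub>a (?a \<odot> ?b)) = ((Uni A \<otimes> ?i) \<otimes> (Uni B \<otimes> ?j)) \<cdot>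
      ?z ?I ?I ?a ?b"
    using interchange_natural[of "Uni A" "Uni B" ?i ?j ?a ?b ?a ?b] by simp
  have ur: "?z ?a ?b ?a ?b \<cdot> (\<one>\<^sub>a (?a \<odot> ?b) \<otimes> (Uni A \<otimes> Uni B)) = ((?i \<otimes> Uni A) \<otimes> (?j \<otimes> Uni B)) \<cdot>
      ?z ?a ?b ?I ?I"
    using interchange_natural[of ?i ?j "Uni A" "Uni B" ?a ?b ?a ?b] by simp
  have "(?M \<cdot> ?z ?a ?b ?a ?b) \<cdot> (((Uni A \<otimes> Uni B) \<cdot> inv_arr M (LUnit M ?I)) \<otimes> \<one>\<^sub>a (?a \<odot> ?b))
      = ?M \<cdot> ?z ?a ?b ?a ?b \<cdot> ((Uni A \<otimes> Uni B) \<otimes> \<one>\<^sub>a (?a \<odot> ?b)) \<cdot> (inv_arr M (LUnit M ?I) \<otimes> \<one>\<^sub>a (?a \<odot> ?b))"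
    by (simp add: merge)
  also have "\<dots> = (LUnit M ?a \<otimes> LUnit M ?b) \<cdot> ?z ?I ?I ?a ?b \<cdot> (inv_arr M (LUnit M ?I) \<otimes> \<one>\<^sub>a (?a \<odot> ?b))"
    by (simp add: comp_tail[OF ul]) (simp add: merge algebra_laws(2))
  also have "\<dots> = LUnit M (?a \<odot> ?b)"
    by (simp add: comp_tail[OF interchange_unit_left]) (simp add: merge)
  finally have left: "(?M \<cdot> ?z ?a ?b ?a ?b) \<cdot> (((Uni A \<otimes> Uni B) \<cdot>
      inv_arr M (LUnit M ?I)) \<otimes> \<one>\<^sub>a (?a \<odot> ?b)) = LUnit M (?a \<odot> ?b)" .
  have "(?M \<cdot> ?z ?a ?b ?a ?b) \<cdot> (\<one>\<^sub>a (?a \<odot> ?b) \<otimes> ((Uni A \<otimes> Uni B) \<cdot> inv_arr M (LUnit M ?I)))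
      = ?M \<cdot> ?z ?a ?b ?a ?b \<cdot> (\<one>\<^sub>a (?a \<odot> ?b) \<otimes> (Uni A \<otimes> Uni B)) \<cdot> (\<one>\<^sub>a (?a \<odot> ?b) \<otimes> inv_arr M (LUnit M ?I))"
    by (simp add: merge)
  also have "\<dots> = (RUnit M ?a \<otimes> RUnit M ?b) \<cdot> ?z ?a ?b ?I ?I \<cdot> (\<one>\<^sub>a (?a \<odot> ?b) \<otimes> inv_arr M (LUnit M ?I))"
    by (simp add: comp_tail[OF ur]) (simp add: merge algebra_laws(3))
  also have "\<dots> = RUnit M (?a \<odot> ?b)"
    by (simp add: comp_tail[OF interchange_unit_right]) (simp add: merge)
  finally have right: "(?M \<cdot> ?z ?a ?b ?a ?b) \<cdot> (\<one>\<^sub>a (?a \<odot> ?b) \<otimes> ((Uni A \<otimes> Uni B) \<cdot>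
      inv_arr M (LUnit M ?I))) = RUnit M (?a \<odot> ?b)" .
  show ?thesis
    unfolding is_algebra_def tensor_product_alg_simps
    by (intro conjI assoc left right) simp_all
qed

lemma tensor_product_hom:
  assumes f: "is_algebra_hom M A A' f" and g: "is_algebra_hom M B B' g"
    and [simp]: "is_algebra M A" "is_algebra M A'" "is_algebra M B" "is_algebra M B'"
  shows "is_algebra_hom M (A \<boxtimes> B) (A' \<boxtimes> B') (f \<otimes> g)"
proof -
  note [simp] = algebra_homD(1-3)[OF f] algebra_homD(1-3)[OF g]
  let ?z = "interchange M"
  have "(f \<otimes> g) \<cdot> Mul (A \<boxtimes> B) = ((f \<cdot> Mul A) \<otimes> (g \<cdot> Mul B)) \<cdot> ?z (Carr A) (Carr B) (Carr A) (Carr B)"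
    by (simp add: merge)
  also have "\<dots> = (Mul A' \<otimes> Mul B') \<cdot> ((f \<otimes> f) \<otimes> (g \<otimes> g)) \<cdot> ?z (Carr A) (Carr B) (Carr A) (Carr B)"
    by (simp add: merge algebra_homD(4)[OF f] algebra_homD(4)[OF g])
  also have "\<dots> = Mul (A' \<boxtimes> B') \<cdot> ((f \<otimes> g) \<otimes> (f \<otimes> g))"
    by (simp add: interchange_natural)
  finally have "(f \<otimes> g) \<cdot> Mul (A \<boxtimes> B) = Mul (A' \<boxtimes> B') \<cdot> ((f \<otimes> g) \<otimes> (f \<otimes> g))" .
  moreover have "(f \<otimes> g) \<cdot> Uni (A \<boxtimes> B) = Uni (A' \<boxtimes> B')"
    by (simp add: merge algebra_homD(5)[OF f] algebra_homD(5)[OF g])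
  ultimately show ?thesis
    by (simp add: is_algebra_hom_def del: tensor_product_alg_simps(2,3))
qed

lemma assoc_algebra_hom:
  assumes [simp]: "is_algebra M A" "is_algebra M B" "is_algebra M C"
  shows "is_algebra_hom M ((A \<boxtimes> B) \<boxtimes> C) (A \<boxtimes> (B \<boxtimes> C)) (Assoc M (Carr A) (Carr B) (Carr C))"
proof -
  let ?a = "Carr A" and ?b = "Carr B" and ?c = "Carr C" and ?z = "interchange M" and ?I = "UnitO M" and ?s = "Assoc M"
  have "?s ?a ?b ?c \<cdot> Mul ((A \<boxtimes> B) \<boxtimes> C)
      = ?s ?a ?b ?c \<cdot> ((Mul A \<otimes> Mul B) \<otimes> Mul C) \<cdot> (?z ?a ?b ?a ?b \<otimes> \<one>\<^sub>a (?c \<odot> ?c)) \<cdot> ?z (?a \<odot> ?b) ?c (?a \<odot> ?b) ?c"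
    by (simp add: merge)
  also have "\<dots> = (Mul A \<otimes> (Mul B \<otimes> Mul C)) \<cdot> ?s (?a \<odot> ?a) (?b \<odot> ?b) (?c \<odot> ?c) \<cdot>
      (?z ?a ?b ?a ?b \<otimes> \<one>\<^sub>a (?c \<odot> ?c)) \<cdot> ?z (?a \<odot> ?b) ?c (?a \<odot> ?b) ?c"
    by (simp add: comp_tail[OF assoc_natural])
  also have "\<dots> = (Mul A \<otimes> (Mul B \<otimes> Mul C)) \<cdot> (\<one>\<^sub>a (?a \<odot> ?a) \<otimes> ?z ?b ?c ?b ?c) \<cdot>
      ?z ?a (?b \<odot> ?c) ?a (?b \<odot> ?c) \<cdot> (?s ?a ?b ?c \<otimes> ?s ?a ?b ?c)"
    by (simp add: interchange_assoc_arr)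
  also have "\<dots> = Mul (A \<boxtimes> (B \<boxtimes> C)) \<cdot> (?s ?a ?b ?c \<otimes> ?s ?a ?b ?c)"
    by (simp add: merge)
  finally have mul: "?s ?a ?b ?c \<cdot> Mul ((A \<boxtimes> B) \<boxtimes> C) = Mul (A \<boxtimes> (B \<boxtimes> C)) \<cdot>
      (?s ?a ?b ?c \<otimes> ?s ?a ?b ?c)" .
  let ?l = "inv_arr M (LUnit M ?I)"
  have ll: "?s ?I ?I ?I \<cdot> (?l \<otimes> \<one>\<^sub>a ?I) = \<one>\<^sub>a ?I \<otimes> ?l"
  proof (rule iso_cancel_left[of "\<one>\<^sub>a ?I \<otimes> LUnit M ?I"])
    show "(\<one>\<^sub>a ?I \<otimes> LUnit M ?I) \<cdot> ?s ?I ?I ?I \<cdot> (?l \<otimes> \<one>\<^sub>a ?I) = (\<one>\<^sub>a ?I \<otimes> LUnit M ?I) \<cdot> (\<one>\<^sub>a ?I \<otimes> ?l)"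
      by (simp add: comp_tail[OF triangle] flip: lunit_eq_runit) (simp add: merge)
  qed auto
  have "?s ?a ?b ?c \<cdot> Uni ((A \<boxtimes> B) \<boxtimes> C) = ?s ?a ?b ?c \<cdot> ((Uni A \<otimes> Uni B) \<otimes> Uni C) \<cdot> (?l \<otimes> \<one>\<^sub>a ?I) \<cdot> ?l"
    by (simp add: merge)
  also have "\<dots> = (Uni A \<otimes> (Uni B \<otimes> Uni C)) \<cdot> ?s ?I ?I ?I \<cdot> (?l \<otimes> \<one>\<^sub>a ?I) \<cdot> ?l"
    by (simp add: comp_tail[OF assoc_natural])
  also have "\<dots> = Uni (A \<boxtimes> (B \<boxtimes> C))"
    by (simp add: comp_tail[OF ll]) (simp add: merge)
  finally have uni: "?s ?a ?b ?c \<cdot> Uni ((A \<boxtimes> B) \<boxtimes> C) = Uni (A \<boxtimes> (B \<boxtimes> C))" .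
  show ?thesis
    unfolding is_algebra_hom_def using mul uni by (simp del: tensor_product_alg_simps(2,3))
qed

lemma lunit_algebra_hom:
  assumes [simp]: "is_algebra M A"
  shows "is_algebra_hom M (unit_alg M \<boxtimes> A) A (LUnit M (Carr A))"
proof -
  let ?a = "Carr A" and ?I = "UnitO M"
  have "LUnit M ?a \<cdot> Mul (unit_alg M \<boxtimes> A) = LUnit M ?a \<cdot> (\<one>\<^sub>a ?I \<otimes> Mul A) \<cdot>
      (LUnit M ?I \<otimes> \<one>\<^sub>a (?a \<odot> ?a)) \<cdot> interchange M ?I ?a ?I ?a"
    by (simp add: merge)
  also have "\<dots> = Mul A \<cdot> (LUnit M ?a \<otimes> LUnit M ?a)"
    by (simp add: comp_tail[OF lunit_natural] lunit_interchange)
  finally show ?thesis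
    by (simp add: is_algebra_hom_def comp_tail[OF lunit_natural])
qed

lemma runit_algebra_hom:
  assumes [simp]: "is_algebra M A"
  shows "is_algebra_hom M (A \<boxtimes> unit_alg M) A (RUnit M (Carr A))"
proof -
  let ?a = "Carr A" and ?I = "UnitO M"
  have "RUnit M ?a \<cdot> Mul (A \<boxtimes> unit_alg M) = RUnit M ?a \<cdot> (Mul A \<otimes> \<one>\<^sub>a ?I) \<cdot>
      (\<one>\<^sub>a (?a \<odot> ?a) \<otimes> LUnit M ?I) \<cdot> interchange M ?a ?I ?a ?I"
    by (simp add: merge)
  also have "\<dots> = Mul A \<cdot> (RUnit M ?a \<otimes> RUnit M ?a)"
    by (simp add: comp_tail[OF runit_natural] runit_interchange)
  finally show ?thesis
    by (simp add: is_algebra_hom_def comp_tail[OF runit_natural] lunit_eq_runit)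
qed

end

section \<open>Additivity\<close>

context preadditive_category
begin

lemma add_arr [simp]:
  assumes "f \<in> Arr M" "g \<in> Arr M" "Dom M f = Dom M g" "Cod M f = Cod M g"
  shows "f \<oplus> g \<in> Arr M" "Dom M (f \<oplus> g) = Dom M g" "Cod M (f \<oplus> g) = Cod M g"
proof -
  interpret G: comm_group "hom_group M (Dom M g) (Cod M g)" by (rule hom_comm_group) (use assms in auto)
  from G.m_closed[of f g] assms show "f \<oplus> g \<in> Arr M" "Dom M (f \<oplus> g) = Dom M g" "Cod M (f \<oplus> g) = Cod M g"
    by (auto simp: hom_group_def)
qed

lemma zero_arr [simp]:
  assumes "X \<in> Obj M" "Y \<in> Obj M"
  shows "Zero M X Y \<in> Arr M" "Dom M (Zero M X Y) = X" "Cod M (Zero M X Y) = Y"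
proof -
  interpret G: comm_group "hom_group M X Y" by (rule hom_comm_group) (use assms in auto)
  from G.one_closed show "Zero M X Y \<in> Arr M" "Dom M (Zero M X Y) = X" "Cod M (Zero M X Y) = Y"
    by (auto simp: hom_group_def)
qed

lemma add_commute:
  assumes "f \<in> Arr M" "g \<in> Arr M" "Dom M f = Dom M g" "Cod M f = Cod M g"
  shows "f \<oplus> g = g \<oplus> f"
proof -
  interpret G: comm_group "hom_group M (Dom M g) (Cod M g)" by (rule hom_comm_group) (use assms in auto)
  from G.m_comm[of f g] assms show ?thesis by (auto simp: hom_group_def)
qed

lemma add_assoc:
  assumes "f \<in> Arr M" "g \<in> Arr M" "h \<in> Arr M" "Dom M f = Dom M g" "Cod M f = Cod M g" "Dom M h =
      Dom M g" "Cod M h = Cod M g"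
  shows "(f \<oplus> g) \<oplus> h = f \<oplus> (g \<oplus> h)"
proof -
  interpret G: comm_group "hom_group M (Dom M g) (Cod M g)" by (rule hom_comm_group) (use assms in auto)
  from G.m_assoc[of f g h] assms show ?thesis by (auto simp: hom_group_def)
qed

lemma add_zero [simp]:
  assumes "f \<in> Arr M" "Dom M f = X" "Cod M f = Y"
  shows "f \<oplus> Zero M X Y = f" "Zero M X Y \<oplus> f = f"
proof -
  interpret G: comm_group "hom_group M X Y" by (rule hom_comm_group) (use assms in auto)
  from G.l_one[of f] G.r_one[of f] assms show "f \<oplus> Zero M X Y = f" "Zero M X Y \<oplus> f =
      f" by (auto simp: hom_group_def)
qed

lemma add_eq_selfD:
  assumes "f \<in> Arr M" "g \<in> Arr M" "Dom M f = X" "Cod M f = Y" "Dom M g = X" "Cod M g = Y" "f \<oplus> g = f"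
  shows "g = Zero M X Y"
proof -
  interpret G: comm_group "hom_group M X Y" by (rule hom_comm_group) (use assms in auto)
  from G.l_cancel_one[of f g] assms show ?thesis by (auto simp: hom_group_def)
qed

lemma add_comp':
  assumes "f \<in> Arr M" "g \<in> Arr M" "g' \<in> Arr M" "Dom M g = Cod M f" "Dom M g' = Cod M f" "Cod M g =
      Cod M g'"
  shows "(g \<oplus> g') \<cdot> f = (g \<cdot> f) \<oplus> (g' \<cdot> f)"
  using add_comp[of f "Dom M f" "Cod M f" g "Cod M g" g'] assms by simp

lemma comp_add':
  assumes "f \<in> Arr M" "f' \<in> Arr M" "g \<in> Arr M" "Dom M g = Cod M f" "Dom M g = Cod M f'" "Dom M f =
      Dom M f'"
  shows "g \<cdot> (f \<oplus> f') = (g \<cdot> f) \<oplus> (g \<cdot> f')"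
  using comp_add[of f "Dom M f" "Cod M f" f' g "Cod M g"] assms by simp

text \<open>
  \<open>Zero M X Y \<cdot> f\<close> equals its own double; in a group this forces it to vanish. The same argument
  gives \<open>comp_zero\<close>, \<open>zero_ten\<close> and \<open>ten_zero\<close>.
\<close>

lemma zero_comp [simp]:
  assumes "f \<in> Arr M" "Cod M f = X" "Y \<in> Obj M"
  shows "Zero M X Y \<cdot> f = Zero M (Dom M f) Y"
proof -
  have X: "X \<in> Obj M" using assms by auto
  have "(Zero M X Y \<cdot> f) \<oplus> (Zero M X Y \<cdot> f) = (Zero M X Y \<oplus> Zero M X Y) \<cdot> f"
    using assms X by (intro add_comp'[symmetric]) auto
  also have "\<dots> = Zero M X Y \<cdot> f" using assms X by simp
  finally show ?thesis
    by (rule add_eq_selfD[rotated -1]) (use assms X in auto)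
qed

lemma comp_zero [simp]:
  assumes "f \<in> Arr M" "Dom M f = Y" "X \<in> Obj M"
  shows "f \<cdot> Zero M X Y = Zero M X (Cod M f)"
proof -
  have Y: "Y \<in> Obj M" using assms by auto
  have "(f \<cdot> Zero M X Y) \<oplus> (f \<cdot> Zero M X Y) = f \<cdot> (Zero M X Y \<oplus> Zero M X Y)"
    using assms Y by (intro comp_add'[symmetric]) auto
  also have "\<dots> = f \<cdot> Zero M X Y" using assms Y by simp
  finally show ?thesis
    by (rule add_eq_selfD[rotated -1]) (use assms Y in auto)
qed

end

locale tensor_bialgebras =
  tensor_algebras M al + braided_monoidal_category M + preadditive_category M
  for M :: "('o, 'a, 'z) pabrcat_scheme" (structure) and al :: "'o \<Rightarrow> nat \<Rightarrow> 'a" +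
  assumes left_additive: "X \<in> Obj M \<Longrightarrow> additive_functor M M (tensor_left M X)"
    and right_additive: "X \<in> Obj M \<Longrightarrow> additive_functor M M (tensor_right M X)"
begin

lemma add_ten:
  assumes [simp]: "f \<in> Arr M" "g \<in> Arr M" "h \<in> Arr M" and eq: "Dom M f = Dom M g" "Cod M f = Cod M g"
  shows "(f \<oplus> g) \<otimes> h = (f \<otimes> h) \<oplus> (g \<otimes> h)"
proof -
  have "(f \<oplus> g) \<otimes> \<one>\<^sub>a (Cod M h) = (f \<otimes> \<one>\<^sub>a (Cod M h)) \<oplus> (g \<otimes> \<one>\<^sub>a (Cod M h))"
    using right_additive[of "Cod M h", unfolded additive_functor_def tensor_right_def funct.simps, THEN conjunct2, rule_format, of "Dom M g"
        "Cod M g" f g] eq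
    by simp
  then have "((f \<oplus> g) \<otimes> \<one>\<^sub>a (Cod M h)) \<cdot> (\<one>\<^sub>a (Dom M g) \<otimes> h) = (f \<otimes> h) \<oplus> (g \<otimes> h)"
    by (simp add: add_comp' merge eq)
  then show ?thesis by (simp add: merge eq)
qed

lemma ten_add:
  assumes [simp]: "f \<in> Arr M" "g \<in> Arr M" "h \<in> Arr M" and eq: "Dom M f = Dom M g" "Cod M f = Cod M g"
  shows "h \<otimes> (f \<oplus> g) = (h \<otimes> f) \<oplus> (h \<otimes> g)"
proof -
  have "\<one>\<^sub>a (Cod M h) \<otimes> (f \<oplus> g) = (\<one>\<^sub>a (Cod M h) \<otimes> f) \<oplus> (\<one>\<^sub>a (Cod M h) \<otimes> g)"
    using left_additive[of "Cod M h", unfolded additive_functor_def tensor_left_def funct.simps, THEN conjunct2, rule_format, of "Dom M g"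
        "Cod M g" f g] eq
    by simp
  then have "(\<one>\<^sub>a (Cod M h) \<otimes> (f \<oplus> g)) \<cdot> (h \<otimes> \<one>\<^sub>a (Dom M g)) = (h \<otimes> f) \<oplus> (h \<otimes> g)"
    by (simp add: add_comp' merge eq)
  then show ?thesis by (simp add: merge eq)
qed

lemma zero_ten [simp]:
  assumes [simp]: "X \<in> Obj M" "Y \<in> Obj M" "h \<in> Arr M"
  shows "Zero M X Y \<otimes> h = Zero M (X \<odot> Dom M h) (Y \<odot> Cod M h)"
  using add_ten[of "Zero M X Y" "Zero M X Y" h] by (intro add_eq_selfD[of "Zero M X Y \<otimes> h"]) auto

lemma ten_zero [simp]:
  assumes [simp]: "X \<in> Obj M" "Y \<in> Obj M" "h \<in> Arr M"
  shows "h \<otimes> Zero M X Y = Zero M (Dom M h \<odot> X) (Cod M h \<odot> Y)"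
  using ten_add[of "Zero M X Y" "Zero M X Y" h] by (intro add_eq_selfD[of "h \<otimes> Zero M X Y"]) auto

section \<open>The tensor bialgebra\<close>

lemma lunit_inv_natural:
  assumes [simp]: "f \<in> Arr M" "Cod M f = Y"
  shows "inv_arr M (LUnit M Y) \<cdot> f = (\<one>\<^sub>a (UnitO M) \<otimes> f) \<cdot> inv_arr M (LUnit M (Dom M f))"
proof (rule iso_cancel_left[of "LUnit M Y"])
  have [simp]: "Y \<in> Obj M" using assms cod_obj by blast
  show "LUnit M Y \<cdot> inv_arr M (LUnit M Y) \<cdot> f = LUnit M Y \<cdot> (\<one>\<^sub>a (UnitO M) \<otimes> f) \<cdot>
      inv_arr M (LUnit M (Dom M f))"
    by (simp add: comp_tail[OF lunit_natural])
qed (use assms cod_obj[of f] in auto)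

lemma runit_inv_natural:
  assumes [simp]: "f \<in> Arr M" "Cod M f = Y"
  shows "inv_arr M (RUnit M Y) \<cdot> f = (f \<otimes> \<one>\<^sub>a (UnitO M)) \<cdot> inv_arr M (RUnit M (Dom M f))"
proof (rule iso_cancel_left[of "RUnit M Y"])
  have [simp]: "Y \<in> Obj M" using assms cod_obj by blast
  show "RUnit M Y \<cdot> inv_arr M (RUnit M Y) \<cdot> f = RUnit M Y \<cdot> (f \<otimes> \<one>\<^sub>a (UnitO M)) \<cdot>
      inv_arr M (RUnit M (Dom M f))"
    by (simp add: comp_tail[OF runit_natural])
qed (use assms cod_obj[of f] in auto)

abbreviation TB where "TB V \<equiv> tensor_bialg M al V"

lemma tensor_bialg_simps [simp]:
  "Carr (TB V) = T V" "Mul (TB V) = Mul (TA V)" "Uni (TB V) = al V 0"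
  by (simp_all add: tensor_bialg_def Let_def)

lemma tensor_bialg_alg_iff [simp]:
  "is_algebra M (TB V) \<longleftrightarrow> is_algebra M (TA V)"
  "is_algebra_hom M (TB V) A h \<longleftrightarrow> is_algebra_hom M (TA V) A h"
  "is_algebra_hom M B (TB V) h \<longleftrightarrow> is_algebra_hom M B (TA V) h"
  "TB V \<boxtimes> A' = TA V \<boxtimes> A'" "B' \<boxtimes> TB V = B' \<boxtimes> TA V"
  by (simp_all only: is_algebra_def is_algebra_hom_def tensor_bialg_simps tensor_alg_simps tensor_product_alg_def)

lemma tensor_comul:
  assumes [simp]: "V \<in> Obj M"
  shows "is_algebra_hom M (TA V) (TA V \<boxtimes> TA V) (Comul (TB V))"
    "Comul (TB V) \<cdot> al V (Suc 0) = ((al V (Suc 0) \<otimes> al V 0) \<cdot> inv_arr M (RUnit M V)) \<oplus>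
        ((al V 0 \<otimes> al V (Suc 0)) \<cdot> inv_arr M (LUnit M V))"
proof -
  have "\<exists>!d. is_algebra_hom M (TA V) (TA V \<boxtimes> TA V) d \<and> d \<cdot> al V (Suc 0) =
      ((al V (Suc 0) \<otimes> al V 0) \<cdot> inv_arr M (RUnit M V)) \<oplus> ((al V 0 \<otimes> al V (Suc 0)) \<cdot> inv_arr M (LUnit M V))"
    by (rule tensor_lift_ex1) auto
  from theI'[OF this] show "is_algebra_hom M (TA V) (TA V \<boxtimes> TA V) (Comul (TB V))"
    "Comul (TB V) \<cdot> al V (Suc 0) = ((al V (Suc 0) \<otimes> al V 0) \<cdot> inv_arr M (RUnit M V)) \<oplus>
        ((al V 0 \<otimes> al V (Suc 0)) \<cdot> inv_arr M (LUnit M V))"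
    by (simp_all add: tensor_bialg_def Let_def del: tensor_product_alg_simps)
qed

lemma tensor_counit:
  assumes [simp]: "V \<in> Obj M"
  shows "is_algebra_hom M (TA V) (unit_alg M) (Counit (TB V))"
    "Counit (TB V) \<cdot> al V (Suc 0) = Zero M V (UnitO M)"
proof -
  have "\<exists>!e. is_algebra_hom M (TA V) (unit_alg M) e \<and> e \<cdot> al V (Suc 0) = Zero M V (UnitO M)"
    by (rule tensor_lift_ex1) auto
  from theI'[OF this] show "is_algebra_hom M (TA V) (unit_alg M) (Counit (TB V))"
    "Counit (TB V) \<cdot> al V (Suc 0) = Zero M V (UnitO M)"
    by (simp_all add: tensor_bialg_def Let_def del: unit_alg_simps)
qed

lemma tensor_bialg_arr [simp]:
  assumes [simp]: "V \<in> Obj M"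
  shows "Comul (TB V) \<in> Arr M" "Dom M (Comul (TB V)) = T V" "Cod M (Comul (TB V)) = T V \<odot> T V"
    "Counit (TB V) \<in> Arr M" "Dom M (Counit (TB V)) = T V" "Cod M (Counit (TB V)) = UnitO M"
    "Comul (TB V) \<cdot> al V 0 = (al V 0 \<otimes> al V 0) \<cdot> inv_arr M (LUnit M (UnitO M))"
    "Counit (TB V) \<cdot> al V 0 = \<one>\<^sub>a (UnitO M)"
  using algebra_homD[OF tensor_comul(1)[OF assms]] algebra_homD[OF tensor_counit(1)[OF assms]] by simp_all

text \<open>
  Both sides are algebra morphisms into the threefold tensor product, because the associator is one.
  They agree on generators, where each is the sum of the three ways to insert two units; \<open>E1\<close>, \<open>E2\<close>
  and \<open>E3\<close> match the corresponding unit constraints.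
\<close>

lemma tensor_coassoc:
  assumes [simp]: "V \<in> Obj M"
  shows "Assoc M (T V) (T V) (T V) \<cdot> (Comul (TB V) \<otimes> \<one>\<^sub>a (T V)) \<cdot> Comul (TB V) =
      (\<one>\<^sub>a (T V) \<otimes> Comul (TB V)) \<cdot> Comul (TB V)"
    (is "?L = ?R")
proof (rule tensor_hom_ext[of V "TA V \<boxtimes> (TA V \<boxtimes> TA V)"])
  let ?I = "UnitO M" and ?s = "Assoc M" and ?d = "Comul (TB V)" and ?x = "al V (Suc 0)" and ?u = "al V 0"
  let ?r = "inv_arr M (RUnit M V)" and ?l = "inv_arr M (LUnit M V)" and ?l1 = "inv_arr M (LUnit M ?I)"
  note d = tensor_comul(1)[OF assms] and i = algebra_hom_ident[of "TA V"]
  have i': "is_algebra_hom M (TA V) (TA V) (\<one>\<^sub>a (T V))" using i by simp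
  show "is_algebra_hom M (TA V) (TA V \<boxtimes> (TA V \<boxtimes> TA V)) ?L"
    using assoc_algebra_hom[of "TA V" "TA V" "TA V"]
    by (intro algebra_hom_comp[OF algebra_hom_comp[OF d tensor_product_hom[OF d i']], of "TA V \<boxtimes> (TA V \<boxtimes> TA V)"
        "?s (T V) (T V) (T V)", unfolded comp_assoc']) auto
  show "is_algebra_hom M (TA V) (TA V \<boxtimes> (TA V \<boxtimes> TA V)) ?R"
    by (rule algebra_hom_comp[OF d tensor_product_hom[OF i' d]]) auto
  have E1: "?s V ?I ?I \<cdot> (?r \<otimes> \<one>\<^sub>a ?I) \<cdot> ?r = (\<one>\<^sub>a V \<otimes> ?l1) \<cdot> ?r"
  proof (rule iso_cancel_left[of "\<one>\<^sub>a V \<otimes> LUnit M ?I"])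
    show "(\<one>\<^sub>a V \<otimes> LUnit M ?I) \<cdot> ?s V ?I ?I \<cdot> (?r \<otimes> \<one>\<^sub>a ?I) \<cdot> ?r = (\<one>\<^sub>a V \<otimes> LUnit M ?I) \<cdot>
        (\<one>\<^sub>a V \<otimes> ?l1) \<cdot> ?r"
      by (simp add: comp_tail[OF triangle]) (simp add: merge)
  qed auto
  have E2: "?s ?I V ?I \<cdot> (?l \<otimes> \<one>\<^sub>a ?I) \<cdot> ?r = (\<one>\<^sub>a ?I \<otimes> ?r) \<cdot> ?l"
  proof (rule iso_cancel_left[of "\<one>\<^sub>a ?I \<otimes> RUnit M V"])
    show "(\<one>\<^sub>a ?I \<otimes> RUnit M V) \<cdot> ?s ?I V ?I \<cdot> (?l \<otimes> \<one>\<^sub>a ?I) \<cdot> ?r = (\<one>\<^sub>a ?I \<otimes> RUnit M V) \<cdot>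
        (\<one>\<^sub>a ?I \<otimes> ?r) \<cdot> ?l"
      by (simp add: comp_tail[OF runit_ten] comp_tail[OF runit_natural]) (simp add: merge)
  qed auto
  have E3: "?s ?I ?I V \<cdot> (?l1 \<otimes> \<one>\<^sub>a V) \<cdot> ?l = (\<one>\<^sub>a ?I \<otimes> ?l) \<cdot> ?l"
  proof (rule iso_cancel_left[of "\<one>\<^sub>a ?I \<otimes> LUnit M V"])
    show "(\<one>\<^sub>a ?I \<otimes> LUnit M V) \<cdot> ?s ?I ?I V \<cdot> (?l1 \<otimes> \<one>\<^sub>a V) \<cdot> ?l = (\<one>\<^sub>a ?I \<otimes> LUnit M V) \<cdot>
        (\<one>\<^sub>a ?I \<otimes> ?l) \<cdot> ?l"
      by (simp add: comp_tail[OF triangle] flip: lunit_eq_runit) (simp add: merge)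
  qed auto
  have "?L \<cdot> ?x = ?s (T V) (T V) (T V) \<cdot> (((?d \<cdot> ?x) \<otimes> ?u) \<cdot> ?r \<oplus> ((?d \<cdot> ?u) \<otimes> ?x) \<cdot> ?l)"
    by (simp add: tensor_comul(2) comp_add') (simp add: merge tensor_comul(2))
  also have "\<dots> = ?s (T V) (T V) (T V) \<cdot> ((((?x \<otimes> ?u) \<otimes> ?u) \<cdot> (?r \<otimes> \<one>\<^sub>a ?I) \<cdot> ?r \<oplus> ((?u \<otimes> ?x) \<otimes> ?u) \<cdot>
      (?l \<otimes> \<one>\<^sub>a ?I) \<cdot> ?r)
      \<oplus> ((?u \<otimes> ?u) \<otimes> ?x) \<cdot> (?l1 \<otimes> \<one>\<^sub>a V) \<cdot> ?l)"
    by (simp add: tensor_comul(2) add_ten add_comp' merge)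
  also have "\<dots> = ((?x \<otimes> (?u \<otimes> ?u)) \<cdot> ?s V ?I ?I \<cdot> (?r \<otimes> \<one>\<^sub>a ?I) \<cdot> ?r \<oplus> (?u \<otimes> (?x \<otimes> ?u)) \<cdot> ?s ?I V ?I \<cdot>
      (?l \<otimes> \<one>\<^sub>a ?I) \<cdot> ?r)
      \<oplus> (?u \<otimes> (?u \<otimes> ?x)) \<cdot> ?s ?I ?I V \<cdot> (?l1 \<otimes> \<one>\<^sub>a V) \<cdot> ?l"
    by (simp add: comp_add' comp_tail[OF assoc_natural])
  also have "\<dots> = (?x \<otimes> (?u \<otimes> ?u)) \<cdot> (\<one>\<^sub>a V \<otimes> ?l1) \<cdot> ?r \<oplus> ((?u \<otimes> (?x \<otimes> ?u)) \<cdot> (\<one>\<^sub>a ?I \<otimes> ?r) \<cdot> ?l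
      \<oplus> (?u \<otimes> (?u \<otimes> ?x)) \<cdot> (\<one>\<^sub>a ?I \<otimes> ?l) \<cdot> ?l)"
    unfolding E1 E2 E3 by (rule add_assoc) auto
  also have "\<dots> = (?x \<otimes> (?d \<cdot> ?u)) \<cdot> ?r \<oplus> (?u \<otimes> (?d \<cdot> ?x)) \<cdot> ?l"
    by (simp add: tensor_comul(2) ten_add add_comp' merge)
  also have "\<dots> = ?R \<cdot> ?x"
    by (simp add: tensor_comul(2) comp_add') (simp add: merge tensor_comul(2))
  finally show "?L \<cdot> ?x = ?R \<cdot> ?x" .
qed (auto simp: tensor_mul)

lemma tensor_counit_left:
  assumes [simp]: "V \<in> Obj M"
  shows "LUnit M (T V) \<cdot> (Counit (TB V) \<otimes> \<one>\<^sub>a (T V)) \<cdot> Comul (TB V) = \<one>\<^sub>a (T V)" (is "?L = _")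
proof (rule tensor_hom_ext[of V "TA V"])
  have i: "is_algebra_hom M (TA V) (TA V) (\<one>\<^sub>a (T V))" using algebra_hom_ident[of "TA V"] by simp
  then show "is_algebra_hom M (TA V) (TA V) (\<one>\<^sub>a (T V))" .
  show "is_algebra_hom M (TA V) (TA V) ?L"
    using algebra_hom_comp[OF algebra_hom_comp[OF tensor_comul(1)[OF assms] tensor_product_hom[OF tensor_counit(1)[OF assms] i]] lunit_algebra_hom[of "TA V"]]
    by simp
  show "?L \<cdot> al V (Suc 0) = \<one>\<^sub>a (T V) \<cdot> al V (Suc 0)"
    by (simp add: tensor_comul(2) comp_add' merge tensor_counit(2) comp_tail[OF ten_merge]) (simp add: comp_tail[OF lunit_natural])
qed (auto simp: tensor_mul)

lemma tensor_counit_right: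
  assumes [simp]: "V \<in> Obj M"
  shows "RUnit M (T V) \<cdot> (\<one>\<^sub>a (T V) \<otimes> Counit (TB V)) \<cdot> Comul (TB V) = \<one>\<^sub>a (T V)" (is "?L = _")
proof (rule tensor_hom_ext[of V "TA V"])
  have i: "is_algebra_hom M (TA V) (TA V) (\<one>\<^sub>a (T V))" using algebra_hom_ident[of "TA V"] by simp
  then show "is_algebra_hom M (TA V) (TA V) (\<one>\<^sub>a (T V))" .
  show "is_algebra_hom M (TA V) (TA V) ?L"
    using algebra_hom_comp[OF algebra_hom_comp[OF tensor_comul(1)[OF assms] tensor_product_hom[OF i tensor_counit(1)[OF assms]]] runit_algebra_hom[of "TA V"]]
    by simp
  show "?L \<cdot> al V (Suc 0) = \<one>\<^sub>a (T V) \<cdot> al V (Suc 0)"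
    by (simp add: tensor_comul(2) comp_add' merge tensor_counit(2) comp_tail[OF ten_merge]) (simp add: comp_tail[OF runit_natural])
qed (auto simp: tensor_mul)

lemma tensor_bialgebra [simp]:
  assumes [simp]: "V \<in> Obj M"
  shows "is_bialgebra M (TB V)"
  unfolding is_bialgebra_def is_coalgebra_def
  using tensor_comul(1)[OF assms] tensor_counit(1)[OF assms] tensor_coassoc[OF assms] tensor_counit_left[OF assms] tensor_counit_right[OF assms]
  by (simp del: comp_assoc')

end

section \<open>Heavily separable adjunctions\<close>

lemma is_functorD:
  assumes "is_functor C D F"
  shows "category C" "category D"
    "X \<in> Obj C \<Longrightarrow> FO F X \<in> Obj D"
    "f \<in> Arr C \<Longrightarrow> FA F f \<in> Arr D" "f \<in> Arr C \<Longrightarrow> Dom D (FA F f) = FO F (Dom C f)"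
    "f \<in> Arr C \<Longrightarrow> Cod D (FA F f) = FO F (Cod C f)"
    "X \<in> Obj C \<Longrightarrow> FA F (\<one>\<^sub>a\<^bsub>C\<^esub> X) = \<one>\<^sub>a\<^bsub>D\<^esub> (FO F X)"
    "\<lbrakk>f \<in> Arr C; g \<in> Arr C; Dom C g = Cod C f\<rbrakk> \<Longrightarrow> FA F (g \<cdot>\<^bsub>C\<^esub> f) = FA F g \<cdot>\<^bsub>D\<^esub> FA F f"
  using assms by (auto simp: is_functor_def)

lemma comp_functor_simps [simp]:
  "FO (G \<circ>\<^sub>F F) X = FO G (FO F X)" "FA (G \<circ>\<^sub>F F) f = FA G (FA F f)"
  by (simp_all add: comp_functor_def)

lemma id_functor_simps [simp]: "FO id_functor X = X" "FA id_functor f = f"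
  by (simp_all add: id_functor_def)

lemma is_functor_comp:
  assumes F: "is_functor C D F" and G: "is_functor D E G"
  shows "is_functor C E (G \<circ>\<^sub>F F)"
  unfolding is_functor_def using is_functorD[OF F] is_functorD[OF G] by simp

lemma is_functor_id: "category C \<Longrightarrow> is_functor C C id_functor"
  by (simp add: is_functor_def)

lemma nat_transD:
  assumes "nat_trans C D F G t"
  shows "is_functor C D F" "is_functor C D G"
    "X \<in> Obj C \<Longrightarrow> t X \<in> Arr D" "X \<in> Obj C \<Longrightarrow> Dom D (t X) = FO F X" "X \<in> Obj C \<Longrightarrow> Cod D (t X) = FO G X"
    "f \<in> Arr C \<Longrightarrow> FA G f \<cdot>\<^bsub>D\<^esub> t (Dom C f) = t (Cod C f) \<cdot>\<^bsub>D\<^esub> FA F f"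
  using assms by (auto simp: nat_trans_def)

text \<open>
  The maps on hom-sets are \<open>gam Y \<cdot> FA R f \<cdot> eta X\<close>, that is, \<open>gam Y\<close> after the transpose of \<open>f\<close>.
  Naturality and the retraction property hold because \<open>gam\<close> is a natural retraction of the unit.
  For composites, the transpose of \<open>f \<cdot> g\<close> is obtained from those of \<open>f\<close> and \<open>g\<close> with one
  application of \<open>FA R (eps (FO L Z))\<close>; the hypothesis \<open>square\<close> turns it into
  \<open>FA R (FA L (gam Z))\<close>, after which naturality of \<open>gam\<close> separates the two factors.
\<close>

lemma h_separable_left_adjoint:
  assumes L: "is_functor C D L" and R: "is_functor D C R"
    and adj: "adjunction C D L R eta eps"
    and gam: "nat_trans C C (R \<circ>\<^sub>F L) id_functor gam"
    and unit: "\<And>X. X \<in> Obj C \<Longrightarrow> gam X \<cdot>\<^bsub>C\<^esub> eta X = \<one>\<^sub>a\<^bsub>C\<^esub> X"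
    and square: "\<And>X. X \<in> Obj C \<Longrightarrow> gam X \<cdot>\<^bsub>C\<^esub> FA R (FA L (gam X)) = gam X \<cdot>\<^bsub>C\<^esub> FA R (eps (FO L X))"
  shows "h_separable C D L"
proof -
  interpret C: category C by (rule is_functorD(1)[OF L])
  interpret D: category D by (rule is_functorD(2)[OF L])
  note [simp] = is_functorD(3-8)[OF L] is_functorD(3-8)[OF R]
  have eta: "nat_trans C C id_functor (R \<circ>\<^sub>F L) eta" and eps: "nat_trans D D (L \<circ>\<^sub>F R) id_functor eps"
    and tri: "\<And>X. X \<in> Obj C \<Longrightarrow> eps (FO L X) \<cdot>\<^bsub>D\<^esub> FA L (eta X) = \<one>\<^sub>a\<^bsub>D\<^esub> (FO L X)"
    using adj by (auto simp: adjunction_def)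
  note [simp] = nat_transD(3-5)[OF eta, simplified] nat_transD(3-5)[OF eps, simplified] nat_transD(3-5)[OF gam, simplified]
  note etanat = nat_transD(6)[OF eta, simplified] and epsnat = nat_transD(6)[OF eps, simplified]
    and gamnat = nat_transD(6)[OF gam, simplified]
  define P where "P X Y f = gam Y \<cdot>\<^bsub>C\<^esub> FA R f \<cdot>\<^bsub>C\<^esub> eta X" for X Y f
  have hom: "P X Y f \<in> Hom C X Y"
    if "X \<in> Obj C" "Y \<in> Obj C" "f \<in> Hom D (FO L X) (FO L Y)" for X Y f
    using that by (simp add: P_def)
  have nat: "P X' Y' (FA L k \<cdot>\<^bsub>D\<^esub> f \<cdot>\<^bsub>D\<^esub> FA L h) = k \<cdot>\<^bsub>C\<^esub> P X Y f \<cdot>\<^bsub>C\<^esub> h"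
    if "h \<in> Hom C X' X" "k \<in> Hom C Y Y'" "f \<in> Hom D (FO L X) (FO L Y)" for X Y X' Y' h k f
  proof -
    note [simp] = that[unfolded in_Hom_iff, THEN conjunct1] that[unfolded in_Hom_iff, THEN conjunct2, THEN conjunct1]
      that[unfolded in_Hom_iff, THEN conjunct2, THEN conjunct2]
    have [simp]: "X \<in> Obj C" "Y \<in> Obj C" "X' \<in> Obj C" "Y' \<in> Obj C"
      using that C.dom_obj C.cod_obj unfolding in_Hom_iff by blast+
    have e: "FA R (FA L h) \<cdot>\<^bsub>C\<^esub> eta X' = eta X \<cdot>\<^bsub>C\<^esub> h" using etanat[of h] by simp
    have g: "gam Y' \<cdot>\<^bsub>C\<^esub> FA R (FA L k) = k \<cdot>\<^bsub>C\<^esub> gam Y" using gamnat[of k] by simp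
    show ?thesis by (simp add: P_def e C.comp_tail[OF g])
  qed
  have retract: "P X Y (FA L f) = f" if "f \<in> Hom C X Y" for X Y f
  proof -
    note [simp] = that[unfolded in_Hom_iff, THEN conjunct1] that[unfolded in_Hom_iff, THEN conjunct2, THEN conjunct1]
      that[unfolded in_Hom_iff, THEN conjunct2, THEN conjunct2]
    have [simp]: "X \<in> Obj C" "Y \<in> Obj C"
      using that C.dom_obj C.cod_obj unfolding in_Hom_iff by blast+
    have e: "FA R (FA L f) \<cdot>\<^bsub>C\<^esub> eta X = eta Y \<cdot>\<^bsub>C\<^esub> f" using etanat[of f] by simp
    show ?thesis by (simp add: P_def e C.comp_tail[OF unit])
  qed
  have mult: "P X Z (f \<cdot>\<^bsub>D\<^esub> g) = P Y Z f \<cdot>\<^bsub>C\<^esub> P X Y g"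
    if XYZ [simp]: "X \<in> Obj C" "Y \<in> Obj C" "Z \<in> Obj C" and fg: "g \<in> Hom D (FO L X) (FO L Y)"
        "f \<in> Hom D (FO L Y) (FO L Z)"
    for X Y Z f g
  proof -
    note [simp] = fg[unfolded in_Hom_iff, THEN conjunct1] fg[unfolded in_Hom_iff, THEN conjunct2, THEN conjunct1]
      fg[unfolded in_Hom_iff, THEN conjunct2, THEN conjunct2]
    define u where "u = FA R f \<cdot>\<^bsub>C\<^esub> eta Y"
    define v where "v = FA R g \<cdot>\<^bsub>C\<^esub> eta X"
    have [simp]: "u \<in> Arr C" "Dom C u = Y" "Cod C u = FO R (FO L Z)"
      "v \<in> Arr C" "Dom C v = X" "Cod C v = FO R (FO L Y)"
      by (simp_all add: u_def v_def)
    \<comment> \<open>\<open>u\<close> is the transpose of \<open>f\<close>, so \<open>f\<close> is recovered from it by the counit.\<close>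
    have f: "f = eps (FO L Z) \<cdot>\<^bsub>D\<^esub> FA L u"
    proof -
      have n: "eps (FO L Z) \<cdot>\<^bsub>D\<^esub> FA L (FA R f) = f \<cdot>\<^bsub>D\<^esub> eps (FO L Y)" using epsnat[of f] by simp
      show ?thesis by (simp add: u_def D.comp_tail[OF n] tri)
    qed
    have n: "gam (FO R (FO L Z)) \<cdot>\<^bsub>C\<^esub> FA R (FA L u) = u \<cdot>\<^bsub>C\<^esub> gam Y" using gamnat[of u] by simp
    have m: "gam Z \<cdot>\<^bsub>C\<^esub> FA R (FA L (gam Z)) = gam Z \<cdot>\<^bsub>C\<^esub> gam (FO R (FO L Z))"
      using gamnat[of "gam Z"] by simp
    have "P X Z (f \<cdot>\<^bsub>D\<^esub> g) = gam Z \<cdot>\<^bsub>C\<^esub> FA R f \<cdot>\<^bsub>C\<^esub> v"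
      by (simp add: P_def v_def)
    also have "FA R f = FA R (eps (FO L Z)) \<cdot>\<^bsub>C\<^esub> FA R (FA L u)"
      by (subst f) simp
    also have "gam Z \<cdot>\<^bsub>C\<^esub> (FA R (eps (FO L Z)) \<cdot>\<^bsub>C\<^esub> FA R (FA L u)) \<cdot>\<^bsub>C\<^esub> v
        = gam Z \<cdot>\<^bsub>C\<^esub> FA R (FA L (gam Z)) \<cdot>\<^bsub>C\<^esub> FA R (FA L u) \<cdot>\<^bsub>C\<^esub> v"
      by (simp add: C.comp_tail[OF square])
    also have "\<dots> = gam Z \<cdot>\<^bsub>C\<^esub> gam (FO R (FO L Z)) \<cdot>\<^bsub>C\<^esub> FA R (FA L u) \<cdot>\<^bsub>C\<^esub> v"
      by (simp add: C.comp_tail[OF m])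
    also have "\<dots> = P Y Z f \<cdot>\<^bsub>C\<^esub> P X Y g"
      by (simp add: C.comp_tail[OF n] P_def) (simp add: u_def v_def)
    finally show ?thesis .
  qed
  show ?thesis
    unfolding h_separable_def by (intro conjI L exI[of _ P] ballI hom nat retract mult)
qed

section \<open>The category of bialgebras\<close>

context category
begin

lemma structure_cat_category:
  assumes obj: "\<And>A. isS A \<Longrightarrow> U A \<in> Obj C"
    and arr: "\<And>A B f. \<lbrakk>isS A; isS B; isH A B f\<rbrakk> \<Longrightarrow> f \<in> Arr C \<and> Dom C f = U A \<and> Cod C f = U B"
    and ident: "\<And>A. isS A \<Longrightarrow> isH A A (\<one>\<^sub>a (U A))"
    and comp: "\<And>A B D f g. \<lbrakk>isS A; isS B; isS D; isH A B f; isH B D g\<rbrakk> \<Longrightarrow> isH A D (g \<cdot> f)"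
  shows "category (structure_cat C isS isH U)"
  by unfold_locales (auto simp: structure_cat_def und_def obj arr ident comp)

end

lemma und_simps [simp]: "und (A, f, B) = f"
  by (simp add: und_def)

lemma Bialg_simps [simp]:
  "B \<in> Obj (Bialg M) \<longleftrightarrow> is_bialgebra M B"
  "F \<in> Arr (Bialg M) \<longleftrightarrow> is_bialgebra M (fst F) \<and> is_bialgebra M (snd (snd F)) \<and>
      is_bialgebra_hom M (fst F) (snd (snd F)) (und F)"
  "Dom (Bialg M) F = fst F" "Cod (Bialg M) F = snd (snd F)"
  "Ident (Bialg M) B = (B, \<one>\<^sub>a\<^bsub>M\<^esub> (Carr B), B)"
  "G \<cdot>\<^bsub>Bialg M\<^esub> F = (fst F, und G \<cdot>\<^bsub>M\<^esub> und F, snd (snd G))"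
  by (auto simp: Bialg_def structure_cat_def und_def)

context braided_monoidal_category
begin

lemma bialgebraD [simp]:
  assumes "is_bialgebra M B"
  shows "is_algebra M B" "Comul B \<in> Arr M" "Dom M (Comul B) = Carr B" "Cod M (Comul B) =
      Carr B \<odot> Carr B"
    "Counit B \<in> Arr M" "Dom M (Counit B) = Carr B" "Cod M (Counit B) = UnitO M"
    "Counit B \<cdot> Uni B = \<one>\<^sub>a (UnitO M)"
  using assms unfolding is_bialgebra_def is_coalgebra_def is_algebra_hom_def by simp_all

lemma bialgebra_laws:
  assumes "is_bialgebra M B"
  shows "is_algebra_hom M B (B \<boxtimes> B) (Comul B)" "is_algebra_hom M B (unit_alg M) (Counit B)"
    "LUnit M (Carr B) \<cdot> (Counit B \<otimes> \<one>\<^sub>a (Carr B)) \<cdot> Comul B = \<one>\<^sub>a (Carr B)"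
  using assms unfolding is_bialgebra_def is_coalgebra_def by blast+

lemma bialgebra_homD:
  assumes "is_bialgebra_hom M A B f"
  shows "is_algebra_hom M A B f" "f \<in> Arr M" "Dom M f = Carr A" "Cod M f = Carr B"
    "Comul B \<cdot> f = (f \<otimes> f) \<cdot> Comul A" "Counit B \<cdot> f = Counit A"
    "f \<cdot> Uni A = Uni B"
  using assms unfolding is_bialgebra_hom_def is_algebra_hom_def in_Hom_iff by blast+

lemma Bialg_category: "category (Bialg M)"
  unfolding Bialg_def
proof (rule structure_cat_category)
  fix A :: "('o, 'a) bialg" assume A: "is_bialgebra M A"
  then show "Carr A \<in> Obj M" by simp
  show "is_bialgebra_hom M A A (\<one>\<^sub>a (Carr A))"
    using A algebra_hom_ident[of A] by (simp add: is_bialgebra_hom_def)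
next
  fix A B D :: "('o, 'a) bialg" and f g
  assume [simp]: "is_bialgebra M A" "is_bialgebra M B" "is_bialgebra M D"
    and f: "is_bialgebra_hom M A B f" and g: "is_bialgebra_hom M B D g"
  note [simp] = bialgebra_homD(2-4)[OF f] bialgebra_homD(2-4)[OF g]
  have "Comul D \<cdot> (g \<cdot> f) = ((g \<cdot> f) \<otimes> (g \<cdot> f)) \<cdot> Comul A"
    by (simp add: comp_tail[OF bialgebra_homD(5)[OF g]] bialgebra_homD(5)[OF f]) (simp add: merge)
  then show "is_bialgebra_hom M A D (g \<cdot> f)"
    using algebra_hom_comp[OF bialgebra_homD(1)[OF f] bialgebra_homD(1)[OF g]]
    by (simp add: is_bialgebra_hom_def comp_tail[OF bialgebra_homD(6)[OF g]] bialgebra_homD(6)[OF f])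
qed (auto simp: bialgebra_homD)

end

section \<open>Primitive elements\<close>

context tensor_bialgebras
begin

definition prim_map :: "('o, 'a) bialg \<Rightarrow> 'a" where
  "prim_map B = ((Uni B \<otimes> \<one>\<^sub>a (Carr B)) \<cdot> inv_arr M (LUnit M (Carr B))) \<oplus>
    ((\<one>\<^sub>a (Carr B) \<otimes> Uni B) \<cdot> inv_arr M (RUnit M (Carr B)))"

text \<open>
  Generalised elements \<open>f : X \<rightarrow> B\<close> whose comultiple is \<open>u \<otimes> f + f \<otimes> u\<close>. They are exactly the arrows
  that factor through the primitive part of \<open>B\<close>.
\<close>

definition primitive :: "('o, 'a) bialg \<Rightarrow> 'a \<Rightarrow> bool" where
  "primitive B f \<longleftrightarrow> f \<in> Arr M \<and> Cod M f = Carr B \<and> Comul B \<cdot> f = prim_map B \<cdot> f"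

lemma primitiveD:
  assumes "primitive B f"
  shows "f \<in> Arr M" "Cod M f = Carr B" "Comul B \<cdot> f = prim_map B \<cdot> f"
  using assms by (auto simp: primitive_def)

lemma prim_map_arr [simp]:
  assumes [simp]: "is_bialgebra M B"
  shows "prim_map B \<in> Arr M" "Dom M (prim_map B) = Carr B" "Cod M (prim_map B) = Carr B \<odot> Carr B"
  by (simp_all add: prim_map_def)

lemma prim_map_comp:
  assumes [simp]: "is_bialgebra M B" "f \<in> Arr M" "Cod M f = Carr B"
  shows "prim_map B \<cdot> f = ((Uni B \<otimes> f) \<cdot> inv_arr M (LUnit M (Dom M f))) \<oplus> ((f \<otimes> Uni B) \<cdot>
      inv_arr M (RUnit M (Dom M f)))"
  by (simp add: prim_map_def add_comp' lunit_inv_natural runit_inv_natural) (simp add: merge)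

lemma primitive_comp:
  assumes "primitive B f" and [simp]: "is_bialgebra M B" "g \<in> Arr M" "Cod M g = Dom M f"
  shows "primitive B (f \<cdot> g)"
proof -
  note f = primitiveD[OF assms(1)]
  show ?thesis using f(1,2) by (simp add: primitive_def comp_tail[OF f(3)])
qed

lemma primitive_hom:
  assumes f: "primitive A f" and h: "is_bialgebra_hom M A B h" and [simp]: "is_bialgebra M A"
      "is_bialgebra M B"
  shows "primitive B (h \<cdot> f)"
proof -
  note [simp] = primitiveD(1,2)[OF f] bialgebra_homD(2-4)[OF h]
  let ?l = "inv_arr M (LUnit M (Dom M f))" and ?r = "inv_arr M (RUnit M (Dom M f))"
  have "Comul B \<cdot> (h \<cdot> f) = (h \<otimes> h) \<cdot> prim_map A \<cdot> f"
    by (simp add: comp_tail[OF bialgebra_homD(5)[OF h]] primitiveD(3)[OF f])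
  also have "\<dots> = prim_map B \<cdot> (h \<cdot> f)"
    by (simp add: prim_map_comp comp_add') (simp add: merge bialgebra_homD(7)[OF h])
  finally show ?thesis by (simp add: primitive_def)
qed

text \<open>
  Applying \<open>Counit B\<close> to the first tensor factor of the equation for primitivity gives
  \<open>f = f + Uni B \<cdot> Counit B \<cdot> f\<close>, so the last term vanishes; composing it with \<open>Counit B\<close> again
  gives the claim, because \<open>Counit B \<cdot> Uni B\<close> is an identity.
\<close>

lemma counit_primitive:
  assumes f: "primitive B f" and B [simp]: "is_bialgebra M B"
  shows "Counit B \<cdot> f = Zero M (Dom M f) (UnitO M)"
proof -
  note [simp] = primitiveD(1,2)[OF f]
  let ?X = "Dom M f" and ?I = "UnitO M" and ?e = "Counit B" and ?b = "Carr B"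
  have X [simp]: "?X \<in> Obj M" by simp
  have "f = (LUnit M ?b \<cdot> (?e \<otimes> \<one>\<^sub>a ?b) \<cdot> Comul B) \<cdot> f"
    unfolding bialgebra_laws(3)[OF B] by simp
  also have "\<dots> = LUnit M ?b \<cdot> (?e \<otimes> \<one>\<^sub>a ?b) \<cdot> prim_map B \<cdot> f"
    by (simp add: primitiveD(3)[OF f])
  also have "\<dots> = LUnit M ?b \<cdot> ((\<one>\<^sub>a ?I \<otimes> f) \<cdot> inv_arr M (LUnit M ?X)) \<oplus> LUnit M ?b \<cdot> ((?e \<cdot>
      f) \<otimes> Uni B) \<cdot> inv_arr M (RUnit M ?X)"
    by (simp add: prim_map_comp comp_add' merge)
  also have "LUnit M ?b \<cdot> ((\<one>\<^sub>a ?I \<otimes> f) \<cdot> inv_arr M (LUnit M ?X)) = f"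
    by (simp add: comp_tail[OF lunit_natural])
  also have "((?e \<cdot> f) \<otimes> Uni B) = (\<one>\<^sub>a ?I \<otimes> Uni B) \<cdot> ((?e \<cdot> f) \<otimes> \<one>\<^sub>a ?I)"
    by (simp add: merge)
  also have "LUnit M ?b \<cdot> ((\<one>\<^sub>a ?I \<otimes> Uni B) \<cdot> ((?e \<cdot> f) \<otimes> \<one>\<^sub>a ?I)) \<cdot> inv_arr M (RUnit M ?X) = Uni B \<cdot>
      ?e \<cdot> f"
    by (simp add: comp_tail[OF lunit_natural] lunit_eq_runit comp_tail[OF runit_natural])
  finally have "f \<oplus> (Uni B \<cdot> ?e \<cdot> f) = f" by (rule sym)
  then have "Uni B \<cdot> ?e \<cdot> f = Zero M ?X ?b"
    by (rule add_eq_selfD[rotated -1]) auto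
  then have "?e \<cdot> (Uni B \<cdot> ?e \<cdot> f) = Zero M ?X ?I" by simp
  then show ?thesis by (simp add: comp_tail[OF bialgebraD(8)])
qed

lemma primitive_generator:
  assumes [simp]: "V \<in> Obj M"
  shows "primitive (TB V) (al V (Suc 0))"
  using tensor_comul(2)[OF assms] by (simp add: primitive_def prim_map_comp add_commute)

text \<open>
  The universal property of the tensor bialgebra. Compatibility with comultiplication and counit are
  equations between algebra morphisms out of a tensor algebra, and on generators they say that \<open>f\<close>
  is primitive, respectively that the counit vanishes on \<open>f\<close>.
\<close>

lemma primitive_lift_bialgebra_hom:
  assumes B [simp]: "is_bialgebra M B" and f: "primitive B f" and V [simp]: "V \<in> Obj M"
    and h: "is_algebra_hom M (TA V) B h" and hf: "h \<cdot> al V (Suc 0) = f"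
  shows "is_bialgebra_hom M (TB V) B h"
proof -
  note [simp] = algebra_homD(1-3)[OF h, simplified] algebra_homD(5)[OF h, simplified] primitiveD(1,2)[OF f]
  have d [simp]: "Dom M f = V" using hf[symmetric] by simp
  have "Comul B \<cdot> h = (h \<otimes> h) \<cdot> Comul (TB V)"
  proof (rule tensor_hom_ext[of V "B \<boxtimes> B"])
    show "is_algebra_hom M (TA V) (B \<boxtimes> B) (Comul B \<cdot> h)"
      by (rule algebra_hom_comp[OF h bialgebra_laws(1)[OF B]]) auto
    show "is_algebra_hom M (TA V) (B \<boxtimes> B) ((h \<otimes> h) \<cdot> Comul (TB V))"
      by (rule algebra_hom_comp[OF tensor_comul(1)[OF V] tensor_product_hom[OF h h]]) auto
    have "(Comul B \<cdot> h) \<cdot> al V (Suc 0) = prim_map B \<cdot> f"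
      by (simp add: hf primitiveD(3)[OF f])
    also have "\<dots> = ((h \<otimes> h) \<cdot> Comul (TB V)) \<cdot> al V (Suc 0)"
      by (simp add: prim_map_comp tensor_comul(2) comp_add') (simp add: merge hf add_commute)
    finally show "(Comul B \<cdot> h) \<cdot> al V (Suc 0) = ((h \<otimes> h) \<cdot> Comul (TB V)) \<cdot> al V (Suc 0)" .
  qed auto
  moreover have "Counit B \<cdot> h = Counit (TB V)"
  proof (rule tensor_hom_ext[of V "unit_alg M"])
    show "is_algebra_hom M (TA V) (unit_alg M) (Counit B \<cdot> h)"
      by (rule algebra_hom_comp[OF h bialgebra_laws(2)[OF B]]) auto
    show "(Counit B \<cdot> h) \<cdot> al V (Suc 0) = Counit (TB V) \<cdot> al V (Suc 0)"
      by (simp add: hf counit_primitive[OF f B] tensor_counit(2))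
  qed (auto simp: tensor_counit)
  ultimately show ?thesis
    using h by (simp add: is_bialgebra_hom_def)
qed

lemma tensor_arr_bialgebra_hom:
  assumes [simp]: "f \<in> Arr M"
  shows "is_bialgebra_hom M (TB (Dom M f)) (TB (Cod M f)) (tensor_arr M al f)"
proof (rule primitive_lift_bialgebra_hom[where f = "al (Cod M f) (Suc 0) \<cdot> f"])
  show "primitive (TB (Cod M f)) (al (Cod M f) (Suc 0) \<cdot> f)"
    by (rule primitive_comp[OF primitive_generator]) auto
  show "tensor_arr M al f \<cdot> al (Dom M f) (Suc 0) = al (Cod M f) (Suc 0) \<cdot> f"
    using tensor_arr_arr(4)[OF assms, of "Suc 0"] by simp
qed (auto simp: tensor_arr_hom)

lemma tensor_bialg_functor_simps [simp]:
  "FO (tensor_bialg_functor M al) V = TB V"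
  "FA (tensor_bialg_functor M al) f = (TB (Dom M f), tensor_arr M al f, TB (Cod M f))"
  by (simp_all add: tensor_bialg_functor_def tensor_functor_def)

lemma tensor_bialg_functor: "is_functor M (Bialg M) (tensor_bialg_functor M al)"
proof -
  have ident: "tensor_arr M al (\<one>\<^sub>a X) = \<one>\<^sub>a (T X)" if [simp]: "X \<in> Obj M" for X
  proof (rule tensor_hom_ext[of X "TA X"])
    show "is_algebra_hom M (TA X) (TA X) (tensor_arr M al (\<one>\<^sub>a X))"
      using tensor_arr_hom[of "\<one>\<^sub>a X"] by simp
    show "is_algebra_hom M (TA X) (TA X) (\<one>\<^sub>a (T X))"
      using algebra_hom_ident[of "TA X"] by simp
    show "tensor_arr M al (\<one>\<^sub>a X) \<cdot> al X (Suc 0) = \<one>\<^sub>a (T X) \<cdot> al X (Suc 0)"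
      using tensor_arr_arr(4)[of "\<one>\<^sub>a X" "Suc 0"] by simp
  qed (auto simp: tensor_mul)
  have comp: "tensor_arr M al (g \<cdot> f) = tensor_arr M al g \<cdot> tensor_arr M al f"
    if [simp]: "f \<in> Arr M" "g \<in> Arr M" and eq [simp]: "Dom M g = Cod M f" for f g
  proof (rule tensor_hom_ext[of "Dom M f" "TA (Cod M g)"])
    note gen = tensor_arr_arr(4)[where n = "Suc 0"]
    show "is_algebra_hom M (TA (Dom M f)) (TA (Cod M g)) (tensor_arr M al (g \<cdot> f))"
      using tensor_arr_hom[of "g \<cdot> f"] by simp
    show "is_algebra_hom M (TA (Dom M f)) (TA (Cod M g)) (tensor_arr M al g \<cdot> tensor_arr M al f)"
      using algebra_hom_comp[OF tensor_arr_hom[of f] tensor_arr_hom[of g, unfolded eq]] by simp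
    show "tensor_arr M al (g \<cdot> f) \<cdot> al (Dom M f) (Suc 0) = (tensor_arr M al g \<cdot> tensor_arr M al f) \<cdot>
        al (Dom M f) (Suc 0)"
      using gen[of "g \<cdot> f"] gen[of f] gen[of g]
      by (simp add: tensor_arr_arr(1-3) comp_tail[OF gen[of g, unfolded eq]])
  qed (auto simp: tensor_mul)
  show ?thesis
    unfolding is_functor_def
    by (intro conjI ballI impI category_axioms Bialg_category)
      (simp_all add: tensor_arr_bialgebra_hom ident comp)
qed

end

section \<open>The adjunction between the tensor bialgebra and the primitive part\<close>

locale primitive_parts = tensor_bialgebras M al
  for M :: "('o, 'a, 'z) pabrcat_scheme" (structure) and al :: "'o \<Rightarrow> nat \<Rightarrow> 'a" +
  fixes xi :: "('o, 'a) bialg \<Rightarrow> 'a"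
  assumes xi: "is_bialgebra M B \<Longrightarrow> is_primitive_part M B (xi B)"
begin

abbreviation PO where "PO B \<equiv> Dom M (xi B)"

lemma xi_equalizer: "is_bialgebra M B \<Longrightarrow> is_equalizer M (Comul B) (prim_map B) (xi B)"
  using xi[of B] by (simp only: is_primitive_part_def prim_map_def)

lemma xi_primitive: "is_bialgebra M B \<Longrightarrow> primitive B (xi B)"
  using xi_equalizer[of B] unfolding is_equalizer_def primitive_def by simp

lemma xi_arr [simp]:
  assumes "is_bialgebra M B"
  shows "xi B \<in> Arr M" "Cod M (xi B) = Carr B"
  using primitiveD[OF xi_primitive[OF assms]] by auto

lemma xi_factor:
  assumes "is_bialgebra M B" "primitive B f" "Dom M f = X"
  shows "\<exists>!k. k \<in> Hom M X (PO B) \<and> xi B \<cdot> k = f"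
proof -
  have "\<forall>h\<in>Arr M. Cod M h = Dom M (Comul B) \<and> Comul B \<cdot> h = prim_map B \<cdot> h \<longrightarrow>
      (\<exists>!k. k \<in> Hom M (Dom M h) (PO B) \<and> xi B \<cdot> k = h)"
    using xi_equalizer[OF assms(1)] unfolding is_equalizer_def by blast
  from this[rule_format, of f] show ?thesis
    using primitiveD[OF assms(2)] assms(1,3) by (simp only: bialgebraD simp_thms)
qed

lemma xi_mono:
  assumes B: "is_bialgebra M B" and [simp]: "g \<in> Arr M" "h \<in> Arr M"
    and [simp]: "Cod M g = PO B" "Cod M h = PO B" "Dom M g = Dom M h" and eq: "xi B \<cdot> g = xi B \<cdot> h"
  shows "g = h"
proof -
  note [simp] = B
  let ?Q = "\<lambda>k. k \<in> Hom M (Dom M h) (PO B) \<and> xi B \<cdot> k = xi B \<cdot> h"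
  have "\<exists>!k. ?Q k"
    by (rule xi_factor[OF B primitive_comp[OF xi_primitive[OF B]]]) auto
  moreover have "?Q g" using eq by simp
  moreover have "?Q h" by simp
  ultimately show ?thesis by blast
qed

lemma primitive_functor_FO [simp]: "FO (primitive_functor M xi) B = PO B"
  by (simp add: primitive_functor_def)

abbreviation PA where "PA \<equiv> FA (primitive_functor M xi)"

text \<open>
  \<open>PA (A, f, B)\<close> is the restriction of \<open>f\<close> to primitive parts, which exists because bialgebra morphisms
  preserve primitive elements.
\<close>

lemma PA_arr:
  assumes [simp]: "is_bialgebra M A" "is_bialgebra M B" and f: "is_bialgebra_hom M A B f"
  shows "PA (A, f, B) \<in> Arr M" "Dom M (PA (A, f, B)) = PO A" "Cod M (PA (A, f, B)) = PO B"
    "xi B \<cdot> PA (A, f, B) = f \<cdot> xi A"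
proof -
  note [simp] = bialgebra_homD(2-4)[OF f]
  have "\<exists>!h. h \<in> Hom M (PO A) (PO B) \<and> xi B \<cdot> h = f \<cdot> xi A"
    by (rule xi_factor[OF _ primitive_hom[OF xi_primitive f]]) auto
  from theI'[OF this] show "PA (A, f, B) \<in> Arr M" "Dom M (PA (A, f, B)) = PO A" "Cod M (PA (A, f, B)) =
      PO B"
    "xi B \<cdot> PA (A, f, B) = f \<cdot> xi A"
    by (simp_all add: primitive_functor_def)
qed

lemma Bialg_arrE:
  assumes "F \<in> Arr (Bialg M)"
  obtains A f B where "F = (A, f, B)" "is_bialgebra M A" "is_bialgebra M B" "is_bialgebra_hom M A B f"
  using assms by (cases F) simp

lemma primitive_functor: "is_functor (Bialg M) M (primitive_functor M xi)"
  unfolding is_functor_def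
proof (intro conjI ballI impI category_axioms Bialg_category)
  fix F assume "F \<in> Arr (Bialg M)"
  then show "PA F \<in> Hom M (FO (primitive_functor M xi) (Dom (Bialg M) F)) (FO (primitive_functor M xi) (Cod (Bialg M) F))"
    by (rule Bialg_arrE) (simp add: PA_arr)
next
  fix B assume "B \<in> Obj (Bialg M)"
  then have B [simp]: "is_bialgebra M B" by simp
  have i: "is_bialgebra_hom M B B (\<one>\<^sub>a (Carr B))"
    using category.ident_hom[OF Bialg_category, of B] by simp
  have "PA (B, \<one>\<^sub>a (Carr B), B) = \<one>\<^sub>a (PO B)"
    by (rule xi_mono[OF B]) (simp_all add: PA_arr[OF B B i])
  then show "PA (Ident (Bialg M) B) = \<one>\<^sub>a (FO (primitive_functor M xi) B)" by simp
next
  fix F G assume F: "F \<in> Arr (Bialg M)" and G: "G \<in> Arr (Bialg M)" and FG: "Dom (Bialg M) G =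
      Cod (Bialg M) F"
  obtain A f B where F': "F = (A, f, B)" and AB [simp]: "is_bialgebra M A"
      "is_bialgebra M B" and f: "is_bialgebra_hom M A B f"
    by (rule Bialg_arrE[OF F])
  obtain B' g D where "G = (B', g, D)" and D [simp]: "is_bialgebra M D" and "is_bialgebra_hom M B' D g"
    by (rule Bialg_arrE[OF G])
  moreover have "B' = B" using FG F' calculation(1) by simp
  ultimately have G': "G = (B, g, D)" and g: "is_bialgebra_hom M B D g" by simp_all
  have gf: "is_bialgebra_hom M A D (g \<cdot> f)"
    using category.comp_arr(1)[OF Bialg_category F G FG] unfolding F' G' by simp
  note [simp] = PA_arr(1-3)[OF AB f] PA_arr(1-3)[OF AB(2) D g] PA_arr(1-3)[OF AB(1) D gf]
    bialgebra_homD(2-4)[OF f] bialgebra_homD(2-4)[OF g]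
  have "PA (A, g \<cdot> f, D) = PA (B, g, D) \<cdot> PA (A, f, B)"
    by (rule xi_mono[OF D])
      (simp_all add: PA_arr(4)[OF AB(1) D gf] comp_tail[OF PA_arr(4)[OF AB(2) D g]] PA_arr(4)[OF AB f])
  then show "PA (G \<cdot>\<^bsub>Bialg M\<^esub> F) = PA G \<cdot> PA F"
    unfolding F' G' by simp
qed simp_all

lemma bialg_unit_arr:
  assumes [simp]: "V \<in> Obj M"
  shows "bialg_unit M al xi V \<in> Arr M" "Dom M (bialg_unit M al xi V) = V"
      "Cod M (bialg_unit M al xi V) = PO (TB V)"
    "xi (TB V) \<cdot> bialg_unit M al xi V = al V (Suc 0)"
proof -
  have "\<exists>!h. h \<in> Hom M V (PO (TB V)) \<and> xi (TB V) \<cdot> h = al V (Suc 0)"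
    by (rule xi_factor[OF _ primitive_generator]) auto
  from theI'[OF this] show "bialg_unit M al xi V \<in> Arr M" "Dom M (bialg_unit M al xi V) = V"
      "Cod M (bialg_unit M al xi V) = PO (TB V)"
    "xi (TB V) \<cdot> bialg_unit M al xi V = al V (Suc 0)"
    by (simp_all add: bialg_unit_def tensor_unit_def)
qed

lemma bialg_unit_nat: "nat_trans M M id_functor (primitive_functor M xi \<circ>\<^sub>F tensor_bialg_functor M al) (bialg_unit M al xi)"
  unfolding nat_trans_def
proof (intro conjI ballI is_functor_id is_functor_comp[OF tensor_bialg_functor primitive_functor] category_axioms)
  fix f assume [simp]: "f \<in> Arr M"
  let ?V = "Dom M f" and ?W = "Cod M f"
  note h = tensor_arr_bialgebra_hom[of f]
  note [simp] = bialg_unit_arr(1-3) PA_arr(1-3)[OF _ _ h] tensor_arr_arr(1-3)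
  have "PA (TB ?V, tensor_arr M al f, TB ?W) \<cdot> bialg_unit M al xi ?V = bialg_unit M al xi ?W \<cdot> f"
  proof (rule xi_mono[of "TB ?W"])
    show "xi (TB ?W) \<cdot> PA (TB ?V, tensor_arr M al f, TB ?W) \<cdot> bialg_unit M al xi ?V = xi (TB ?W) \<cdot>
        bialg_unit M al xi ?W \<cdot> f"
      using tensor_arr_arr(4)[of f "Suc 0"]
      by (simp add: comp_tail[OF PA_arr(4)[OF _ _ h]] bialg_unit_arr(4) comp_tail[OF bialg_unit_arr(4)])
  qed auto
  then show "FA (primitive_functor M xi \<circ>\<^sub>F tensor_bialg_functor M al) f \<cdot> bialg_unit M al xi (Dom M f)
      = bialg_unit M al xi (Cod M f) \<cdot> FA id_functor f"
    by simp
qed (auto simp: bialg_unit_arr)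

abbreviation eps_arr :: "('o, 'a) bialg \<Rightarrow> 'a" where
  "eps_arr B \<equiv> und (bialg_counit M al xi B)"

lemma bialg_counit_triple: "bialg_counit M al xi B = (TB (PO B), eps_arr B, B)"
  by (simp add: bialg_counit_def)

lemma bialg_counit_ends:
  "fst (bialg_counit M al xi B) = TB (PO B)" "snd (snd (bialg_counit M al xi B)) = B"
  by (simp_all add: bialg_counit_def)

text \<open>
  The counit of the adjunction multiplies words of primitive elements; it is the algebra morphism
  that extends the inclusion \<open>xi B\<close>.
\<close>

lemma eps_arr_props:
  assumes B [simp]: "is_bialgebra M B"
  shows "is_algebra_hom M (TA (PO B)) B (eps_arr B)" "eps_arr B \<cdot> al (PO B) (Suc 0) = xi B"
proof -
  let ?B = "alg.truncate B"
  have A [simp]: "is_algebra M ?B" by (simp add: truncate_algebra)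
  have e: "eps_arr B = mult_out ?B \<cdot> tensor_arr M al (xi B)"
    by (simp add: bialg_counit_def forget_bialg_def tensor_functor_def Alg_def structure_cat_def)
  note x = tensor_arr_arr[of "xi B", simplified] and m = mult_out_arr[OF A, simplified]
  show "is_algebra_hom M (TA (PO B)) B (eps_arr B)"
    unfolding e using algebra_hom_comp[OF tensor_arr_hom[of "xi B", simplified] mult_out_hom[OF A, simplified]]
    by (simp add: truncate_algebra)
  show "eps_arr B \<cdot> al (PO B) (Suc 0) = xi B"
    unfolding e using x(4)[of "Suc 0"] by (simp add: x(1-3) m(1-3) comp_tail[OF m(4)])
qed

lemma eps_arr_bialgebra_hom:
  assumes B [simp]: "is_bialgebra M B"
  shows "is_bialgebra_hom M (TB (PO B)) B (eps_arr B)"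
  by (rule primitive_lift_bialgebra_hom[OF B xi_primitive[OF B] _ eps_arr_props[OF B]]) simp

lemma eps_arr_arr [simp]:
  assumes B [simp]: "is_bialgebra M B"
  shows "eps_arr B \<in> Arr M" "Dom M (eps_arr B) = T (PO B)" "Cod M (eps_arr B) = Carr B"
  using bialgebra_homD(2-4)[OF eps_arr_bialgebra_hom[OF B]] by simp_all

lemma bialg_counit_nat:
  "nat_trans (Bialg M) (Bialg M) (tensor_bialg_functor M al \<circ>\<^sub>F primitive_functor M xi) id_functor (bialg_counit M al xi)"
  unfolding nat_trans_def
proof (intro conjI ballI is_functor_id is_functor_comp[OF primitive_functor tensor_bialg_functor] Bialg_category)
  fix B assume "B \<in> Obj (Bialg M)"
  then have [simp]: "is_bialgebra M B" by simp
  show "bialg_counit M al xi B \<in> Hom (Bialg M) (FO (tensor_bialg_functor M al \<circ>\<^sub>F primitive_functor M xi) B) (FO id_functor B)"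
    by (subst bialg_counit_triple) (simp add: eps_arr_bialgebra_hom)
next
  fix F assume "F \<in> Arr (Bialg M)"
  then obtain A f B where F: "F = (A, f, B)" and AB [simp]: "is_bialgebra M A"
      "is_bialgebra M B" and f: "is_bialgebra_hom M A B f"
    by (rule Bialg_arrE)
  note p = PA_arr[OF AB f]
  note [simp] = p(1-3) bialgebra_homD(2-4)[OF f] tensor_arr_arr(1-3)
  have t: "tensor_arr M al (PA (A, f, B)) \<cdot> al (PO A) (Suc 0) = al (PO B) (Suc 0) \<cdot> PA (A, f, B)"
    using tensor_arr_arr(4)[OF p(1), of "Suc 0"] by simp
  have "f \<cdot> eps_arr A = eps_arr B \<cdot> tensor_arr M al (PA (A, f, B))"
  proof (rule tensor_hom_ext[of "PO A" B])
    show "is_algebra_hom M (TA (PO A)) B (f \<cdot> eps_arr A)"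
      by (rule algebra_hom_comp[OF eps_arr_props(1) bialgebra_homD(1)[OF f]]) auto
    show "is_algebra_hom M (TA (PO A)) B (eps_arr B \<cdot> tensor_arr M al (PA (A, f, B)))"
      using algebra_hom_comp[OF tensor_arr_hom[OF p(1)], unfolded p(2,3), OF eps_arr_props(1)] by simp
    show "(f \<cdot> eps_arr A) \<cdot> al (PO A) (Suc 0) = (eps_arr B \<cdot> tensor_arr M al (PA (A, f, B))) \<cdot>
        al (PO A) (Suc 0)"
      by (simp add: t eps_arr_props(2) comp_tail[OF eps_arr_props(2)] p(4))
  qed auto
  then show "FA id_functor F \<cdot>\<^bsub>Bialg M\<^esub> bialg_counit M al xi (Dom (Bialg M) F)
      = bialg_counit M al xi (Cod (Bialg M) F) \<cdot>\<^bsub>Bialg M\<^esub> FA (tensor_bialg_functor M al \<circ>\<^sub>F primitive_functor M xi) F"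
    unfolding F by (simp add: bialg_counit_ends)
qed

lemma tensor_primitive_adjunction:
  "adjunction M (Bialg M) (tensor_bialg_functor M al) (primitive_functor M xi) (bialg_unit M al xi) (bialg_counit M al xi)"
  unfolding adjunction_def
proof (intro conjI ballI bialg_unit_nat bialg_counit_nat)
  fix V assume [simp]: "V \<in> Obj M"
  note u = bialg_unit_arr[of V, simplified]
  note [simp] = u(1-3) tensor_arr_arr(1-3)[of "bialg_unit M al xi V", simplified]
  have t: "tensor_arr M al (bialg_unit M al xi V) \<cdot> al V (Suc 0) = al (PO (TB V)) (Suc 0) \<cdot>
      bialg_unit M al xi V"
    using tensor_arr_arr(4)[of "bialg_unit M al xi V" "Suc 0"] by simp
  have "eps_arr (TB V) \<cdot> tensor_arr M al (bialg_unit M al xi V) = \<one>\<^sub>a (T V)"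
  proof (rule tensor_hom_ext[of V "TA V"])
    show "is_algebra_hom M (TA V) (TA V) (eps_arr (TB V) \<cdot> tensor_arr M al (bialg_unit M al xi V))"
      using algebra_hom_comp[OF tensor_arr_hom[of "bialg_unit M al xi V", simplified] eps_arr_props(1)[of "TB V", simplified]] by simp
    show "is_algebra_hom M (TA V) (TA V) (\<one>\<^sub>a (T V))"
      using algebra_hom_ident[of "TA V"] by simp
    show "(eps_arr (TB V) \<cdot> tensor_arr M al (bialg_unit M al xi V)) \<cdot> al V (Suc 0) = \<one>\<^sub>a (T V) \<cdot>
        al V (Suc 0)"
      by (simp add: t comp_tail[OF eps_arr_props(2)] u(4))
  qed (auto simp: tensor_mul)
  then show "bialg_counit M al xi (FO (tensor_bialg_functor M al) V) \<cdot>\<^bsub>Bialg M\<^esub> FA (tensor_bialg_functor M al) (bialg_unit M al xi V)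
      = \<one>\<^sub>a\<^bsub>Bialg M\<^esub> (FO (tensor_bialg_functor M al) V)"
    by (simp add: bialg_counit_ends)
next
  fix B assume "B \<in> Obj (Bialg M)"
  then have B [simp]: "is_bialgebra M B" by simp
  have P [simp]: "PO B \<in> Obj M" by simp
  note p = PA_arr[OF tensor_bialgebra[OF P] B eps_arr_bialgebra_hom[OF B]] and u = bialg_unit_arr[OF P]
  have "PA (TB (PO B), eps_arr B, B) \<cdot> bialg_unit M al xi (PO B) = \<one>\<^sub>a (PO B)"
    by (rule xi_mono[OF B]) (simp_all add: p(1-3) u comp_tail[OF p(4)] eps_arr_props(2))
  then show "PA (bialg_counit M al xi B) \<cdot> bialg_unit M al xi (FO (primitive_functor M xi) B) =
      \<one>\<^sub>a (FO (primitive_functor M xi) B)"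
    by (subst bialg_counit_triple) simp
qed

section \<open>The projection onto generators\<close>

abbreviation om where "om V \<equiv> tensor_proj M al V"

lemma tensor_proj_arr:
  assumes [simp]: "V \<in> Obj M"
  shows "om V \<in> Arr M" "Dom M (om V) = T V" "Cod M (om V) = V"
    "om V \<cdot> al V (Suc 0) = \<one>\<^sub>a V" "n \<noteq> Suc 0 \<Longrightarrow> om V \<cdot> al V n = Zero M (tpow M V n) V"
proof -
  have "\<exists>!h. h \<in> Hom M (T V) V \<and> (\<forall>n. h \<cdot> al V n = (if n = 1 then \<one>\<^sub>a V else Zero M (tpow M V n) V))"
    by (rule coproduct_lift[OF tensor_coproduct]) auto
  from theI'[OF this] have "om V \<in> Hom M (T V) V \<and> (\<forall>n. om V \<cdot> al V n = (if n =
      1 then \<one>\<^sub>a V else Zero M (tpow M V n) V))"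
    by (simp add: tensor_proj_def forget_alg_def tensor_functor_def)
  then show "om V \<in> Arr M" "Dom M (om V) = T V" "Cod M (om V) = V"
    "om V \<cdot> al V (Suc 0) = \<one>\<^sub>a V" "n \<noteq> Suc 0 \<Longrightarrow> om V \<cdot> al V n = Zero M (tpow M V n) V"
    by simp_all
qed

lemma tensor_proj_natural:
  assumes [simp]: "f \<in> Arr M"
  shows "om (Cod M f) \<cdot> tensor_arr M al f = f \<cdot> om (Dom M f)"
proof (rule tensor_ext[of "Dom M f"])
  note [simp] = tensor_proj_arr tensor_arr_arr
  show "(om (Cod M f) \<cdot> tensor_arr M al f) \<cdot> al (Dom M f) n = (f \<cdot> om (Dom M f)) \<cdot> al (Dom M f) n" for n
    by (cases "n =
        Suc 0") (simp_all add: comp_tail[OF tensor_proj_arr(4)] comp_tail[OF tensor_proj_arr(5)])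
qed (auto simp: tensor_proj_arr tensor_arr_arr)

lemma tensor_counit_positive:
  assumes [simp]: "V \<in> Obj M"
  shows "Counit (TB V) \<cdot> al V (Suc n) = Zero M (tpow M V (Suc n)) (UnitO M)"
  by (subst tensor_hom_Suc[OF assms tensor_counit(1)[OF assms]]) (simp_all add: tensor_counit(2))

text \<open>
  A product of two words has a component of degree one only if one word has degree one and the other
  has degree zero, and the counit is the projection onto degree zero. Hence the projection \<open>om V\<close> is
  a derivation with respect to the counit.
\<close>

lemma tensor_proj_derivation:
  assumes [simp]: "V \<in> Obj M"
  shows "om V \<cdot> Mul (TA V) = (RUnit M V \<cdot> (om V \<otimes> Counit (TB V))) \<oplus> (LUnit M V \<cdot>
      (Counit (TB V) \<otimes> om V))"
    (is "?L = ?R")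
proof (rule tensor_ext2[of V V])
  note [simp] = tensor_proj_arr tensor_mul(1-3)
  fix i j
  have L: "?L \<cdot> (al V i \<otimes> al V j) = om V \<cdot> al V (i + j) \<cdot> concat_iso M V i j"
    by (simp add: tensor_mul(4))
  have R: "?R \<cdot> (al V i \<otimes> al V j) = (RUnit M V \<cdot> ((om V \<cdot> al V i) \<otimes> (Counit (TB V) \<cdot> al V j))) \<oplus>
      (LUnit M V \<cdot> ((Counit (TB V) \<cdot> al V i) \<otimes> (om V \<cdot> al V j)))"
    by (simp add: add_comp' merge)
  \<comment> \<open>Only \<open>i + j = 1\<close> contributes, and there \<open>concat_iso\<close> is a unit constraint.\<close>
  consider "i = 0" "j = 0" | "i = 0" "j = Suc 0" | "i = Suc 0" "j = 0" | k where "i = 0" "j =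
      Suc (Suc k)"
    | k where "i = Suc (Suc k)" "j = 0" | k l where "i = Suc k" "j = Suc l"
    by (metis not0_implies_Suc)
  then show "?L \<cdot> (al V i \<otimes> al V j) = ?R \<cdot> (al V i \<otimes> al V j)"
    unfolding L R
    by cases (simp_all add: tensor_counit_positive comp_tail[OF tensor_proj_arr(4)] comp_tail[OF tensor_proj_arr(5)] del: tpow.simps(3) concat_iso.simps(4))
qed (auto simp: tensor_proj_arr tensor_mul)

lemma tensor_proj_mul_augmented:
  assumes [simp]: "V \<in> Obj M" "f \<in> Arr M" "g \<in> Arr M" "Cod M f = T V" "Cod M g = T V"
    and f: "Counit (TB V) \<cdot> f = Zero M (Dom M f) (UnitO M)" and g: "Counit (TB V) \<cdot> g =
        Zero M (Dom M g) (UnitO M)"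
  shows "om V \<cdot> Mul (TA V) \<cdot> (f \<otimes> g) = Zero M (Dom M f \<odot> Dom M g) V"
proof -
  note [simp] = tensor_proj_arr(1-3) tensor_mul(1-3)
  show ?thesis
    by (simp add: comp_tail[OF tensor_proj_derivation] add_comp' merge f g)
qed

text \<open>
  The two arrows from the tensor algebra on the primitive part are compared in each degree. In degree
  one both are \<open>om V \<cdot> xi (TB V)\<close>. In degree zero both vanish, since \<open>om V\<close> kills the unit. In
  higher degree the left-hand side is the projection of a product of at least two primitive elements.
  The counit vanishes on the last factor because it is primitive, and on the product of the others
  because it is multiplicative; so the derivation rule gives zero.
\<close>

lemma tensor_proj_counit:
  assumes V [simp]: "V \<in> Obj M"
  shows "om V \<cdot> eps_arr (TB V) = (om V \<cdot> xi (TB V)) \<cdot> om (PO (TB V))"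
proof (rule tensor_ext[of "PO (TB V)"])
  let ?B = "TB V" and ?W = "PO (TB V)"
  have W [simp]: "?W \<in> Obj M" by simp
  note [simp] = tensor_proj_arr[OF V] tensor_proj_arr[OF W]
  have e: "is_algebra_hom M (TA ?W) (TA V) (eps_arr ?B)"
    using eps_arr_props(1)[of ?B] by simp
  have gen: "eps_arr ?B \<cdot> al ?W (Suc 0) = xi ?B"
    by (rule eps_arr_props(2)) simp
  fix n
  consider "n = 0" | "n = Suc 0" | k where "n = Suc (Suc k)" by (metis not0_implies_Suc)
  then show "(om V \<cdot> eps_arr ?B) \<cdot> al ?W n = ((om V \<cdot> xi ?B) \<cdot> om ?W) \<cdot> al ?W n"
  proof cases
    case 1
    then show ?thesis using algebra_homD(5)[OF e] by simp
  next
    case 2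
    then show ?thesis by (simp add: gen)
  next
    case (3 k)
    have "Counit ?B \<cdot> eps_arr ?B = Counit (TB ?W)"
      by (rule bialgebra_homD(6)[OF eps_arr_bialgebra_hom]) simp
    then have p: "Counit ?B \<cdot> (eps_arr ?B \<cdot> al ?W (Suc k)) = Zero M (tpow M ?W (Suc k)) (UnitO M)"
      using tensor_counit_positive[OF W, of k] by (subst comp_tail) simp_all
    have q: "Counit ?B \<cdot> xi ?B = Zero M ?W (UnitO M)"
      by (rule counit_primitive[OF xi_primitive]) simp_all
    have "(om V \<cdot> eps_arr ?B) \<cdot> al ?W n = om V \<cdot> (eps_arr ?B \<cdot> al ?W (Suc (Suc k)))"
      unfolding 3 by simp
    also have "\<dots> = om V \<cdot> (Mul (TA V) \<cdot> ((eps_arr ?B \<cdot> al ?W (Suc k)) \<otimes> xi ?B) \<cdot>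
        inv_arr M (snoc_iso ?W (Suc k)))"
      by (subst tensor_hom_Suc[OF W e]) (simp_all only: gen tensor_mul[OF V] tensor_alg_simps)
    also have "\<dots> = Zero M (tpow M ?W n) V"
    proof -
      have "om V \<cdot> Mul (TA V) \<cdot> ((eps_arr ?B \<cdot> al ?W (Suc k)) \<otimes> xi ?B) =
          Zero M (tpow M ?W (Suc k) \<odot> ?W) V"
        by (subst tensor_proj_mul_augmented) (simp_all add: p q)
      from comp_tail3[OF this, of "inv_arr M (snoc_iso ?W (Suc k))"] show ?thesis
        unfolding 3 by (simp add: tensor_mul)
    qed
    also have "\<dots> = ((om V \<cdot> xi ?B) \<cdot> om ?W) \<cdot> al ?W n"
      unfolding 3 by simp
    finally show ?thesis .
  qed
qed (auto simp: tensor_proj_arr)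

abbreviation gam where "gam \<equiv> gamma_trans M al xi"

lemma gamma_arr:
  assumes [simp]: "V \<in> Obj M"
  shows "gam V = om V \<cdot> xi (TB V)" "gam V \<in> Arr M" "Dom M (gam V) = PO (TB V)" "Cod M (gam V) = V"
  by (simp_all add: gamma_trans_def tensor_proj_arr)

lemma gamma_nat: "nat_trans M M (primitive_functor M xi \<circ>\<^sub>F tensor_bialg_functor M al) id_functor gam"
  unfolding nat_trans_def
proof (intro conjI ballI is_functor_id is_functor_comp[OF tensor_bialg_functor primitive_functor] category_axioms)
  fix f assume [simp]: "f \<in> Arr M"
  let ?V = "Dom M f" and ?W = "Cod M f"
  note h = tensor_arr_bialgebra_hom[of f]
  note [simp] = PA_arr(1-3)[OF _ _ h] tensor_arr_arr(1-3) tensor_proj_arr(1-3)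
  have "f \<cdot> gam ?V = gam ?W \<cdot> PA (TB ?V, tensor_arr M al f, TB ?W)"
    by (simp add: gamma_arr(1) PA_arr(4)[OF _ _ h] comp_tail[OF tensor_proj_natural])
  then show "FA id_functor f \<cdot> gam (Dom M f) = gam (Cod M f) \<cdot>
      FA (primitive_functor M xi \<circ>\<^sub>F tensor_bialg_functor M al) f"
    by simp
qed (auto simp: gamma_arr(2-4))

lemma gamma_unit:
  assumes [simp]: "V \<in> Obj M"
  shows "gam V \<cdot> bialg_unit M al xi V = \<one>\<^sub>a V"
  by (simp add: gamma_arr(1) bialg_unit_arr tensor_proj_arr)

text \<open>
  Cancelling \<open>xi\<close> of the tensor bialgebra on \<open>PO (TB V)\<close>, both sides reduce to \<open>tensor_proj_counit\<close>:
  the left one by naturality of \<open>om\<close>, the right one by the description of \<open>eps_arr\<close> on primitive parts.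
\<close>

lemma gamma_square:
  assumes V [simp]: "V \<in> Obj M"
  shows "gam V \<cdot> PA (FA (tensor_bialg_functor M al) (gam V)) = gam V \<cdot> PA (bialg_counit M al xi (TB V))"
proof -
  let ?B = "TB V" and ?W = "PO (TB V)"
  have W [simp]: "?W \<in> Obj M" by simp
  note g = gamma_arr[OF V]
  note [simp] = g(2-4) tensor_proj_arr(1-3)
  have h: "is_bialgebra_hom M (TB ?W) ?B (tensor_arr M al (gam V))"
    using tensor_arr_bialgebra_hom[OF g(2)] by simp
  have t: "tensor_arr M al (gam V) \<in> Arr M" "Dom M (tensor_arr M al (gam V)) = T ?W"
      "Cod M (tensor_arr M al (gam V)) = T V"
    using tensor_arr_arr(1-3)[OF g(2)] by simp_all
  have e: "is_bialgebra_hom M (TB ?W) ?B (eps_arr ?B)"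
    by (rule eps_arr_bialgebra_hom) simp
  have B: "is_bialgebra M (TB ?W)" "is_bialgebra M ?B" by simp_all
  note p = PA_arr[OF B h] and q = PA_arr[OF B e]
  have n: "om V \<cdot> tensor_arr M al (gam V) = gam V \<cdot> om ?W"
    using tensor_proj_natural[OF g(2)] by simp
  have k: "om V \<cdot> eps_arr ?B = gam V \<cdot> om ?W"
    using tensor_proj_counit[OF V] unfolding g(1) .
  have "gam V \<cdot> PA (TB ?W, tensor_arr M al (gam V), ?B) = om V \<cdot> tensor_arr M al (gam V) \<cdot> xi (TB ?W)"
    by (subst g(1)) (simp add: p)
  also have "\<dots> = om V \<cdot> eps_arr ?B \<cdot> xi (TB ?W)"
    by (simp add: comp_tail[OF n] comp_tail[OF k] t)
  also have "\<dots> = gam V \<cdot> PA (TB ?W, eps_arr ?B, ?B)"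
    by (subst g(1)) (simp add: q)
  finally show ?thesis
    by (subst bialg_counit_triple) simp
qed

end

theorem theorem4p4:
  fixes M :: "('o, 'a) pabrcat"
    and al :: "'o \<Rightarrow> nat \<Rightarrow> 'a"
    and xi :: "('o, 'a) bialg \<Rightarrow> 'a"
  assumes "braided_monoidal_category M"
    and "preadditive_category M"
    and "has_equalizers M"
    and "has_denumerable_coproducts M"
    and "\<And>X. X \<in> Obj M \<Longrightarrow> additive_functor M M (tensor_left M X)"
    and "\<And>X. X \<in> Obj M \<Longrightarrow> additive_functor M M (tensor_right M X)"
    and "\<And>X. X \<in> Obj M \<Longrightarrow> preserves_equalizers M M (tensor_left M X)"
    and "\<And>X. X \<in> Obj M \<Longrightarrow> preserves_equalizers M M (tensor_right M X)"
    and "\<And>X. X \<in> Obj M \<Longrightarrow> preserves_denumerable_coproducts M M (tensor_left M X)"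
    and "\<And>X. X \<in> Obj M \<Longrightarrow> preserves_denumerable_coproducts M M (tensor_right M X)"
    and "\<And>V. V \<in> Obj M \<Longrightarrow> is_coproduct M (tpow M V) (tensor_obj M al V) (al V)"
    and "\<And>B. B \<in> Obj (Bialg M) \<Longrightarrow> is_primitive_part M B (xi B)"
  defines "T \<equiv> tensor_bialg_functor M al"
    and "P \<equiv> primitive_functor M xi"
    and "\<eta> \<equiv> bialg_unit M al xi"
    and "\<epsilon> \<equiv> bialg_counit M al xi"
    and "\<gamma> \<equiv> gamma_trans M al xi"
  shows "adjunction M (Bialg M) T P \<eta> \<epsilon> \<and>
    nat_trans M M (P \<circ>\<^sub>F T) id_functor \<gamma> \<and>
    (\<forall>V \<in> Obj M. \<gamma> V \<cdot>\<^bsub>M\<^esub> \<eta> V = \<one>\<^sub>a\<^bsub>M\<^esub> V) \<and>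
    (\<forall>V \<in> Obj M. \<gamma> V \<cdot>\<^bsub>M\<^esub> FA (P \<circ>\<^sub>F T) (\<gamma> V) = \<gamma> V \<cdot>\<^bsub>M\<^esub> FA P (\<epsilon> (FO T V))) \<and>
    h_separable M (Bialg M) T"
proof -
  interpret braided_monoidal_category M by fact
  interpret preadditive_category M by fact
  interpret primitive_parts M al xi
    by unfold_locales (use assms(5,6,9-12) in auto)
  have "h_separable M (Bialg M) T"
    unfolding T_def
    by (rule h_separable_left_adjoint[OF tensor_bialg_functor primitive_functor tensor_primitive_adjunction gamma_nat gamma_unit])
      (simp_all only: gamma_square tensor_bialg_functor_simps(1))
  then show ?thesis
    unfolding T_def P_def \<eta>_def \<epsilon>_def \<gamma>_def
    using tensor_primitive_adjunction gamma_nat gamma_unit gamma_square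
    by (simp only: comp_functor_simps tensor_bialg_functor_simps(1)) blast
qed

end
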